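(* Let $F_{15}:=(6,\{03,04,12,15\})$. Then $\lambda_{F_{15}}=45/256$. Furthermore, the $F_{15}$-problem is perfectly $B$-stable with $B:=(4,\{02,13\})$, and the unique (up to automorphisms of $B$) maximiser of $p(F_{15},B(\boldsymbol x))$ over $\boldsymbol x\in\mathbb S_4$ is $\boldsymbol x=(1/4,1/4,1/4,1/4)$.
   Context: All graphs are finite and simple. $(m,E)$ denotes the graph or pattern with vertex set $\{0,\dots,m-1\}$ and edge set $E$; $ij$ abbreviates $\{i,j\}$ ($ii$ is a loop). For graphs $F,G$ with $\kappa\le n$ vertices, $p(F,G)$ is the number of $\kappa$-subsets of $V(G)$ inducing a subgraph isomorphic to $F$, divided by $\binom n\kappa$; $p(F,n)$ is the maximum of $p(F,G)$ over $n$-vertex graphs $G$; $\lambda_F=\lim_{n\to\infty}p(F,n)$ (the limit exists). A pattern is a graph in which loops are allowed; its automorphisms are the bijections of the vertex set preserving edges, non-edges, loops and non-loops. For a pattern $B$ on $\{0,\dots,m-1\}$ and disjoint (possibly empty) sets $V_0,\dots,V_{m-1}$, the blowup $B(V_0,\dots,V_{m-1})$ is the simple graph on $\bigcup V_i$ in which distinct $x\in V_i$, $y\in V_j$ are adjacent iff $\{i,j\}\in E(B)$ (so $V_i$ is a clique if $i$ has a loop and independent otherwise); $B()$ is the family of all blowups. $\mathbb S_m=\{\boldsymbol x\in\mathbb R^m:x_i\ge0,\sum x_i=1\}$, and $p(F,B(\boldsymbol x))$ is the limit as $n\to\infty$ of $p(F,B(V_0,\dots,V_{m-1}))$ with $|V_i|=(x_i+o(1))n$.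 $\delta_{\mathrm{edit}}(G,B())$ is the minimum number of vertex pairs whose adjacency must be changed to turn $G$ into a graph isomorphic to a blowup of $B$ (of the same order). The $F$-problem is perfectly $B$-stable if there is $C>0$ such that every graph $G$ with $n\ge C$ vertices satisfies $\delta_{\mathrm{edit}}(G,B())\le C\,(p(F,n)-p(F,G))\,n^2$. *)

theory Defs
  imports Complex_Main "HOL-Library.Disjoint_Sets"
begin

(* Vertex set and edge set.  The edge ij is the set {i, j}; in particular a loop ii is the
   singleton {i}. *)
type_synonym 'a pgraph = "'a set \<times> 'a set set"

abbreviation verts :: "'a pgraph \<Rightarrow> 'a set" where
  "verts \<equiv> fst"

abbreviation edges :: "'a pgraph \<Rightarrow> 'a set set" where
  "edges \<equiv> snd"

definition pattern :: "'a pgraph \<Rightarrow> bool" where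
  "pattern B \<longleftrightarrow> finite (verts B) \<and> edges B \<subseteq> {{u, v} | u v. u \<in> verts B \<and> v \<in> verts B}"

definition simple_graph :: "'a pgraph \<Rightarrow> bool" where
  "simple_graph G \<longleftrightarrow> pattern G \<and> (\<forall>v. {v} \<notin> edges G)"

(* u = v is not excluded, so loops and non-loops are preserved as well. *)
definition isomorphism :: "('a \<Rightarrow> 'b) \<Rightarrow> 'a pgraph \<Rightarrow> 'b pgraph \<Rightarrow> bool" where
  "isomorphism f A B \<longleftrightarrow> bij_betw f (verts A) (verts B) \<and>
     (\<forall>u\<in>verts A. \<forall>v\<in>verts A. {u, v} \<in> edges A \<longleftrightarrow> {f u, f v} \<in> edges B)"

definition isomorphic :: "'a pgraph \<Rightarrow> 'b pgraph \<Rightarrow> bool" where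
  "isomorphic A B \<longleftrightarrow> (\<exists>f. isomorphism f A B)"

abbreviation automorphism :: "('a \<Rightarrow> 'a) \<Rightarrow> 'a pgraph \<Rightarrow> bool" where
  "automorphism f B \<equiv> isomorphism f B B"

definition induced :: "'a pgraph \<Rightarrow> 'a set \<Rightarrow> 'a pgraph" where
  "induced G S = (S, {e \<in> edges G. e \<subseteq> S})"

(* p(F,G); equal to 0 in the degenerate case that G has fewer vertices than F. *)
definition ind_density :: "'a pgraph \<Rightarrow> 'b pgraph \<Rightarrow> real" where
  "ind_density F G =
     real (card {S. S \<subseteq> verts G \<and> card S = card (verts F) \<and> isomorphic (induced G S) F})
     / real (card (verts G) choose card (verts F))"

(* p(F,n).  Vertices are taken in nat, which loses nothing up to isomorphism.  There are
   infinitely many such G, but only finitely many values; see the lemma below. *)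
definition max_density :: "'a pgraph \<Rightarrow> nat \<Rightarrow> real" where
  "max_density F n =
     Max {ind_density F G | G :: nat pgraph. simple_graph G \<and> card (verts G) = n}"

lemma finite_ind_density_values:
  "finite {ind_density F G | G :: nat pgraph. simple_graph G \<and> card (verts G) = n}"
proof (rule finite_subset)
  show "{ind_density F G | G :: nat pgraph. simple_graph G \<and> card (verts G) = n}
      \<subseteq> (\<lambda>k. real k / real (n choose card (verts F))) ` {..2 ^ n}"
  proof clarify
    fix V :: "nat set" and E
    assume "simple_graph (V, E)"
    then have fin: "finite V"
      by (simp add: simple_graph_def pattern_def)
    have "card {S. S \<subseteq> V \<and> card S = card (verts F) \<and> isomorphic (induced (V, E) S) F}
        \<le> card (Pow V)"
      by (rule card_mono) (use fin in auto)
    then show "ind_density F (V, E)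
        \<in> (\<lambda>k. real k / real (card (verts (V, E)) choose card (verts F))) ` {..2 ^ card (verts (V, E))}"
      by (auto simp: ind_density_def card_Pow[OF fin])
  qed
qed simp

definition blowup :: "'b pgraph \<Rightarrow> ('b \<Rightarrow> 'a set) \<Rightarrow> 'a pgraph" where
  "blowup B V = (\<Union>i\<in>verts B. V i,
     {{x, y} | x y i j. i \<in> verts B \<and> j \<in> verts B \<and> x \<in> V i \<and> y \<in> V j \<and> x \<noteq> y
        \<and> {i, j} \<in> edges B})"

definition blowup_parts :: "'b pgraph \<Rightarrow> ('b \<Rightarrow> 'a set) \<Rightarrow> bool" where
  "blowup_parts B V \<longleftrightarrow> disjoint_family_on V (verts B) \<and> (\<forall>i\<in>verts B. finite (V i))"

definition blowups :: "'b pgraph \<Rightarrow> 'a pgraph set" where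
  "blowups B = {blowup B V | V. blowup_parts B V}"

definition edit_distance :: "'a pgraph \<Rightarrow> 'b pgraph \<Rightarrow> nat" where
  "edit_distance G B =
     Inf {card ((edges G - edges H) \<union> (edges H - edges G)) | H :: 'a pgraph.
       simple_graph H \<and> verts H = verts G \<and> (\<exists>K \<in> (blowups B :: 'a pgraph set). isomorphic H K)}"

definition perfectly_stable :: "'a pgraph \<Rightarrow> 'b pgraph \<Rightarrow> bool" where
  "perfectly_stable F B \<longleftrightarrow>
     (\<exists>C::real. C > 0 \<and>
       (\<forall>G :: nat pgraph. simple_graph G \<longrightarrow> real (card (verts G)) \<ge> C \<longrightarrow>
          real (edit_distance G B)
            \<le> C * (max_density F (card (verts G)) - ind_density F G) * (real (card (verts G)))\<^sup>2))"

definition weights :: "'b set \<Rightarrow> ('b \<Rightarrow> real) set" where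
  "weights I = {x. (\<forall>i\<in>I. 0 \<le> x i) \<and> (\<Sum>i\<in>I. x i) = 1}"

(* p(F,B(x)): the common limit over all sequences of blowups with |V_i| = (x_i + o(1)) n. *)
definition blowup_density :: "'a pgraph \<Rightarrow> 'b pgraph \<Rightarrow> ('b \<Rightarrow> real) \<Rightarrow> real" where
  "blowup_density F B x =
     (THE L. \<forall>V :: nat \<Rightarrow> 'b \<Rightarrow> nat set.
        (\<forall>n. blowup_parts B (V n)) \<and>
        (\<forall>i\<in>verts B. (\<lambda>n. real (card (V n i)) / real n) \<longlonglongrightarrow> x i)
        \<longrightarrow> (\<lambda>n. ind_density F (blowup B (V n))) \<longlonglongrightarrow> L)"

definition maximiser :: "'a pgraph \<Rightarrow> 'b pgraph \<Rightarrow> ('b \<Rightarrow> real) \<Rightarrow> bool" where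
  "maximiser F B x \<longleftrightarrow> x \<in> weights (verts B) \<and>
     (\<forall>y\<in>weights (verts B). blowup_density F B y \<le> blowup_density F B x)"

definition unique_maximiser :: "'a pgraph \<Rightarrow> 'b pgraph \<Rightarrow> ('b \<Rightarrow> real) \<Rightarrow> bool" where
  "unique_maximiser F B x \<longleftrightarrow> maximiser F B x \<and>
     (\<forall>y. maximiser F B y \<longrightarrow>
        (\<exists>\<sigma>. automorphism \<sigma> B \<and> (\<forall>i\<in>verts B. y i = x (\<sigma> i))))"

definition F15 :: "nat pgraph" where
  "F15 = ({0..<6}, {{0, 3}, {0, 4}, {1, 2}, {1, 5}})"

definition B15 :: "nat pgraph" where
  "B15 = ({0..<4}, {{0, 2}, {1, 3}})"

end

theory Submission
  imports Defs
begin

text \<open>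
  The graph \<open>F15\<close> consists of two disjoint \<^emph>\<open>cherries\<close>, induced paths on three vertices. Write \<open>N(\<tau>)\<close> for the set of
  vertices adjacent to some vertex of a cherry \<open>\<tau>\<close>; it contains \<open>\<tau>\<close>. An induced copy of \<open>F15\<close> is a pair of cherries
  \<open>\<tau>, \<tau>'\<close> such that \<open>\<tau>'\<close> avoids \<open>N(\<tau>)\<close>, and each copy arises from eight ordered pairs of cherries with ordered leaves.

  The upper bound rests on one inequality valid in every graph with \<open>n\<close> vertices: the sum of \<open>1 / (|N(\<tau>)| (|N(\<tau>)| - 2))\<close> over
  all ordered cherries is at most \<open>n / 4\<close> (\<open>sum_cherries_inverse_reach_le\<close>). It is applied to the whole graph and, for each
  \<open>\<tau>\<close>, to the graph induced outside \<open>N(\<tau>)\<close>. This bounds the total weight of the separated pairs for a weight that depends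
  on \<open>|N(\<tau>)|\<close> and \<open>|N(\<tau>') - N(\<tau>)|\<close>. By the inequality of arithmetic and geometric means, the two orders of a pair
  together weigh least when \<open>N(\<tau>)\<close> and \<open>N(\<tau>')\<close> are complementary halves of the vertex set. Hence there are at most
  \<open>pair_bound n = 8 (n / 4)\<^sup>4 ((n - 4) / 4)\<^sup>2\<close> ordered pairs, and two disjoint balanced complete bipartite graphs attain this
  up to \<open>O(n\<^sup>4)\<close>. The limit \<open>45 / 256\<close> follows.

  For stability, the slack in these inequalities is kept. It pays linearly for the vertices that lie in both or in neither of
  \<open>N(\<tau>)\<close> and \<open>N(\<tau>')\<close> (\<open>sum_defect_le\<close>), and for a lack of cherries outside \<open>N(\<tau>)\<close> (\<open>sum_cherry_ratio_le\<close>). A graph with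
  almost the maximum number of cherries is almost complete bipartite, with a number of wrong pairs linear in the loss
  (\<open>near_bipartite\<close>). So for a typical \<open>\<tau>\<close> both \<open>N(\<tau>)\<close> and its complement are almost complete bipartite, with few edges
  between them, and the total number of wrong pairs is at most \<open>O(1 + D / n\<^sup>4)\<close> if the count is \<open>D\<close> below the
  bound and \<open>D\<close> is a small fraction of it
  (\<open>near_two_bicliques\<close>).

  Since \<open>pair_bound n\<close> may exceed the true maximum by \<open>O(n\<^sup>4)\<close>, this leaves graphs with a bounded, positive number of
  wrong pairs and almost maximal count. For large \<open>n\<close> they do not exist: each wrong pair destroys a positive fraction of \<open>n\<^sup>4\<close> copies
  (\<open>two_bicliques_copies_through\<close>), whereas a copy of \<open>F15\<close> that is new in the graph contains at least two wrong pairs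
  (\<open>copy_not_single_conflict\<close>), and there are only \<open>O(n\<^sup>3)\<close> six-element sets of this kind. This gives the exact linear
  estimate \<open>edit_distance_le_gap\<close>.

  Finally the density of \<open>F15\<close> in blowups of \<open>B15\<close> is an explicit polynomial in the weights, whose maximum over the simplex is
  elementary.
\<close>

section \<open>Cherries and their neighbourhoods\<close>

text \<open>The vertex set is left open: every notion below takes the set \<open>A\<close> of vertices as an argument, so that
  it applies to the induced subgraphs that the argument passes to.\<close>

locale graph =
  fixes adj :: "'a \<Rightarrow> 'a \<Rightarrow> bool" (infix "\<sim>" 50)
  assumes adj_sym: "x \<sim> y \<Longrightarrow> y \<sim> x" and adj_irrefl [simp]: "\<not> x \<sim> x"
begin

definition nbh :: "'a set \<Rightarrow> 'a \<Rightarrow> 'a set" where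
  "nbh A x = {y\<in>A. x \<sim> y}"

text \<open>Induced paths on three vertices \<open>(w, u, v)\<close> with centre \<open>w\<close>; the leaves \<open>u, v\<close> are ordered, so each path
  is listed twice.\<close>

definition cherries :: "'a set \<Rightarrow> ('a \<times> 'a \<times> 'a) set" where
  "cherries A = (SIGMA w:A. SIGMA u:nbh A w. nbh A w - nbh A u - {u})"

text \<open>The open and the closed neighbourhood of a cherry agree, since each of its vertices has a neighbour in it.\<close>

definition reach :: "'a set \<Rightarrow> 'a \<times> 'a \<times> 'a \<Rightarrow> 'a set" where
  "reach A = (\<lambda>(w, u, v). nbh A w \<union> nbh A u \<union> nbh A v)"

definition away :: "'a set \<Rightarrow> 'a \<times> 'a \<times> 'a \<Rightarrow> 'a set" where
  "away A \<tau> = A - reach A \<tau>"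

text \<open>The second cherry avoids every neighbour of the first, so the two together induce \<open>F15\<close>.\<close>

definition cherry_pairs :: "'a set \<Rightarrow> (('a \<times> 'a \<times> 'a) \<times> ('a \<times> 'a \<times> 'a)) set" where
  "cherry_pairs A = (SIGMA \<tau>:cherries A. cherries (away A \<tau>))"

lemma adj_commute: "x \<sim> y \<longleftrightarrow> y \<sim> x"
  using adj_sym by blast

lemma finite_nbh [simp]: "finite A \<Longrightarrow> finite (nbh A x)"
  by (simp add: nbh_def)

lemma nbh_subset: "nbh A x \<subseteq> A"
  by (auto simp: nbh_def)

lemma finite_cherries [simp]: "finite A \<Longrightarrow> finite (cherries A)"
  by (auto simp: cherries_def intro!: finite_SigmaI)

lemma reach_subset: "reach A \<tau> \<subseteq> A"
  by (auto simp: reach_def nbh_def split: prod.splits)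

lemma finite_reach [simp]: "finite A \<Longrightarrow> finite (reach A \<tau>)"
  by (rule finite_subset[OF reach_subset])

lemma finite_away [simp]: "finite A \<Longrightarrow> finite (away A \<tau>)"
  by (simp add: away_def)

lemma finite_cherry_pairs [simp]: "finite A \<Longrightarrow> finite (cherry_pairs A)"
  by (auto simp: cherry_pairs_def intro!: finite_SigmaI)

lemma mem_cherries:
  "(w, u, v) \<in> cherries A \<longleftrightarrow>
     w \<in> A \<and> u \<in> A \<and> v \<in> A \<and> w \<sim> u \<and> w \<sim> v \<and> \<not> u \<sim> v \<and> u \<noteq> v"
  by (auto simp: cherries_def nbh_def)

lemma sum_cherries:
  assumes "finite A"
  shows "(\<Sum>\<tau>\<in>cherries A. f \<tau>) = (\<Sum>w\<in>A. \<Sum>u\<in>nbh A w. \<Sum>v\<in>nbh A w - nbh A u - {u}. f (w, u, v))"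
  using assms unfolding cherries_def by (simp add: sum.Sigma split_def)

lemma sum_cherry_pairs:
  assumes "finite A"
  shows "(\<Sum>p\<in>cherry_pairs A. f p) = (\<Sum>\<tau>\<in>cherries A. \<Sum>\<tau>'\<in>cherries (away A \<tau>). f (\<tau>, \<tau>'))"
  using assms unfolding cherry_pairs_def by (simp add: sum.Sigma split_def)

lemma sum_arcs_swap:
  assumes "finite A"
  shows "(\<Sum>w\<in>A. \<Sum>u\<in>nbh A w. f w u) = (\<Sum>w\<in>A. \<Sum>u\<in>nbh A w. f u w)"
  unfolding nbh_def using sum.swap_restrict[OF assms assms, of f "(\<sim>)"]
  by (simp add: adj_commute)

lemma reach_away: "reach (away A \<tau>) \<tau>' = reach A \<tau>' - reach A \<tau>"
  by (auto simp: reach_def away_def nbh_def split: prod.splits)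

lemma cherry_subset_reach:
  "(w, u, v) \<in> cherries A \<Longrightarrow> {w, u, v} \<subseteq> nbh A w \<union> nbh A u"
  by (auto simp: mem_cherries nbh_def adj_commute)

lemma cherry_card: "(w, u, v) \<in> cherries A \<Longrightarrow> card {w, u, v} = 3"
  by (auto simp: mem_cherries card_insert_if)

lemma card_reach_ge_3:
  assumes "finite A" "\<tau> \<in> cherries A"
  shows "3 \<le> card (reach A \<tau>)"
proof -
  obtain w u v where \<tau>: "\<tau> = (w, u, v)" by (cases \<tau>)
  have "card {w, u, v} \<le> card (reach A \<tau>)"
    using cherry_subset_reach[of w u v A] assms \<tau>
    by (intro card_mono) (auto simp: reach_def)
  then show ?thesis using cherry_card[of w u v A] assms \<tau> by simp
qed

lemma card_ge_3_of_cherry: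
  assumes "finite A" "\<tau> \<in> cherries A"
  shows "3 \<le> card A"
  using card_reach_ge_3[OF assms] card_mono[OF assms(1) reach_subset, of \<tau>] by linarith

lemma cherry_pairs_sym: "(\<tau>, \<tau>') \<in> cherry_pairs A \<longleftrightarrow> (\<tau>', \<tau>) \<in> cherry_pairs A"
  by (cases \<tau>; cases \<tau>') (auto simp: cherry_pairs_def mem_cherries away_def reach_def nbh_def adj_commute)

lemma sum_cherry_pairs_swap:
  "(\<Sum>(\<tau>, \<tau>')\<in>cherry_pairs A. f \<tau> \<tau>') = (\<Sum>(\<tau>, \<tau>')\<in>cherry_pairs A. f \<tau>' \<tau>)"
  by (rule sum.reindex_bij_witness[of _ prod.swap prod.swap]) (auto simp: cherry_pairs_sym)

end

text \<open>Here \<open>c\<close> is the number of common neighbours of two adjacent vertices and \<open>p, q\<close> count the private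
  neighbours of each, the other end excluded; the union of the two neighbourhoods then has \<open>p + q + c + 2\<close>
  elements and the degrees are \<open>p + c + 1\<close> and \<open>q + c + 1\<close>. The bound follows from
  \<open>(p + q) (p + q + 2 c + 2) \<le> (p + q + c + 2) (p + q + c)\<close>, where the two sides differ by \<open>c (c + 2)\<close>, and the
  inequality between harmonic and arithmetic mean of the degrees.\<close>

lemma arc_weight_bound:
  fixes x c p q :: real
  assumes "0 \<le> p" "0 \<le> q" "0 \<le> c"
  shows "(p + q) / ((p + q + c + 2) * (p + q + c)) \<le> 1 / 4 * (1 / (p + c + 1) + 1 / (q + c + 1))"
proof (cases "p + q + c = 0")
  case True
  then show ?thesis using assms by simp
next
  case False
  have "(p + q) * (p + q + 2 * c + 2) \<le> (p + q + c + 2) * (p + q + c)"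
  proof -
    have "(p + q + c + 2) * (p + q + c) - (p + q) * (p + q + 2 * c + 2) = c * c + 2 * c"
      by (simp add: algebra_simps)
    moreover have "0 \<le> c * c + 2 * c" using assms by simp
    ultimately show ?thesis by linarith
  qed
  then have "(p + q) / ((p + q + c + 2) * (p + q + c)) \<le> 1 / (p + q + 2 * c + 2)"
    using False assms by (simp add: divide_simps)
  also have "\<dots> \<le> 1 / 4 * (1 / (p + c + 1) + 1 / (q + c + 1))"
  proof -
    have "4 * ((p + c + 1) * (q + c + 1)) \<le> (p + q + 2 * c + 2)^2"
      using zero_le_power2[of "p - q"] by (simp add: power2_eq_square algebra_simps)
    then show ?thesis using assms
      by (simp add: divide_simps power2_eq_square) (simp add: algebra_simps)
  qed
  finally show ?thesis .
qed

context graph begin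

text \<open>Replacing the neighbourhood of \<open>(w, u, v)\<close> by the smaller set \<open>nbh A w \<union> nbh A u\<close> makes the summand
  independent of \<open>v\<close>, and the number of choices for \<open>v\<close> is the number of private neighbours of \<open>w\<close>. Averaged
  over the two orders of the arc \<open>(w, u)\<close>, the sum over \<open>v\<close> is at most an eighth of the sum of the inverse degrees of
  its ends, and the inverse degree of a vertex, taken once for each neighbour, adds up to at most one.\<close>

lemma sum_cherries_inverse_reach_le:
  assumes fin: "finite A"
  shows "(\<Sum>\<tau>\<in>cherries A. 1 / (real (card (reach A \<tau>)) * (real (card (reach A \<tau>)) - 2)))
         \<le> real (card A) / 4"
proof -
  define D where "D w u = real (card (nbh A w \<union> nbh A u))" for w u
  define \<alpha> where "\<alpha> w u = real (card (nbh A w - nbh A u - {u}))" for w u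
  define \<delta> where "\<delta> w = real (card (nbh A w))" for w
  have "(\<Sum>\<tau>\<in>cherries A. 1 / (real (card (reach A \<tau>)) * (real (card (reach A \<tau>)) - 2)))
      \<le> (\<Sum>(w, u, v)\<in>cherries A. 1 / (D w u * (D w u - 2)))"
  proof (rule sum_mono, clarify)
    fix w u v assume \<tau>: "(w, u, v) \<in> cherries A"
    have "card {w, u, v} \<le> card (nbh A w \<union> nbh A u)"
      using cherry_subset_reach[OF \<tau>] fin by (intro card_mono) auto
    then have "3 \<le> D w u" using cherry_card[OF \<tau>] by (simp add: D_def)
    moreover have "D w u \<le> real (card (reach A (w, u, v)))"
      unfolding D_def using fin by (auto simp: reach_def intro!: card_mono)
    ultimately show "1 / (real (card (reach A (w, u, v))) * (real (card (reach A (w, u, v))) - 2))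
        \<le> 1 / (D w u * (D w u - 2))"
      by (intro divide_left_mono mult_mono mult_pos_pos) auto
  qed
  also have "\<dots> = (\<Sum>w\<in>A. \<Sum>u\<in>nbh A w. \<alpha> w u / (D w u * (D w u - 2)))"
    using fin by (simp add: sum_cherries \<alpha>_def)
  also have "\<dots> = 1 / 2 * ((\<Sum>w\<in>A. \<Sum>u\<in>nbh A w. \<alpha> w u / (D w u * (D w u - 2)))
      + (\<Sum>w\<in>A. \<Sum>u\<in>nbh A w. \<alpha> u w / (D u w * (D u w - 2))))"
    using sum_arcs_swap[OF fin, of "\<lambda>w u. \<alpha> w u / (D w u * (D w u - 2))"] by simp
  also have "\<dots> = 1 / 2 * (\<Sum>w\<in>A. \<Sum>u\<in>nbh A w. (\<alpha> w u + \<alpha> u w) / (D w u * (D w u - 2)))"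
    by (simp add: sum.distrib add_divide_distrib D_def Un_commute)
  also have "\<dots> \<le> 1 / 2 * (\<Sum>w\<in>A. \<Sum>u\<in>nbh A w. 1 / 4 * (1 / \<delta> w + 1 / \<delta> u))"
  proof (intro mult_left_mono sum_mono)
    fix w u assume w: "w \<in> A" and u: "u \<in> nbh A w"
    define c where "c = real (card (nbh A w \<inter> nbh A u))"
    have wu: "w \<in> nbh A u" "u \<in> A" using u w by (auto simp: nbh_def adj_commute)
    have 1: "\<delta> w = \<alpha> w u + c + 1"
    proof -
      have "nbh A w = insert u (nbh A w - nbh A u - {u} \<union> nbh A w \<inter> nbh A u)"
        using u by auto
      moreover have "card (insert u (nbh A w - nbh A u - {u} \<union> nbh A w \<inter> nbh A u))
         = card (nbh A w - nbh A u - {u}) + card (nbh A w \<inter> nbh A u) + 1"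
        using fin by (subst card_insert_disjoint, simp, force simp: nbh_def, subst card_Un_disjoint, auto)
      ultimately show ?thesis by (simp add: \<delta>_def \<alpha>_def c_def)
    qed
    have 2: "\<delta> u = \<alpha> u w + c + 1"
    proof -
      have "nbh A u = insert w (nbh A u - nbh A w - {w} \<union> nbh A w \<inter> nbh A u)"
        using wu by auto
      moreover have "card (insert w (nbh A u - nbh A w - {w} \<union> nbh A w \<inter> nbh A u))
         = card (nbh A u - nbh A w - {w}) + card (nbh A w \<inter> nbh A u) + 1"
        using fin by (subst card_insert_disjoint, simp, force simp: nbh_def, subst card_Un_disjoint, auto)
      ultimately show ?thesis by (simp add: \<delta>_def \<alpha>_def c_def)
    qed
    have 3: "D w u = \<alpha> w u + \<alpha> u w + c + 2"
    proof -
      have "card (nbh A w \<union> nbh A u) + card (nbh A w \<inter> nbh A u) = card (nbh A w) + card (nbh A u)"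
        using card_Un_Int[of "nbh A w" "nbh A u"] fin by simp
      then have "D w u + c = \<delta> w + \<delta> u" unfolding D_def c_def \<delta>_def by linarith
      then show ?thesis using 1 2 by simp
    qed
    show "(\<alpha> w u + \<alpha> u w) / (D w u * (D w u - 2)) \<le> 1 / 4 * (1 / \<delta> w + 1 / \<delta> u)"
      using arc_weight_bound[of "\<alpha> w u" "\<alpha> u w" c] unfolding 1 2 3
      by (simp add: \<alpha>_def c_def)
  qed simp
  also have "\<dots> = 1 / 8 * ((\<Sum>w\<in>A. \<Sum>u\<in>nbh A w. 1 / \<delta> w) + (\<Sum>w\<in>A. \<Sum>u\<in>nbh A w. 1 / \<delta> u))"
    by (simp add: sum.distrib sum_distrib_left[symmetric] sum_divide_distrib[symmetric])
  also have "\<dots> = 1 / 4 * (\<Sum>w\<in>A. \<Sum>u\<in>nbh A w. 1 / \<delta> w)"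
    using sum_arcs_swap[OF fin, of "\<lambda>w u. 1 / \<delta> w"] by simp
  also have "\<dots> \<le> 1 / 4 * (\<Sum>w\<in>A. 1)"
    by (intro mult_left_mono sum_mono) (auto simp: \<delta>_def)
  finally show ?thesis by simp
qed

end

section \<open>Counting pairs of separated cherries\<close>

lemma inverse_sum_ge:
  fixes a b z :: real
  assumes "0 < a" "0 < b" "0 < z" "a * b \<le> z\<^sup>2"
  shows "2 / z \<le> 1 / a + 1 / b"
proof -
  have "(2 * (a * b))\<^sup>2 = 4 * (a * b) * (a * b)" by (simp add: power2_eq_square)
  also have "\<dots> \<le> 4 * (a * b) * z\<^sup>2" using assms by (intro mult_left_mono) auto
  also have "\<dots> \<le> (a + b)\<^sup>2 * z\<^sup>2"
    using zero_le_power2[of "a - b"] by (intro mult_right_mono) (auto simp: power2_eq_square algebra_simps)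
  also have "\<dots> = ((a + b) * z)\<^sup>2" by (simp add: power_mult_distrib)
  finally have "2 * (a * b) \<le> (a + b) * z"
    using assms by (intro power2_le_imp_le[of "2 * (a * b)"]) auto
  then show ?thesis using assms by (simp add: field_simps)
qed

lemma mult_le_square_of_sum_le:
  fixes a b m :: real
  assumes "0 \<le> a" "0 \<le> b" "a + b \<le> 2 * m"
  shows "a * b \<le> m\<^sup>2"
proof -
  have "4 * (a * b) \<le> (a + b)\<^sup>2"
    using zero_le_power2[of "a - b"] by (simp add: power2_eq_square algebra_simps)
  also have "\<dots> \<le> (2 * m)\<^sup>2" using assms by (intro power_mono) auto
  finally show ?thesis by (simp add: power2_eq_square)
qed

text \<open>The arithmetic-geometric mean inequality for the weights of \<open>(\<tau>, \<tau>')\<close> and \<open>(\<tau>', \<tau>)\<close>. Here \<open>d, d'\<close> are the sizes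
  of the two neighbourhoods, \<open>e\<close> is the part of the second outside the first and \<open>e'\<close> the part of the first
  outside the second. In the product of the two denominators the factors combine into pairs whose sum is at most
  \<open>2 h\<close> or \<open>2 h - 4\<close>; the pair \<open>e, e'\<close> also retains how far \<open>e + e'\<close> falls short of \<open>2 h\<close>.\<close>

lemma separated_weight_bound:
  fixes d d' e e' h :: real
  assumes "3 \<le> d" "3 \<le> d'" "3 \<le> e" "3 \<le> e'"
    and "d + e \<le> 2 * h" "d' + e' \<le> 2 * h" "e + e' \<le> 2 * h"
  shows "2 / (h^3 * (h - 2)\<^sup>2) * (1 + (2 * h - e - e') / (2 * h))
    \<le> 1 / (d * (d - 2) * (e * (e - 2)) * (2 * h - d)) + 1 / (d' * (d' - 2) * (e' * (e' - 2)) * (2 * h - d'))"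
proof -
  define z where "z = h\<^sup>2 * (h - 2)\<^sup>2 * ((e + e') / 2)"
  have h: "3 \<le> h" using assms by linarith
  have "(d * (d - 2) * (e * (e - 2)) * (2 * h - d)) * (d' * (d' - 2) * (e' * (e' - 2)) * (2 * h - d'))
      = (d * (2 * h - d)) * (d' * (2 * h - d')) * (((d - 2) * (e - 2)) * ((d' - 2) * (e' - 2))) * (e * e')"
    by (simp add: mult_ac)
  also have "\<dots> \<le> h\<^sup>2 * h\<^sup>2 * ((h - 2)\<^sup>2 * (h - 2)\<^sup>2) * ((e + e') / 2)\<^sup>2"
    using assms by (intro mult_mono mult_le_square_of_sum_le mult_nonneg_nonneg zero_le_power2) auto
  also have "\<dots> = z\<^sup>2" by (simp add: z_def power_mult_distrib power2_eq_square)
  finally have "2 / z \<le> 1 / (d * (d - 2) * (e * (e - 2)) * (2 * h - d))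
      + 1 / (d' * (d' - 2) * (e' * (e' - 2)) * (2 * h - d'))"
    using assms h by (intro inverse_sum_ge) (auto simp: z_def)
  moreover have "2 / (h^3 * (h - 2)\<^sup>2) * (1 + (2 * h - e - e') / (2 * h)) \<le> 2 / z"
  proof -
    have "(4 * h - (e + e')) * (e + e') \<le> (2 * h)\<^sup>2"
      by (intro mult_le_square_of_sum_le) (use assms in auto)
    then have "1 + (2 * h - e - e') / (2 * h) \<le> 2 * h / (e + e')"
      using assms h by (simp add: field_simps power2_eq_square)
    then have "2 / (h^3 * (h - 2)\<^sup>2) * (1 + (2 * h - e - e') / (2 * h))
        \<le> 2 / (h^3 * (h - 2)\<^sup>2) * (2 * h / (e + e'))"
      using h by (intro mult_left_mono) auto
    also have "\<dots> = 2 / z"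
    proof -
      have "0 < (h - 2)\<^sup>2" using h by simp
      then show ?thesis unfolding z_def
        using h assms by (simp add: divide_simps) (simp add: power2_eq_square power3_eq_cube)
    qed
    finally show ?thesis .
  qed
  ultimately show ?thesis by linarith
qed

text \<open>The same device with the actual number \<open>\<rho> s\<^sup>2 (s - 2) / 4\<close> of cherries outside a neighbourhood in place of
  the sizes \<open>e\<close>. The factors \<open>s, s'\<close> need not have sum at most \<open>2 h\<close>, and their excess \<open>t\<close> enters as an error term.\<close>

lemma cherry_ratio_weight_bound:
  fixes d d' s s' \<rho> \<rho>' t h :: real
  assumes "3 \<le> d" "3 \<le> d'" "3 \<le> s" "3 \<le> s'"
    and "d + s = 2 * h" "d' + s' = 2 * h"
    and t: "0 \<le> t" "t \<le> 2 * h" "s + s' \<le> 2 * h + t"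
    and \<rho>: "0 < \<rho>" "\<rho> \<le> 1" "0 < \<rho>'" "\<rho>' \<le> 1"
  shows "8 / (h^3 * (h - 2)\<^sup>2) * (1 + (1 - (\<rho> + \<rho>') / 2) - 2 * (t / (2 * h)))
    \<le> 1 / (d * (d - 2) * (\<rho> * (s\<^sup>2 * (s - 2) / 4))) + 1 / (d' * (d' - 2) * (\<rho>' * (s'\<^sup>2 * (s' - 2) / 4)))"
proof -
  define r where "r = (\<rho> + \<rho>') / 2"
  define z where "z = h\<^sup>2 * (h - 2)\<^sup>2 / 4 * r * ((s + s') / 2)"
  have h: "3 \<le> h" using assms by linarith
  have r: "0 < r" "r \<le> 1" using \<rho> by (auto simp: r_def)
  have "(d * (d - 2) * (\<rho> * (s\<^sup>2 * (s - 2) / 4))) * (d' * (d' - 2) * (\<rho>' * (s'\<^sup>2 * (s' - 2) / 4)))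
      = (d * s) * (d' * s') * (((d - 2) * (s - 2)) * ((d' - 2) * (s' - 2))) * (\<rho> * \<rho>') * (s * s') / 16"
    by (simp add: power2_eq_square mult_ac)
  also have "\<dots> \<le> h\<^sup>2 * h\<^sup>2 * ((h - 2)\<^sup>2 * (h - 2)\<^sup>2) * r\<^sup>2 * ((s + s') / 2)\<^sup>2 / 16"
    using assms unfolding r_def
    by (intro mult_mono mult_le_square_of_sum_le mult_nonneg_nonneg zero_le_power2 divide_right_mono) auto
  also have "\<dots> = z\<^sup>2" by (simp add: z_def power_mult_distrib power2_eq_square)
  finally have "2 / z \<le> 1 / (d * (d - 2) * (\<rho> * (s\<^sup>2 * (s - 2) / 4)))
      + 1 / (d' * (d' - 2) * (\<rho>' * (s'\<^sup>2 * (s' - 2) / 4)))"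
    using assms h r by (intro inverse_sum_ge) (auto simp: z_def)
  moreover have "8 / (h^3 * (h - 2)\<^sup>2) * (1 + (1 - r) - 2 * (t / (2 * h))) \<le> 2 / z"
  proof -
    define y where "y = t / (2 * h)"
    have y: "0 \<le> y" "y \<le> 1" using t h by (auto simp: y_def divide_simps)
    have "1 + (1 - r) - 2 * y \<le> (2 - r) * (1 - y)"
      using y r by (simp add: algebra_simps)
    also have "\<dots> \<le> (1 / r) * (1 / (1 + y))"
    proof (intro mult_mono)
      have "(2 - r) * r \<le> 1\<^sup>2" by (intro mult_le_square_of_sum_le) (use r in auto)
      then show "2 - r \<le> 1 / r" using r by (simp add: field_simps)
      have "(1 - y) * (1 + y) \<le> 1\<^sup>2" by (intro mult_le_square_of_sum_le) (use y in auto)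
      then show "1 - y \<le> 1 / (1 + y)" using y by (simp add: field_simps)
    qed (use y r in auto)
    also have "\<dots> \<le> (1 / r) * (2 * h / (s + s'))"
    proof (intro mult_left_mono)
      have "2 * h * (1 + y) = 2 * h + t" using h by (simp add: y_def field_simps)
      then have "s + s' \<le> 2 * h * (1 + y)" using t by linarith
      then show "1 / (1 + y) \<le> 2 * h / (s + s')"
        using assms y by (simp add: field_simps)
    qed (use r in auto)
    finally have "8 / (h^3 * (h - 2)\<^sup>2) * (1 + (1 - r) - 2 * y)
      \<le> 8 / (h^3 * (h - 2)\<^sup>2) * ((1 / r) * (2 * h / (s + s')))"
      using h by (intro mult_left_mono) auto
    also have "\<dots> = 2 / z"
    proof -
      have "0 < (h - 2)\<^sup>2" using h by simp
      then show ?thesis unfolding z_def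
        using h assms r by (simp add: divide_simps) (simp add: power2_eq_square power3_eq_cube)
    qed
    finally show ?thesis by (simp add: y_def)
  qed
  ultimately show ?thesis by (simp add: r_def)
qed

text \<open>Eight times the number of induced copies of \<open>F15\<close> in two disjoint complete bipartite graphs with all four
  classes of size \<open>n / 4\<close>.\<close>

definition pair_bound :: "real \<Rightarrow> real" where
  "pair_bound n = (n / 2)^4 * (n / 2 - 2)\<^sup>2 / 8"

context graph begin

text \<open>The number of vertices that lie in both or in neither of the two neighbourhoods.\<close>

definition defect :: "'a set \<Rightarrow> 'a \<times> 'a \<times> 'a \<Rightarrow> 'a \<times> 'a \<times> 'a \<Rightarrow> real" where
  "defect V \<tau> \<tau>' = real (card V) - real (card (reach V \<tau>' - reach V \<tau>)) - real (card (reach V \<tau> - reach V \<tau>'))"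

text \<open>The number of cherries relative to that of a balanced complete bipartite graph.\<close>

definition cherry_ratio :: "'a set \<Rightarrow> real" where
  "cherry_ratio A = real (card (cherries A)) / ((real (card A))\<^sup>2 * (real (card A) - 2) / 4)"

lemma card_away: "finite V \<Longrightarrow> real (card (away V \<tau>)) = real (card V) - real (card (reach V \<tau>))"
  unfolding away_def by (simp add: card_Diff_subset reach_subset card_mono of_nat_diff)

lemma card_cherries_le:
  assumes fin: "finite A" and ge2: "2 \<le> card A"
  shows "real (card (cherries A)) \<le> (real (card A))\<^sup>2 * (real (card A) - 2) / 4"
proof (cases "cherries A = {}")
  case True
  then show ?thesis using ge2 by simp
next
  case False
  let ?a = "real (card A)"
  have a: "3 \<le> ?a" using False card_ge_3_of_cherry[OF fin] by auto
  have "real (card (cherries A)) / (?a * (?a - 2)) = (\<Sum>\<tau>\<in>cherries A. 1 / (?a * (?a - 2)))" by simp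
  also have "\<dots> \<le> (\<Sum>\<tau>\<in>cherries A. 1 / (real (card (reach A \<tau>)) * (real (card (reach A \<tau>)) - 2)))"
  proof (rule sum_mono)
    fix \<tau> assume \<tau>: "\<tau> \<in> cherries A"
    have "3 \<le> real (card (reach A \<tau>))" using card_reach_ge_3[OF fin \<tau>] by simp
    moreover have "real (card (reach A \<tau>)) \<le> ?a" using card_mono[OF fin reach_subset] by simp
    ultimately show "1 / (?a * (?a - 2)) \<le> 1 / (real (card (reach A \<tau>)) * (real (card (reach A \<tau>)) - 2))"
      by (intro divide_left_mono mult_mono mult_pos_pos) auto
  qed
  also have "\<dots> \<le> ?a / 4" by (rule sum_cherries_inverse_reach_le[OF fin])
  finally show ?thesis using a by (simp add: field_simps power2_eq_square)
qed

lemma cherry_pair_sizes: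
  assumes fin: "finite V" and p: "(\<tau>, \<tau>') \<in> cherry_pairs V"
  shows "3 \<le> card (reach V \<tau>)" "3 \<le> card (reach V \<tau>' - reach V \<tau>)"
    "card (reach V \<tau>) + card (reach V \<tau>' - reach V \<tau>) \<le> card V"
    "card (reach V \<tau>' - reach V \<tau>) \<le> card (reach V \<tau>')"
    "card (reach V \<tau>' - reach V \<tau>) + card (reach V \<tau> - reach V \<tau>') \<le> card V"
    "3 \<le> card (away V \<tau>)"
    "0 < card (cherries (away V \<tau>))"
proof -
  have \<tau>: "\<tau> \<in> cherries V" "\<tau>' \<in> cherries (away V \<tau>)"
    using p by (auto simp: cherry_pairs_def)
  show "3 \<le> card (reach V \<tau>)" using card_reach_ge_3[OF fin \<tau>(1)] .
  show "3 \<le> card (reach V \<tau>' - reach V \<tau>)"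
    using card_reach_ge_3[OF _ \<tau>(2)] fin by (simp add: reach_away)
  show "card (reach V \<tau>) + card (reach V \<tau>' - reach V \<tau>) \<le> card V"
    using fin reach_subset[of V \<tau>] reach_subset[of V \<tau>']
    by (subst card_Un_disjoint[symmetric]) (auto intro!: card_mono)
  show "card (reach V \<tau>' - reach V \<tau>) \<le> card (reach V \<tau>')"
    using fin by (intro card_mono) auto
  show "card (reach V \<tau>' - reach V \<tau>) + card (reach V \<tau> - reach V \<tau>') \<le> card V"
    using fin reach_subset[of V \<tau>] reach_subset[of V \<tau>']
    by (subst card_Un_disjoint[symmetric]) (auto intro!: card_mono)
  show "3 \<le> card (away V \<tau>)"
    using card_ge_3_of_cherry[OF _ \<tau>(2)] fin by simp
  show "0 < card (cherries (away V \<tau>))"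
    using \<tau>(2) fin by (auto simp: card_gt_0_iff)
qed

lemma defect_nonneg: "finite V \<Longrightarrow> (\<tau>, \<tau>') \<in> cherry_pairs V \<Longrightarrow> 0 \<le> defect V \<tau> \<tau>'"
  using cherry_pair_sizes(5)[of V \<tau> \<tau>'] by (simp add: defect_def)

text \<open>Weight a pair by \<open>1 / (d (d - 2) e (e - 2) (n - d))\<close>. For fixed \<open>\<tau>\<close> the sum over \<open>\<tau>'\<close> is an instance of
  \<open>sum_cherries_inverse_reach_le\<close> in the graph induced on \<open>away V \<tau>\<close>, where \<open>\<tau>'\<close> has exactly \<open>e\<close> neighbours; a second instance
  then sums over \<open>\<tau>\<close>. The two orders of a pair have an average weight of at least the value at \<open>d = e = n / 2\<close>,
  increased in proportion to the defect.\<close>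

lemma sum_defect_le:
  assumes fin: "finite V"
  defines "n \<equiv> real (card V)"
  shows "(\<Sum>(\<tau>, \<tau>')\<in>cherry_pairs V. 1 + defect V \<tau> \<tau>' / n) \<le> pair_bound n"
proof (cases "cherry_pairs V = {}")
  case True
  then show ?thesis by (simp add: pair_bound_def)
next
  case False
  define h where "h = n / 2"
  define d where "d \<tau> = real (card (reach V \<tau>))" for \<tau>
  define e where "e \<tau> \<tau>' = real (card (reach V \<tau>' - reach V \<tau>))" for \<tau> \<tau>'
  define f where "f \<tau> \<tau>' = 1 / (d \<tau> * (d \<tau> - 2) * (e \<tau> \<tau>' * (e \<tau> \<tau>' - 2)) * (n - d \<tau>))" for \<tau> \<tau>'
  have h: "3 \<le> h"
  proof -
    obtain \<tau> \<tau>' where "(\<tau>, \<tau>') \<in> cherry_pairs V" using False by auto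
    then show ?thesis using cherry_pair_sizes(1-3)[OF fin, of \<tau> \<tau>'] by (simp add: h_def n_def)
  qed
  have "(\<Sum>(\<tau>, \<tau>')\<in>cherry_pairs V. f \<tau> \<tau>')
      = (\<Sum>\<tau>\<in>cherries V. 1 / (d \<tau> * (d \<tau> - 2) * (n - d \<tau>)) *
           (\<Sum>\<tau>'\<in>cherries (away V \<tau>). 1 / (e \<tau> \<tau>' * (e \<tau> \<tau>' - 2))))"
    using fin by (simp add: sum_cherry_pairs f_def sum_distrib_left mult_ac)
  also have "\<dots> \<le> (\<Sum>\<tau>\<in>cherries V. 1 / 4 * (1 / (d \<tau> * (d \<tau> - 2))))"
  proof (rule sum_mono)
    fix \<tau> assume \<tau>: "\<tau> \<in> cherries V"
    have d: "3 \<le> d \<tau>" using card_reach_ge_3[OF fin \<tau>] by (simp add: d_def)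
    have dn: "d \<tau> \<le> n" using card_mono[OF fin reach_subset] by (simp add: d_def n_def)
    have "(\<Sum>\<tau>'\<in>cherries (away V \<tau>). 1 / (e \<tau> \<tau>' * (e \<tau> \<tau>' - 2))) \<le> (n - d \<tau>) / 4"
      using sum_cherries_inverse_reach_le[of "away V \<tau>"] fin
      by (simp add: e_def reach_away card_away n_def d_def)
    then have "1 / (d \<tau> * (d \<tau> - 2) * (n - d \<tau>)) *
           (\<Sum>\<tau>'\<in>cherries (away V \<tau>). 1 / (e \<tau> \<tau>' * (e \<tau> \<tau>' - 2)))
        \<le> 1 / (d \<tau> * (d \<tau> - 2) * (n - d \<tau>)) * ((n - d \<tau>) / 4)"
      using d dn by (intro mult_left_mono) auto
    also have "\<dots> \<le> 1 / 4 * (1 / (d \<tau> * (d \<tau> - 2)))"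
      using d dn by (cases "n = d \<tau>") (simp_all add: divide_simps)
    finally show "1 / (d \<tau> * (d \<tau> - 2) * (n - d \<tau>)) *
           (\<Sum>\<tau>'\<in>cherries (away V \<tau>). 1 / (e \<tau> \<tau>' * (e \<tau> \<tau>' - 2)))
        \<le> 1 / 4 * (1 / (d \<tau> * (d \<tau> - 2)))" .
  qed
  also have "\<dots> \<le> 1 / 4 * (n / 4)"
    unfolding sum_distrib_left[symmetric]
    using sum_cherries_inverse_reach_le[OF fin] by (simp add: d_def n_def)
  finally have upper: "(\<Sum>(\<tau>, \<tau>')\<in>cherry_pairs V. f \<tau> \<tau>') \<le> n / 16" by simp
  have "2 / (h^3 * (h - 2)\<^sup>2) * (\<Sum>(\<tau>, \<tau>')\<in>cherry_pairs V. 1 + defect V \<tau> \<tau>' / n)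
      \<le> (\<Sum>(\<tau>, \<tau>')\<in>cherry_pairs V. f \<tau> \<tau>' + f \<tau>' \<tau>)"
    unfolding sum_distrib_left
  proof (rule sum_mono, clarify)
    fix \<tau> \<tau>' assume p: "(\<tau>, \<tau>') \<in> cherry_pairs V"
    then have p': "(\<tau>', \<tau>) \<in> cherry_pairs V" by (simp add: cherry_pairs_sym)
    show "2 / (h^3 * (h - 2)\<^sup>2) * (1 + defect V \<tau> \<tau>' / n) \<le> f \<tau> \<tau>' + f \<tau>' \<tau>"
      using separated_weight_bound[of "d \<tau>" "d \<tau>'" "e \<tau> \<tau>'" "e \<tau>' \<tau>" h]
        cherry_pair_sizes[OF fin p] cherry_pair_sizes[OF fin p']
      by (simp add: f_def defect_def h_def n_def d_def e_def)
  qed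
  also have "\<dots> = 2 * (\<Sum>(\<tau>, \<tau>')\<in>cherry_pairs V. f \<tau> \<tau>')"
    using sum_cherry_pairs_swap[of f V] by (simp add: split_def sum.distrib)
  also have "\<dots> \<le> h / 4" using upper by (simp add: h_def)
  finally have "(\<Sum>(\<tau>, \<tau>')\<in>cherry_pairs V. 1 + defect V \<tau> \<tau>' / n) \<le> h / 4 * (h^3 * (h - 2)\<^sup>2 / 2)"
    using h by (simp add: field_simps)
  also have "\<dots> = pair_bound n"
    by (simp add: pair_bound_def h_def power_numeral_reduce)
  finally show ?thesis .
qed

corollary card_cherry_pairs_le:
  assumes fin: "finite V"
  shows "real (card (cherry_pairs V)) \<le> pair_bound (real (card V))"
proof -
  have "real (card (cherry_pairs V)) = (\<Sum>(\<tau>, \<tau>')\<in>cherry_pairs V. 1)" by simp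
  also have "\<dots> \<le> (\<Sum>(\<tau>, \<tau>')\<in>cherry_pairs V. 1 + defect V \<tau> \<tau>' / real (card V))"
    by (rule sum_mono) (use defect_nonneg[OF fin] in auto)
  finally show ?thesis using sum_defect_le[OF fin] by linarith
qed

lemma cherry_ratio_le_1:
  assumes "finite A" "3 \<le> card A"
  shows "cherry_ratio A \<le> 1"
proof -
  have "0 < (real (card A))\<^sup>2 * (real (card A) - 2) / 4"
    using assms by (intro divide_pos_pos mult_pos_pos) auto
  then show ?thesis
    using card_cherries_le[of A] assms unfolding cherry_ratio_def by (subst divide_le_eq_1) auto
qed

text \<open>For fixed \<open>\<tau>\<close> the weights \<open>1 / (d (d - 2) q)\<close> with \<open>q\<close> the number of partners of \<open>\<tau>\<close> add up to
  \<open>1 / (d (d - 2))\<close>, so the total is again controlled. The error term of the comparison is paid for by the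
  defects.\<close>

lemma sum_cherry_ratio_le:
  assumes fin: "finite V"
  defines "n \<equiv> real (card V)"
  shows "(\<Sum>(\<tau>, \<tau>')\<in>cherry_pairs V. 1 - cherry_ratio (away V \<tau>))
    \<le> 3 * (pair_bound n - real (card (cherry_pairs V)))"
proof (cases "cherry_pairs V = {}")
  case True
  then show ?thesis by (simp add: pair_bound_def)
next
  case False
  define h where "h = n / 2"
  define d where "d \<tau> = real (card (reach V \<tau>))" for \<tau>
  define q where "q \<tau> = real (card (cherries (away V \<tau>)))" for \<tau>
  define \<rho> where "\<rho> \<tau> = cherry_ratio (away V \<tau>)" for \<tau>
  define f where "f \<tau> = 1 / (d \<tau> * (d \<tau> - 2) * q \<tau>)" for \<tau>
  have h: "3 \<le> h"
  proof -
    obtain \<tau> \<tau>' where "(\<tau>, \<tau>') \<in> cherry_pairs V" using False by auto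
    then show ?thesis using cherry_pair_sizes(1-3)[OF fin, of \<tau> \<tau>'] by (simp add: h_def n_def)
  qed
  have "(\<Sum>(\<tau>, \<tau>')\<in>cherry_pairs V. f \<tau>) = (\<Sum>\<tau>\<in>cherries V. q \<tau> * f \<tau>)"
    using fin by (simp add: sum_cherry_pairs q_def)
  also have "\<dots> \<le> (\<Sum>\<tau>\<in>cherries V. 1 / (d \<tau> * (d \<tau> - 2)))"
  proof (rule sum_mono)
    fix \<tau> assume \<tau>: "\<tau> \<in> cherries V"
    have "3 \<le> d \<tau>" using card_reach_ge_3[OF fin \<tau>] by (simp add: d_def)
    then show "q \<tau> * f \<tau> \<le> 1 / (d \<tau> * (d \<tau> - 2))" by (cases "q \<tau> = 0") (auto simp: f_def)
  qed
  also have "\<dots> \<le> n / 4"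
    using sum_cherries_inverse_reach_le[OF fin] by (simp add: d_def n_def)
  finally have upper: "(\<Sum>(\<tau>, \<tau>')\<in>cherry_pairs V. f \<tau>) \<le> n / 4" .
  have "8 / (h^3 * (h - 2)\<^sup>2) *
      (\<Sum>(\<tau>, \<tau>')\<in>cherry_pairs V. 1 + (1 - (\<rho> \<tau> + \<rho> \<tau>') / 2) - 2 * (defect V \<tau> \<tau>' / n))
      \<le> (\<Sum>(\<tau>, \<tau>')\<in>cherry_pairs V. f \<tau> + f \<tau>')"
    unfolding sum_distrib_left
  proof (rule sum_mono, clarify)
    fix \<tau> \<tau>' assume p: "(\<tau>, \<tau>') \<in> cherry_pairs V"
    then have p': "(\<tau>', \<tau>) \<in> cherry_pairs V" by (simp add: cherry_pairs_sym)
    note sz = cherry_pair_sizes[OF fin p] cherry_pair_sizes[OF fin p']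
    define s where "s \<tau> = real (card (away V \<tau>))" for \<tau>
    have s: "s \<tau> = n - d \<tau>" for \<tau> by (simp add: s_def n_def d_def card_away fin)
    have s3: "3 \<le> s \<tau>" "3 \<le> s \<tau>'" using sz by (auto simp: s_def)
    have q: "q x = \<rho> x * ((s x)\<^sup>2 * (s x - 2) / 4)" if "3 \<le> s x" for x
      using that by (simp add: q_def \<rho>_def cherry_ratio_def s_def)
    have "0 < \<rho> \<tau>" "0 < \<rho> \<tau>'"
      unfolding \<rho>_def cherry_ratio_def using sz s3
      by (auto intro!: divide_pos_pos mult_pos_pos simp: s_def)
    moreover have "\<rho> \<tau> \<le> 1" "\<rho> \<tau>' \<le> 1"
      unfolding \<rho>_def using cherry_ratio_le_1 fin sz by auto
    moreover have "0 \<le> defect V \<tau> \<tau>'" by (rule defect_nonneg[OF fin p])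
    moreover have "defect V \<tau> \<tau>' \<le> 2 * h" by (simp add: defect_def h_def n_def)
    moreover have "s \<tau> + s \<tau>' \<le> 2 * h + defect V \<tau> \<tau>'"
      using sz by (simp add: s h_def n_def defect_def d_def)
    ultimately show "8 / (h^3 * (h - 2)\<^sup>2) * (1 + (1 - (\<rho> \<tau> + \<rho> \<tau>') / 2) - 2 * (defect V \<tau> \<tau>' / n))
        \<le> f \<tau> + f \<tau>'"
      using cherry_ratio_weight_bound[of "d \<tau>" "d \<tau>'" "s \<tau>" "s \<tau>'" h "defect V \<tau> \<tau>'" "\<rho> \<tau>" "\<rho> \<tau>'"] sz s3
      by (simp add: f_def q[OF s3(1)] q[OF s3(2)]) (simp add: s h_def d_def)
  qed
  also have "\<dots> = 2 * (\<Sum>(\<tau>, \<tau>')\<in>cherry_pairs V. f \<tau>)"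
    using sum_cherry_pairs_swap[of "\<lambda>\<tau> \<tau>'. f \<tau>" V] by (simp add: split_def sum.distrib)
  also have "\<dots> \<le> h" using upper by (simp add: h_def)
  finally have "(\<Sum>(\<tau>, \<tau>')\<in>cherry_pairs V. 1 + (1 - (\<rho> \<tau> + \<rho> \<tau>') / 2) - 2 * (defect V \<tau> \<tau>' / n))
      \<le> h * (h^3 * (h - 2)\<^sup>2 / 8)"
    using h by (simp add: field_simps)
  also have "\<dots> = pair_bound n"
    by (simp add: pair_bound_def h_def power_numeral_reduce)
  finally have 1: "(\<Sum>(\<tau>, \<tau>')\<in>cherry_pairs V. 1 + (1 - (\<rho> \<tau> + \<rho> \<tau>') / 2) - 2 * (defect V \<tau> \<tau>' / n))
      \<le> pair_bound n" .
  define R where "R = real (card (cherry_pairs V))"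
  define T where "T = (\<Sum>(\<tau>, \<tau>')\<in>cherry_pairs V. defect V \<tau> \<tau>' / n)"
  define S where "S = (\<Sum>(\<tau>, \<tau>')\<in>cherry_pairs V. \<rho> \<tau>)"
  have S': "(\<Sum>(\<tau>, \<tau>')\<in>cherry_pairs V. \<rho> \<tau>') = S"
    using sum_cherry_pairs_swap[of "\<lambda>\<tau> \<tau>'. \<rho> \<tau>" V] by (simp add: S_def)
  have "(\<Sum>(\<tau>, \<tau>')\<in>cherry_pairs V. 1 + (1 - (\<rho> \<tau> + \<rho> \<tau>') / 2) - 2 * (defect V \<tau> \<tau>' / n))
     = R + (R - (S + S) / 2) - 2 * T"
    using S' by (simp add: split_def sum.distrib sum_subtractf R_def S_def T_def
        sum_divide_distrib[symmetric] sum_distrib_left)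
  moreover have "R + T \<le> pair_bound n"
    using sum_defect_le[OF fin] by (simp add: split_def sum.distrib R_def T_def n_def)
  moreover have "(\<Sum>(\<tau>, \<tau>')\<in>cherry_pairs V. 1 - \<rho> \<tau>) = R - S"
    by (simp add: split_def sum_subtractf R_def S_def)
  ultimately have "(\<Sum>(\<tau>, \<tau>')\<in>cherry_pairs V. 1 - \<rho> \<tau>) \<le> 3 * (pair_bound n - R)"
    using 1 by simp
  then show ?thesis by (simp add: \<rho>_def R_def)
qed

end

section \<open>Graphs with almost the maximum number of cherries\<close>

lemma exists_le_average:
  fixes f :: "'b \<Rightarrow> real"
  assumes "finite S" "S \<noteq> {}"
  shows "\<exists>x\<in>S. f x * real (card S) \<le> sum f S"
proof -
  obtain x where x: "x \<in> S" "\<forall>y\<in>S. f x \<le> f y"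
    using ex_is_arg_min_if_finite[OF assms, of f] by (auto simp: is_arg_min_linorder)
  then have "(\<Sum>y\<in>S. f x) \<le> sum f S" by (intro sum_mono) auto
  then show ?thesis using x by (auto simp: mult.commute)
qed

text \<open>Ordered pairs, so a symmetric disagreement is counted twice.\<close>

definition conflicts :: "'a set \<Rightarrow> ('a \<Rightarrow> 'a \<Rightarrow> bool) \<Rightarrow> ('a \<Rightarrow> 'a \<Rightarrow> bool) \<Rightarrow> ('a \<times> 'a) set" where
  "conflicts A r r' = {(x, y). x \<in> A \<and> y \<in> A \<and> r x y \<noteq> r' x y}"

lemma finite_conflicts [simp]: "finite A \<Longrightarrow> finite (conflicts A r r')"
  by (rule finite_subset[of _ "A \<times> A"]) (auto simp: conflicts_def)

context graph begin

definition common :: "'a set \<Rightarrow> 'a \<Rightarrow> 'a \<Rightarrow> real" where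
  "common A w u = real (card (nbh A w \<inter> nbh A u))"

text \<open>Counts the third vertices of the triples whose only edge is \<open>w u\<close>, if \<open>w, u\<close> are adjacent.\<close>

definition missed :: "'a set \<Rightarrow> 'a \<Rightarrow> 'a \<Rightarrow> real" where
  "missed A w u = real (card (A - nbh A w - nbh A u))"

definition deviation :: "'a set \<Rightarrow> 'a \<Rightarrow> real" where
  "deviation A w = real (card (nbh A w)) - (real (card A) - 1) / 2"

text \<open>The reference value \<open>a (a - 1)\<^sup>2 / 4\<close> exceeds the bound \<open>a\<^sup>2 (a - 2) / 4\<close> on the number of cherries by \<open>a / 4\<close>; in
  exchange the difference is an exact sum of nonnegative terms.\<close>

definition shortfall :: "'a set \<Rightarrow> real" where
  "shortfall A = real (card A) * (real (card A) - 1)\<^sup>2 / 4 - real (card (cherries A))"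

lemma card_leaves:
  assumes fin: "finite A" and u: "u \<in> nbh A w"
  shows "real (card (nbh A w - nbh A u - {u})) = real (card (nbh A w)) - 1 - common A w u"
proof -
  have "nbh A w = insert u (nbh A w - nbh A u - {u} \<union> nbh A w \<inter> nbh A u)" using u by auto
  moreover have "card (insert u (nbh A w - nbh A u - {u} \<union> nbh A w \<inter> nbh A u))
         = card (nbh A w - nbh A u - {u}) + card (nbh A w \<inter> nbh A u) + 1"
    using fin by (subst card_insert_disjoint, simp, force simp: nbh_def, subst card_Un_disjoint, auto)
  ultimately show ?thesis by (simp add: common_def)
qed

lemma card_cherries_eq:
  assumes fin: "finite A"
  shows "real (card (cherries A)) = (\<Sum>w\<in>A. \<Sum>u\<in>nbh A w. real (card (nbh A w)) - 1 - common A w u)"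
proof -
  have "real (card (cherries A)) = (\<Sum>w\<in>A. \<Sum>u\<in>nbh A w. real (card (nbh A w - nbh A u - {u})))"
    using sum_cherries[OF fin, of "\<lambda>_. 1::real"] by simp
  also have "\<dots> = (\<Sum>w\<in>A. \<Sum>u\<in>nbh A w. real (card (nbh A w)) - 1 - common A w u)"
    by (intro sum.cong refl card_leaves fin)
  finally show ?thesis .
qed

text \<open>Count the triples of distinct vertices \<open>w, u, y\<close> with \<open>w\<close> adjacent to \<open>u\<close> but not to \<open>y\<close>. There are
  \<open>\<delta> (a - 1 - \<delta>)\<close> of them for a vertex \<open>w\<close> of degree \<open>\<delta>\<close>, and they are cherries with centre \<open>u\<close> or triples
  spanning the single edge \<open>w u\<close>, according to whether \<open>u, y\<close> are adjacent.\<close>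

lemma shortfall_eq:
  assumes fin: "finite A"
  shows "shortfall A = (\<Sum>w\<in>A. \<Sum>u\<in>nbh A w. missed A w u) + (\<Sum>w\<in>A. (deviation A w)\<^sup>2)"
proof -
  let ?a = "real (card A)" and ?\<delta> = "\<lambda>w. real (card (nbh A w))"
  have split: "?a - 1 - ?\<delta> w = (?\<delta> u - 1 - common A u w) + missed A w u"
    if w: "w \<in> A" and u: "u \<in> nbh A w" for w u
  proof -
    have wu: "w \<in> nbh A u" "u \<in> A" using that by (auto simp: nbh_def adj_commute)
    have "card A = card (nbh A w \<union> ({w} \<union> ((nbh A u - nbh A w - {w}) \<union> (A - nbh A w - nbh A u))))"
      by (rule arg_cong[of _ _ card]) (use w nbh_subset in auto)
    also have "\<dots> = card (nbh A w) + (1 + (card (nbh A u - nbh A w - {w}) + card (A - nbh A w - nbh A u)))"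
    proof -
      have "w \<notin> nbh A w" by (simp add: nbh_def)
      then show ?thesis using fin wu
        by (subst card_Un_disjoint, simp, simp, force, subst card_Un_disjoint, simp, simp, force,
            subst card_Un_disjoint, auto)
    qed
    finally have "?a - 1 - ?\<delta> w = real (card (nbh A u - nbh A w - {w})) + missed A w u"
      by (simp add: missed_def)
    then show ?thesis by (simp add: card_leaves[OF fin wu(1)])
  qed
  have "(\<Sum>w\<in>A. ?\<delta> w * (?a - 1 - ?\<delta> w)) = (\<Sum>w\<in>A. \<Sum>u\<in>nbh A w. ?a - 1 - ?\<delta> w)"
    by simp
  also have "\<dots> = (\<Sum>w\<in>A. \<Sum>u\<in>nbh A w. (?\<delta> u - 1 - common A u w) + missed A w u)"
    by (intro sum.cong refl split)
  also have "\<dots> = (\<Sum>w\<in>A. \<Sum>u\<in>nbh A w. ?\<delta> u - 1 - common A u w) + (\<Sum>w\<in>A. \<Sum>u\<in>nbh A w. missed A w u)"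
    by (simp add: sum.distrib)
  also have "(\<Sum>w\<in>A. \<Sum>u\<in>nbh A w. ?\<delta> u - 1 - common A u w) = real (card (cherries A))"
    unfolding card_cherries_eq[OF fin] by (rule sum_arcs_swap[OF fin])
  finally have 1: "(\<Sum>w\<in>A. ?\<delta> w * (?a - 1 - ?\<delta> w))
      = real (card (cherries A)) + (\<Sum>w\<in>A. \<Sum>u\<in>nbh A w. missed A w u)" .
  have "?\<delta> w * (?a - 1 - ?\<delta> w) = (?a - 1)\<^sup>2 / 4 - (deviation A w)\<^sup>2" for w
    by (simp add: deviation_def power2_eq_square field_simps)
  then have "(\<Sum>w\<in>A. ?\<delta> w * (?a - 1 - ?\<delta> w)) = ?a * (?a - 1)\<^sup>2 / 4 - (\<Sum>w\<in>A. (deviation A w)\<^sup>2)"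
    by (simp add: sum_subtractf)
  with 1 show ?thesis by (simp add: shortfall_def)
qed

definition triangles :: "'a set \<Rightarrow> ('a \<times> 'a \<times> 'a) set" where
  "triangles A = (SIGMA w:A. SIGMA u:nbh A w. nbh A w \<inter> nbh A u)"

lemma finite_triangles [simp]: "finite A \<Longrightarrow> finite (triangles A)"
  by (auto simp: triangles_def intro!: finite_SigmaI)

lemma mem_triangles:
  "(w, u, z) \<in> triangles A \<longleftrightarrow> w \<in> A \<and> u \<in> A \<and> z \<in> A \<and> w \<sim> u \<and> w \<sim> z \<and> u \<sim> z"
  by (auto simp: triangles_def nbh_def)

lemma sum_triangles:
  assumes "finite A"
  shows "(\<Sum>\<tau>\<in>triangles A. f \<tau>) = (\<Sum>w\<in>A. \<Sum>u\<in>nbh A w. \<Sum>z\<in>nbh A w \<inter> nbh A u. f (w, u, z))"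
  using assms unfolding triangles_def by (simp add: sum.Sigma split_def)

lemma sum_triangles_rotate:
  "(\<Sum>(w, u, z)\<in>triangles A. f w u z) = (\<Sum>(w, u, z)\<in>triangles A. f u z w)"
  by (rule sum.reindex_bij_witness[of _ "\<lambda>(w, u, z). (u, z, w)" "\<lambda>(w, u, z). (z, w, u)"])
     (auto simp: mem_triangles adj_commute)

text \<open>Every vertex outside \<open>missed\<close> of all three edges is adjacent to at least two corners of the triangle, so without
  missed vertices the three degrees would add up to \<open>2 a\<close> and could not all be close to \<open>a / 2\<close>. The linear
  deviations are traded for squares by \<open>b \<le> a / 12 + 3 b\<^sup>2 / a\<close>.\<close>

lemma triangle_counts:
  assumes fin: "finite A" and T: "(w, u, z) \<in> triangles A"
  shows "real (card A) / 4 \<le> missed A w u + missed A u z + missed A z w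
     + 3 / real (card A) * ((deviation A w)\<^sup>2 + (deviation A u)\<^sup>2 + (deviation A z)\<^sup>2)"
proof -
  let ?a = "real (card A)"
  have a: "0 < ?a" using T fin by (auto simp: mem_triangles card_gt_0_iff)
  have ind: "real (card S) = (\<Sum>x\<in>A. of_bool (x \<in> S))" if "S \<subseteq> A" for S
    using that fin by (simp add: sum.If_cases of_bool_def Int_absorb1)
  have "2 * ?a = (\<Sum>x\<in>A. 2)" by simp
  also have "\<dots> \<le> (\<Sum>x\<in>A. of_bool (x \<in> nbh A w) + of_bool (x \<in> nbh A u) + of_bool (x \<in> nbh A z)
     + of_bool (x \<in> A - nbh A w - nbh A u) + of_bool (x \<in> A - nbh A u - nbh A z)
     + of_bool (x \<in> A - nbh A z - nbh A w))"
    by (rule sum_mono) auto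
  also have "\<dots> = real (card (nbh A w)) + real (card (nbh A u)) + real (card (nbh A z))
      + missed A w u + missed A u z + missed A z w"
    unfolding missed_def
    by (subst (1 2 3 4 5 6) ind) (auto simp: sum.distrib nbh_def)
  finally have "?a / 2 \<le> deviation A w + deviation A u + deviation A z
      + missed A w u + missed A u z + missed A z w"
    by (simp add: deviation_def field_simps)
  moreover have "b \<le> ?a / 12 + 3 / ?a * b\<^sup>2" for b
  proof -
    have "0 \<le> (?a - 6 * b)\<^sup>2" by simp
    then have "12 * ?a * b \<le> ?a\<^sup>2 + 36 * b\<^sup>2" by (simp add: power2_eq_square algebra_simps)
    then show ?thesis using a by (simp add: field_simps power2_eq_square)
  qed
  from this[of "deviation A w"] this[of "deviation A u"] this[of "deviation A z"]
  have "deviation A w + deviation A u + deviation A z \<le> ?a / 4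
     + 3 / ?a * ((deviation A w)\<^sup>2 + (deviation A u)\<^sup>2 + (deviation A z)\<^sup>2)"
    by (simp add: distrib_left)
  ultimately show ?thesis by linarith
qed

text \<open>The left side counts ordered triangles. Their number is linear in the shortfall, which is what makes the
  final edit bound linear.\<close>

lemma sum_common_le:
  assumes fin: "finite A"
  shows "(\<Sum>w\<in>A. \<Sum>u\<in>nbh A w. common A w u) \<le> 36 * shortfall A"
proof (cases "A = {}")
  case True
  then show ?thesis by (simp add: shortfall_def cherries_def)
next
  case False
  let ?a = "real (card A)"
  define Z where "Z = (\<Sum>w\<in>A. \<Sum>u\<in>nbh A w. missed A w u)"
  define B where "B = (\<Sum>w\<in>A. (deviation A w)\<^sup>2)"
  have a: "0 < ?a" using False fin by (auto simp: card_gt_0_iff)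
  have Zpos: "0 \<le> Z" by (auto simp: Z_def missed_def intro!: sum_nonneg)
  have nbh_le: "real (card (nbh A w)) \<le> ?a" for w
    using card_mono[OF fin nbh_subset] by simp
  have common_le: "common A w u \<le> ?a" for w u
    unfolding common_def using fin nbh_subset by (auto intro!: card_mono)
  have T: "real (card (triangles A)) = (\<Sum>w\<in>A. \<Sum>u\<in>nbh A w. common A w u)"
    using sum_triangles[OF fin, of "\<lambda>_. 1::real"] by (simp add: common_def)
  have missed1: "(\<Sum>(w, u, z)\<in>triangles A. missed A w u) \<le> ?a * Z"
  proof -
    have "(\<Sum>(w, u, z)\<in>triangles A. missed A w u) = (\<Sum>w\<in>A. \<Sum>u\<in>nbh A w. common A w u * missed A w u)"
      using fin by (simp add: sum_triangles common_def)
    also have "\<dots> \<le> (\<Sum>w\<in>A. \<Sum>u\<in>nbh A w. ?a * missed A w u)"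
      by (intro sum_mono mult_right_mono common_le) (simp add: missed_def)
    finally show ?thesis by (simp add: Z_def sum_distrib_left)
  qed
  have dev1: "(\<Sum>(w, u, z)\<in>triangles A. (deviation A w)\<^sup>2) \<le> ?a * ?a * B"
  proof -
    have "(\<Sum>(w, u, z)\<in>triangles A. (deviation A w)\<^sup>2)
        = (\<Sum>w\<in>A. \<Sum>u\<in>nbh A w. common A w u * (deviation A w)\<^sup>2)"
      using fin by (simp add: sum_triangles common_def)
    also have "\<dots> \<le> (\<Sum>w\<in>A. \<Sum>u\<in>nbh A w. ?a * (deviation A w)\<^sup>2)"
      by (intro sum_mono mult_right_mono common_le) simp
    also have "\<dots> = (\<Sum>w\<in>A. real (card (nbh A w)) * (?a * (deviation A w)\<^sup>2))" by simp
    also have "\<dots> \<le> (\<Sum>w\<in>A. ?a * (?a * (deviation A w)\<^sup>2))"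
      by (intro sum_mono mult_right_mono nbh_le) simp
    finally show ?thesis by (simp add: B_def sum_distrib_left mult.assoc)
  qed
  have "(\<Sum>w\<in>A. \<Sum>u\<in>nbh A w. common A w u) * (?a / 4) = (\<Sum>\<tau>\<in>triangles A. ?a / 4)"
    unfolding T[symmetric] by simp
  also have "\<dots> \<le> (\<Sum>(w, u, z)\<in>triangles A. missed A w u + missed A u z + missed A z w
     + 3 / ?a * ((deviation A w)\<^sup>2 + (deviation A u)\<^sup>2 + (deviation A z)\<^sup>2))"
    by (rule sum_mono) (use triangle_counts[OF fin] in auto)
  also have "\<dots> = (\<Sum>(w, u, z)\<in>triangles A. missed A w u) + (\<Sum>(w, u, z)\<in>triangles A. missed A u z)
     + (\<Sum>(w, u, z)\<in>triangles A. missed A z w)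
     + 3 / ?a * ((\<Sum>(w, u, z)\<in>triangles A. (deviation A w)\<^sup>2)
       + (\<Sum>(w, u, z)\<in>triangles A. (deviation A u)\<^sup>2)
       + (\<Sum>(w, u, z)\<in>triangles A. (deviation A z)\<^sup>2))"
    by (simp add: split_def sum.distrib sum_distrib_left distrib_left)
  also have "\<dots> = 3 * (\<Sum>(w, u, z)\<in>triangles A. missed A w u)
     + 3 / ?a * (3 * (\<Sum>(w, u, z)\<in>triangles A. (deviation A w)\<^sup>2))"
    using sum_triangles_rotate[of "\<lambda>w u z. missed A w u" A] sum_triangles_rotate[of "\<lambda>w u z. missed A u z" A]
      sum_triangles_rotate[of "\<lambda>w u z. (deviation A w)\<^sup>2" A]
      sum_triangles_rotate[of "\<lambda>w u z. (deviation A u)\<^sup>2" A]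
    by simp
  also have "\<dots> \<le> 3 * (?a * Z) + 3 / ?a * (3 * (?a * ?a * B))"
    using missed1 dev1 a by (intro add_mono mult_left_mono) auto
  also have "\<dots> = (12 * Z + 36 * B) * (?a / 4)"
    using a by (simp add: field_simps)
  finally have "(\<Sum>w\<in>A. \<Sum>u\<in>nbh A w. common A w u) \<le> 12 * Z + 36 * B"
    using a by simp
  also have "\<dots> \<le> 36 * (Z + B)" using Zpos by simp
  also have "Z + B = shortfall A" using shortfall_eq[OF fin] by (simp add: Z_def B_def)
  finally show ?thesis .
qed

lemma sum_arcs_le:
  assumes fin: "finite A" and nn: "\<And>w. w \<in> A \<Longrightarrow> 0 \<le> f w"
  shows "(\<Sum>w\<in>A. \<Sum>u\<in>nbh A w. f w) \<le> real (card A) * sum f A"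
proof -
  have "(\<Sum>w\<in>A. \<Sum>u\<in>nbh A w. f w) = (\<Sum>w\<in>A. real (card (nbh A w)) * f w)" by simp
  also have "\<dots> \<le> (\<Sum>w\<in>A. real (card A) * f w)"
    using card_mono[OF fin nbh_subset] by (intro sum_mono mult_right_mono nn) auto
  finally show ?thesis by (simp add: sum_distrib_left)
qed

text \<open>The two classes are \<open>nbh A w\<close> and its complement. An edge inside \<open>nbh A w\<close> either avoids \<open>nbh A u\<close> at both ends, and
  is then counted as an edge outside the neighbourhood of \<open>u\<close>, or it meets the common neighbourhood.\<close>

lemma conflicts_of_arc:
  assumes fin: "finite A" and w: "w \<in> A" and u: "u \<in> nbh A w"
  shows "real (card (conflicts A (\<sim>) (\<lambda>x y. (x \<in> nbh A w) \<noteq> (y \<in> nbh A w))))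
    \<le> 2 * (\<Sum>x\<in>nbh A w. missed A w x)
      + real (card {(x, y). x \<in> A - nbh A w \<and> y \<in> A - nbh A w \<and> x \<sim> y})
      + real (card {(x, y). x \<in> A - nbh A u \<and> y \<in> A - nbh A u \<and> x \<sim> y})
      + 2 * real (card A) * common A w u"
proof -
  let ?N = "nbh A w" and ?M = "nbh A u"
  define P where "P = (SIGMA x:?N. A - ?N - nbh A x)"
  define I where "I v = {(x, y). x \<in> A - nbh A v \<and> y \<in> A - nbh A v \<and> x \<sim> y}" for v
  have finP: "finite P" unfolding P_def using fin by (auto intro!: finite_SigmaI)
  have finI: "finite (I v)" for v
    by (rule finite_subset[of _ "A \<times> A"]) (use fin in \<open>auto simp: I_def\<close>)
  have cP: "real (card P) = (\<Sum>x\<in>?N. missed A w x)"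
    using fin by (simp add: P_def missed_def)
  have "conflicts A (\<sim>) (\<lambda>x y. (x \<in> ?N) \<noteq> (y \<in> ?N))
      \<subseteq> P \<union> prod.swap ` P \<union> I w \<union> I u \<union> (?N \<inter> ?M) \<times> A \<union> A \<times> (?N \<inter> ?M)"
    unfolding conflicts_def P_def I_def
    by (auto simp: nbh_def image_iff adj_commute)
  then have "card (conflicts A (\<sim>) (\<lambda>x y. (x \<in> ?N) \<noteq> (y \<in> ?N)))
      \<le> card (P \<union> prod.swap ` P \<union> I w \<union> I u \<union> (?N \<inter> ?M) \<times> A \<union> A \<times> (?N \<inter> ?M))"
    using fin finP finI by (intro card_mono) auto
  also have "\<dots> \<le> card P + card P + card (I w) + card (I u) + card ((?N \<inter> ?M) \<times> A) + card (A \<times> (?N \<inter> ?M))"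
    using card_image_le[OF finP, of prod.swap]
    by (intro order.trans[OF card_Un_le] add_mono) auto
  also have "\<dots> = card P + card P + card (I w) + card (I u) + 2 * (card A * card (?N \<inter> ?M))"
    by (simp add: card_cartesian_product)
  finally have "real (card (conflicts A (\<sim>) (\<lambda>x y. (x \<in> ?N) \<noteq> (y \<in> ?N))))
     \<le> real (card P + card P + card (I w) + card (I u) + 2 * (card A * card (?N \<inter> ?M)))"
    by (simp only: of_nat_le_iff)
  then show ?thesis by (simp add: cP common_def I_def)
qed

lemma sum_arcs_in_conbh:
  assumes fin: "finite A"
  shows "(\<Sum>v\<in>A. real (card {(x, y). x \<in> A - nbh A v \<and> y \<in> A - nbh A v \<and> x \<sim> y}))
    = (\<Sum>w\<in>A. \<Sum>u\<in>nbh A w. missed A w u)"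
proof -
  define Q where "Q = {(v, x, y). v \<in> A \<and> x \<in> A - nbh A v \<and> y \<in> A - nbh A v \<and> x \<sim> y}"
  have finQ: "finite Q"
    by (rule finite_subset[of _ "A \<times> A \<times> A"]) (use fin in \<open>auto simp: Q_def\<close>)
  have finI: "finite {(x, y). x \<in> A - nbh A v \<and> y \<in> A - nbh A v \<and> x \<sim> y}" for v
    by (rule finite_subset[of _ "A \<times> A"]) (use fin in auto)
  have "Q = (SIGMA v:A. {(x, y). x \<in> A - nbh A v \<and> y \<in> A - nbh A v \<and> x \<sim> y})"
    by (auto simp: Q_def)
  then have 1: "card Q = (\<Sum>v\<in>A. card {(x, y). x \<in> A - nbh A v \<and> y \<in> A - nbh A v \<and> x \<sim> y})"
    using fin finI by simp
  have "bij_betw (\<lambda>(v, x, y). (x, y, v)) Q (SIGMA w:A. SIGMA u:nbh A w. A - nbh A w - nbh A u)"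
    by (rule bij_betw_byWitness[of _ "\<lambda>(x, y, v). (v, x, y)"])
       (auto simp: Q_def nbh_def adj_commute)
  then have "card Q = card (SIGMA w:A. SIGMA u:nbh A w. A - nbh A w - nbh A u)"
    by (rule bij_betw_same_card)
  also have "\<dots> = (\<Sum>w\<in>A. \<Sum>u\<in>nbh A w. card (A - nbh A w - nbh A u))"
    using fin by simp
  finally show ?thesis using 1 by (simp add: missed_def flip: of_nat_sum)
qed

text \<open>An arc with at most average conflicts works, since each kind of conflict summed over all arcs is at most the
  number of vertices times a multiple of the shortfall.\<close>

lemma near_bipartite:
  assumes fin: "finite A" and ne: "cherries A \<noteq> {}"
  shows "\<exists>I. real (card (conflicts A (\<sim>) (\<lambda>x y. (x \<in> I) \<noteq> (y \<in> I)))) * real (card (cherries A))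
     \<le> 76 * (real (card A))\<^sup>2 * shortfall A"
proof -
  let ?a = "real (card A)"
  define Z where "Z = (\<Sum>w\<in>A. \<Sum>u\<in>nbh A w. missed A w u)"
  define arcs where "arcs = (SIGMA w:A. nbh A w)"
  define g where "g v = real (card {(x, y). x \<in> A - nbh A v \<and> y \<in> A - nbh A v \<and> x \<sim> y})" for v
  define m where "m v = (\<Sum>x\<in>nbh A v. missed A v x)" for v
  define cost where "cost = (\<lambda>(w, u). 2 * m w + g w + g u + 2 * ?a * common A w u)"
  have finarcs: "finite arcs" unfolding arcs_def using fin by (auto intro!: finite_SigmaI)
  have arcs_ne: "arcs \<noteq> {}" using ne by (auto simp: arcs_def cherries_def)
  have Z_le: "0 \<le> Z" "Z \<le> shortfall A"
    using shortfall_eq[OF fin] by (auto simp: Z_def missed_def intro!: sum_nonneg)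
  have sums: "sum m A = Z" "sum g A = Z"
    unfolding m_def g_def sum_arcs_in_conbh[OF fin] Z_def by simp_all
  have nn: "0 \<le> m w" "0 \<le> g w" for w
    by (auto simp: m_def g_def missed_def intro!: sum_nonneg)
  obtain p where p: "p \<in> arcs" "cost p * real (card arcs) \<le> sum cost arcs"
    using exists_le_average[OF finarcs arcs_ne, of cost] by blast
  obtain w u where wu: "p = (w, u)" "w \<in> A" "u \<in> nbh A w" using p by (auto simp: arcs_def)
  have "sum cost arcs = (\<Sum>w\<in>A. \<Sum>u\<in>nbh A w. 2 * m w + g w + g u + 2 * ?a * common A w u)"
    unfolding arcs_def cost_def using fin by (simp add: sum.Sigma)
  also have "\<dots> = 2 * (\<Sum>w\<in>A. \<Sum>u\<in>nbh A w. m w) + (\<Sum>w\<in>A. \<Sum>u\<in>nbh A w. g w)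
      + (\<Sum>w\<in>A. \<Sum>u\<in>nbh A w. g u) + 2 * ?a * (\<Sum>w\<in>A. \<Sum>u\<in>nbh A w. common A w u)"
    unfolding sum_distrib_left by (simp add: sum.distrib distrib_left)
  also have "(\<Sum>w\<in>A. \<Sum>u\<in>nbh A w. g u) = (\<Sum>w\<in>A. \<Sum>u\<in>nbh A w. g w)"
    by (rule sum_arcs_swap[OF fin])
  also have "2 * (\<Sum>w\<in>A. \<Sum>u\<in>nbh A w. m w) + (\<Sum>w\<in>A. \<Sum>u\<in>nbh A w. g w)
      + (\<Sum>w\<in>A. \<Sum>u\<in>nbh A w. g w) + 2 * ?a * (\<Sum>w\<in>A. \<Sum>u\<in>nbh A w. common A w u)
      \<le> 2 * (?a * Z) + ?a * Z + ?a * Z + 2 * ?a * (36 * shortfall A)"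
    using sum_arcs_le[OF fin, of m] sum_arcs_le[OF fin, of g] nn
    by (intro add_mono mult_left_mono sum_common_le[OF fin]) (auto simp: sums)
  also have "\<dots> \<le> 76 * (?a * shortfall A)"
  proof -
    have "?a * Z \<le> ?a * shortfall A" using Z_le by (intro mult_left_mono) auto
    then show ?thesis by (simp add: algebra_simps)
  qed
  finally have total: "sum cost arcs \<le> 76 * (?a * shortfall A)" .
  define W where "W = real (card (conflicts A (\<sim>) (\<lambda>x y. (x \<in> nbh A w) \<noteq> (y \<in> nbh A w))))"
  have "W \<le> cost p"
    using conflicts_of_arc[OF fin wu(2,3)] by (simp add: W_def cost_def wu m_def g_def)
  have "real (card (cherries A)) \<le> real (card arcs) * ?a"
  proof -
    have "cherries A \<subseteq> (\<lambda>((w, u), v). (w, u, v)) ` (arcs \<times> A)"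
      by (auto simp: cherries_def arcs_def nbh_def image_iff)
    then have "card (cherries A) \<le> card (arcs \<times> A)"
      using fin finarcs by (meson finite_SigmaI surj_card_le finite_cartesian_product)
    then show ?thesis by (simp add: card_cartesian_product flip: of_nat_mult)
  qed
  then have "W * real (card (cherries A)) \<le> W * (real (card arcs) * ?a)"
    by (intro mult_left_mono) (auto simp: W_def)
  also have "\<dots> \<le> cost p * (real (card arcs) * ?a)"
    using \<open>W \<le> cost p\<close> by (intro mult_right_mono) auto
  also have "\<dots> \<le> 76 * (?a * shortfall A) * ?a"
    using mult_right_mono[OF order.trans[OF p(2) total], of ?a] by (simp add: mult.assoc)
  finally show ?thesis unfolding W_def
    by (intro exI[of _ "nbh A w"]) (simp add: power2_eq_square mult_ac)
qed

lemma shortfall_le: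
  assumes "3 \<le> card A" "cherry_ratio A \<le> 1"
  shows "shortfall A \<le> real (card A) / 4 * (1 + (1 - cherry_ratio A) * (real (card A))\<^sup>2)"
proof -
  define a where "a = real (card A)"
  define r where "r = cherry_ratio A"
  have a: "3 \<le> a" using assms by (simp add: a_def)
  have "real (card (cherries A)) = r * (a\<^sup>2 * (a - 2) / 4)"
    using a by (simp add: r_def cherry_ratio_def a_def)
  then have "shortfall A = a * (a - 1)\<^sup>2 / 4 - r * (a\<^sup>2 * (a - 2) / 4)"
    by (simp add: shortfall_def a_def)
  also have "\<dots> = a / 4 * (1 + (1 - r) * (a * (a - 2)))"
    by (simp add: power2_eq_square field_simps)
  also have "\<dots> \<le> a / 4 * (1 + (1 - r) * a\<^sup>2)"
    using a assms by (intro mult_left_mono add_left_mono) (auto simp: power2_eq_square r_def)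
  finally show ?thesis by (simp add: a_def r_def)
qed

corollary near_bipartite_of_ratio:
  assumes fin: "finite A" and a3: "3 \<le> card A" and r: "1 / 2 \<le> cherry_ratio A"
  shows "\<exists>I. real (card (conflicts A (\<sim>) (\<lambda>x y. (x \<in> I) \<noteq> (y \<in> I))))
     \<le> 456 * (1 + (1 - cherry_ratio A) * (real (card A))\<^sup>2)"
proof -
  define a where "a = real (card A)"
  define q where "q = real (card (cherries A))"
  have a: "3 \<le> a" using a3 by (simp add: a_def)
  have "1 / 2 * (a\<^sup>2 * (a - 2) / 4) \<le> q"
    using r a by (simp add: cherry_ratio_def a_def q_def field_simps)
  moreover have "a\<^sup>2 * (a / 3) \<le> a\<^sup>2 * (a - 2)" using a by (intro mult_left_mono) auto
  ultimately have q: "a^3 / 24 \<le> q" by (simp add: power2_eq_square power3_eq_cube)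
  have apos: "0 < a^3 / 24" using a by simp
  then have "cherries A \<noteq> {}" using q by (auto simp: q_def)
  then obtain I where I: "real (card (conflicts A (\<sim>) (\<lambda>x y. (x \<in> I) \<noteq> (y \<in> I)))) * q
     \<le> 76 * a\<^sup>2 * shortfall A"
    using near_bipartite[OF fin] by (auto simp: a_def q_def)
  define W where "W = real (card (conflicts A (\<sim>) (\<lambda>x y. (x \<in> I) \<noteq> (y \<in> I))))"
  have "W * (a^3 / 24) \<le> W * q" using q by (intro mult_left_mono) (auto simp: W_def)
  also have "\<dots> \<le> 76 * a\<^sup>2 * shortfall A" using I by (simp add: W_def)
  also have "\<dots> \<le> 76 * a\<^sup>2 * (a / 4 * (1 + (1 - cherry_ratio A) * a\<^sup>2))"
    using shortfall_le[OF a3 cherry_ratio_le_1[OF fin a3]]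
    by (intro mult_left_mono) (auto simp: a_def)
  also have "\<dots> = 456 * (1 + (1 - cherry_ratio A) * a\<^sup>2) * (a^3 / 24)"
    by (simp add: power2_eq_square power3_eq_cube)
  finally have "W \<le> 456 * (1 + (1 - cherry_ratio A) * a\<^sup>2)"
    using apos by (rule mult_right_le_imp_le)
  then show ?thesis by (auto simp: W_def a_def)
qed

text \<open>A vertex of degree about \<open>a / 2\<close> in few triangles is the centre of more than \<open>a\<^sup>2 / 16\<close> cherries, and the
  lack of cherries at a vertex is at most its squared deviation plus its number of triangles. So a sum over centres of
  cherries controls the plain sum over vertices.\<close>

lemma sum_weighted_by_centres:
  assumes fin: "finite A" and a: "20 \<le> card A" and g: "\<And>w. w \<in> A \<Longrightarrow> 0 \<le> g w \<and> g w \<le> n"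
  shows "(real (card A))\<^sup>2 / 16 * sum g A
    \<le> (\<Sum>(w, u, v)\<in>cherries A. g w) + 37 * n * shortfall A"
proof -
  define a where "a = real (card A)"
  define t where "t w = (\<Sum>u\<in>nbh A w. common A w u)" for w
  define \<pi> where "\<pi> w = (\<Sum>u\<in>nbh A w. real (card (nbh A w - nbh A u - {u})))" for w
  have n: "0 \<le> n" if "A \<noteq> {}" using g that by fastforce
  have tnn: "0 \<le> t w" for w by (auto simp: t_def common_def intro!: sum_nonneg)
  have key: "a\<^sup>2 / 16 \<le> \<pi> w + ((deviation A w)\<^sup>2 + t w)" if w: "w \<in> A" for w
  proof -
    define \<delta> where "\<delta> = real (card (nbh A w))"
    define b where "b = deviation A w"
    have "\<pi> w = (\<Sum>u\<in>nbh A w. \<delta> - 1 - common A w u)"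
      unfolding \<pi>_def \<delta>_def by (intro sum.cong refl card_leaves fin)
    then have pi: "\<pi> w = \<delta> * (\<delta> - 1) - t w"
      by (simp add: sum_subtractf t_def \<delta>_def right_diff_distrib)
    have \<delta>: "\<delta> = (a - 1) / 2 + b" by (simp add: b_def \<delta>_def deviation_def a_def)
    have \<delta>a: "\<delta> \<le> a" unfolding \<delta>_def a_def using card_mono[OF fin nbh_subset] by simp
    have "0 \<le> (a - 1 + 4 * b)\<^sup>2" by simp
    then have "(a - 1)\<^sup>2 / 8 \<le> \<delta>\<^sup>2 + b\<^sup>2"
      unfolding \<delta> by (simp add: power2_eq_square field_simps)
    moreover have "a\<^sup>2 / 16 \<le> (a - 1)\<^sup>2 / 8 - a"
    proof -
      have "20 * a \<le> a * a" using a by (intro mult_right_mono) (auto simp: a_def)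
      then show ?thesis by (simp add: power2_eq_square field_simps)
    qed
    ultimately show ?thesis using \<delta>a unfolding pi b_def[symmetric]
      by (simp add: power2_eq_square algebra_simps)
  qed
  have "a\<^sup>2 / 16 * sum g A = (\<Sum>w\<in>A. g w * (a\<^sup>2 / 16))"
    by (subst mult.commute) (rule sum_distrib_right)
  also have "\<dots> \<le> (\<Sum>w\<in>A. g w * \<pi> w + n * ((deviation A w)\<^sup>2 + t w))"
  proof (rule sum_mono)
    fix w assume w: "w \<in> A"
    have "g w * (a\<^sup>2 / 16) \<le> g w * (\<pi> w + ((deviation A w)\<^sup>2 + t w))"
      using g[OF w] key[OF w] by (intro mult_left_mono) auto
    also have "\<dots> = g w * \<pi> w + g w * ((deviation A w)\<^sup>2 + t w)" by (simp add: distrib_left)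
    also have "\<dots> \<le> g w * \<pi> w + n * ((deviation A w)\<^sup>2 + t w)"
      using g[OF w] tnn by (intro add_left_mono mult_right_mono) auto
    finally show "g w * (a\<^sup>2 / 16) \<le> g w * \<pi> w + n * ((deviation A w)\<^sup>2 + t w)" .
  qed
  also have "\<dots> = (\<Sum>w\<in>A. g w * \<pi> w) + n * ((\<Sum>w\<in>A. (deviation A w)\<^sup>2) + sum t A)"
    by (simp add: sum.distrib sum_distrib_left distrib_left)
  also have "(\<Sum>w\<in>A. g w * \<pi> w) = (\<Sum>(w, u, v)\<in>cherries A. g w)"
    using fin by (simp add: sum_cherries \<pi>_def sum_distrib_left mult.commute)
  also have "n * ((\<Sum>w\<in>A. (deviation A w)\<^sup>2) + sum t A) \<le> n * (37 * shortfall A)"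
  proof (rule mult_left_mono)
    have "(\<Sum>w\<in>A. (deviation A w)\<^sup>2) \<le> shortfall A"
      unfolding shortfall_eq[OF fin] by (auto simp: missed_def intro!: sum_nonneg)
    then show "(\<Sum>w\<in>A. (deviation A w)\<^sup>2) + sum t A \<le> 37 * shortfall A"
      using sum_common_le[OF fin] by (simp add: t_def)
    show "0 \<le> n" using n a by fastforce
  qed
  finally show ?thesis by (simp add: a_def split_def)
qed

end

section \<open>Many separated pairs force two bicliques\<close>

text \<open>The colour \<open>k\<close> names the component and \<open>b\<close> the side: up to names of the classes, these are the blowups
  of \<open>B15\<close>.\<close>

definition two_bicliques :: "('a \<Rightarrow> bool) \<Rightarrow> ('a \<Rightarrow> bool) \<Rightarrow> 'a \<Rightarrow> 'a \<Rightarrow> bool" where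
  "two_bicliques k b x y \<longleftrightarrow> k x = k y \<and> b x \<noteq> b y"

context graph begin

text \<open>All three ways in which a pair can fall short of the extremal configuration, on a common scale.\<close>

definition pair_loss :: "'a set \<Rightarrow> 'a \<times> 'a \<times> 'a \<Rightarrow> 'a \<times> 'a \<times> 'a \<Rightarrow> real" where
  "pair_loss V \<tau> \<tau>' = defect V \<tau> \<tau>' / real (card V)
     + (1 - cherry_ratio (away V \<tau>)) + (1 - cherry_ratio (away V \<tau>'))"

lemma sum_pair_loss_le:
  assumes fin: "finite V"
  shows "(\<Sum>(\<tau>, \<tau>')\<in>cherry_pairs V. pair_loss V \<tau> \<tau>')
    \<le> 7 * (pair_bound (real (card V)) - real (card (cherry_pairs V)))"
proof -
  let ?R = "real (card (cherry_pairs V))"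
  have "(\<Sum>(\<tau>, \<tau>')\<in>cherry_pairs V. defect V \<tau> \<tau>' / real (card V)) \<le> pair_bound (real (card V)) - ?R"
    using sum_defect_le[OF fin] by (simp add: split_def sum.distrib)
  moreover have "(\<Sum>(\<tau>, \<tau>')\<in>cherry_pairs V. 1 - cherry_ratio (away V \<tau>'))
      = (\<Sum>(\<tau>, \<tau>')\<in>cherry_pairs V. 1 - cherry_ratio (away V \<tau>))"
    using sum_cherry_pairs_swap[of "\<lambda>\<tau> \<tau>'. 1 - cherry_ratio (away V \<tau>')" V] .
  moreover have "(\<Sum>(\<tau>, \<tau>')\<in>cherry_pairs V. pair_loss V \<tau> \<tau>')
      = (\<Sum>(\<tau>, \<tau>')\<in>cherry_pairs V. defect V \<tau> \<tau>' / real (card V))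
        + (\<Sum>(\<tau>, \<tau>')\<in>cherry_pairs V. 1 - cherry_ratio (away V \<tau>))
        + (\<Sum>(\<tau>, \<tau>')\<in>cherry_pairs V. 1 - cherry_ratio (away V \<tau>'))"
    by (simp only: pair_loss_def split_def sum.distrib)
  moreover have "s \<le> 7 * c" if "x \<le> c" "z = y" "s = x + y + z" "y \<le> 3 * c" for s x y z c :: real
    using that by linarith
  ultimately show ?thesis
    using sum_cherry_ratio_le[OF fin] by blast
qed

lemma pair_loss_parts:
  assumes fin: "finite V" and p: "(\<tau>, \<tau>') \<in> cherry_pairs V"
  shows "0 \<le> defect V \<tau> \<tau>'" "defect V \<tau> \<tau>' \<le> real (card V) * pair_loss V \<tau> \<tau>'"
    "1 - cherry_ratio (away V \<tau>) \<le> pair_loss V \<tau> \<tau>'"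
    "1 - cherry_ratio (away V \<tau>') \<le> pair_loss V \<tau> \<tau>'"
    "0 \<le> pair_loss V \<tau> \<tau>'"
proof -
  have p': "(\<tau>', \<tau>) \<in> cherry_pairs V" using p by (simp add: cherry_pairs_sym)
  have r: "cherry_ratio (away V \<tau>) \<le> 1" "cherry_ratio (away V \<tau>') \<le> 1"
    using cherry_pair_sizes(6)[OF fin p] cherry_pair_sizes(6)[OF fin p'] fin
    by (auto intro!: cherry_ratio_le_1)
  have n: "0 < real (card V)" using cherry_pair_sizes(1,3)[OF fin p] by simp
  show d: "0 \<le> defect V \<tau> \<tau>'" by (rule defect_nonneg[OF fin p])
  then have d': "0 \<le> defect V \<tau> \<tau>' / real (card V)" by simp
  show "1 - cherry_ratio (away V \<tau>) \<le> pair_loss V \<tau> \<tau>'"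
    "1 - cherry_ratio (away V \<tau>') \<le> pair_loss V \<tau> \<tau>'" "0 \<le> pair_loss V \<tau> \<tau>'"
    using r d' by (auto simp: pair_loss_def)
  have "defect V \<tau> \<tau>' / real (card V) \<le> pair_loss V \<tau> \<tau>'" using r by (simp add: pair_loss_def)
  then show "defect V \<tau> \<tau>' \<le> real (card V) * pair_loss V \<tau> \<tau>'" using n by (simp add: field_simps)
qed

lemma card_reach_Int_le_defect:
  assumes fin: "finite V"
  shows "real (card (reach V \<tau> \<inter> reach V \<tau>')) \<le> defect V \<tau> \<tau>'"
proof -
  let ?N = "reach V \<tau>" and ?N' = "reach V \<tau>'"
  have "card (?N \<inter> ?N') + (card (?N' - ?N) + card (?N - ?N')) = card ((?N \<inter> ?N') \<union> ((?N' - ?N) \<union> (?N - ?N')))"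
    using fin by (subst card_Un_disjoint, simp, simp, force, subst card_Un_disjoint, auto)
  also have "\<dots> \<le> card V"
    using fin reach_subset[of V \<tau>] reach_subset[of V \<tau>'] by (intro card_mono) auto
  finally show ?thesis by (simp add: defect_def)
qed

text \<open>Averaging over pairs. The first cherries \<open>\<tau>\<close> with \<open>away V \<tau>\<close> smaller than \<open>n / 16\<close> contribute at most
  \<open>n\<^sup>3 (n / 16)\<^sup>3\<close> pairs, at most half of the total, so the remaining ones include one with at most twice the
  average loss.\<close>

lemma typical_cherry:
  assumes fin: "finite V"
  defines "n \<equiv> real (card V)" and "R \<equiv> real (card (cherry_pairs V))"
  assumes R: "0 < R" "n^6 / 1024 \<le> R"
  shows "\<exists>\<tau>\<in>cherries V. n / 16 \<le> real (card (away V \<tau>)) \<and> cherries (away V \<tau>) \<noteq> {} \<and>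
    (\<Sum>\<tau>'\<in>cherries (away V \<tau>). pair_loss V \<tau> \<tau>')
      \<le> 14 * (pair_bound n - R) / R * real (card (cherries (away V \<tau>)))"
proof (rule ccontr)
  define q where "q \<tau> = real (card (cherries (away V \<tau>)))" for \<tau>
  define L where "L \<tau> = (\<Sum>\<tau>'\<in>cherries (away V \<tau>). pair_loss V \<tau> \<tau>')" for \<tau>
  define \<eta> where "\<eta> = 14 * (pair_bound n - R) / R"
  define S where "S = {\<tau>\<in>cherries V. n / 16 \<le> real (card (away V \<tau>)) \<and> cherries (away V \<tau>) \<noteq> {}}"
  assume "\<not> ?thesis"
  then have neg: "\<eta> * q \<tau> < L \<tau>" if "\<tau> \<in> S" for \<tau>
    using that by (fastforce simp: S_def \<eta>_def q_def L_def)
  have finS: "finite S" using fin by (simp add: S_def)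
  have Lnn: "0 \<le> L \<tau>" if "\<tau> \<in> cherries V" for \<tau>
    unfolding L_def
    by (rule sum_nonneg, rule pair_loss_parts(5)[OF fin]) (use that in \<open>simp add: cherry_pairs_def\<close>)
  have "R = sum q (cherries V)"
    using sum_cherry_pairs[OF fin, of "\<lambda>_. 1::real"] by (simp add: R_def q_def)
  also have "\<dots> = sum q S + sum q (cherries V - S)"
    using fin by (subst add.commute, intro sum.subset_diff) (auto simp: S_def)
  also have "sum q (cherries V - S) \<le> (\<Sum>\<tau>\<in>cherries V - S. (n / 16)^3)"
  proof (rule sum_mono)
    fix \<tau> assume \<tau>: "\<tau> \<in> cherries V - S"
    define A where "A = away V \<tau>"
    show "q \<tau> \<le> (n / 16)^3"
    proof (cases "cherries A = {}")
      case False
      then have A: "real (card A) \<le> n / 16" using \<tau> by (auto simp: S_def A_def)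
      have finA: "finite A" using fin by (simp add: A_def)
      have "cherries A \<subseteq> A \<times> A \<times> A" by (auto simp: mem_cherries)
      then have "card (cherries A) \<le> card (A \<times> A \<times> A)" using finA by (intro card_mono) auto
      then have "q \<tau> \<le> real (card A)^3"
        by (simp add: q_def A_def card_cartesian_product power3_eq_cube flip: of_nat_mult)
      also have "\<dots> \<le> (n / 16)^3" using A by (intro power_mono) auto
      finally show ?thesis .
    qed (simp add: q_def A_def n_def)
  qed
  also have "\<dots> \<le> n^3 * (n / 16)^3"
  proof -
    have "cherries V \<subseteq> V \<times> V \<times> V" by (auto simp: mem_cherries)
    then have "card (cherries V - S) \<le> card (V \<times> V \<times> V)" using fin by (intro card_mono) auto
    then have "real (card (cherries V - S)) \<le> n^3"
      by (simp add: n_def card_cartesian_product power3_eq_cube flip: of_nat_mult)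
    then show ?thesis by (simp add: mult_right_mono n_def)
  qed
  also have "n^3 * (n / 16)^3 \<le> R / 2"
    using R by (simp add: power_divide field_simps power_numeral_reduce)
  finally have half: "R / 2 \<le> sum q S" by simp
  then have Sne: "S \<noteq> {}" using R by auto
  have \<eta>nn: "0 \<le> \<eta>" using card_cherry_pairs_le[OF fin] R by (simp add: \<eta>_def n_def R_def)
  have "7 * (pair_bound n - R) = \<eta> * (R / 2)" using R by (simp add: \<eta>_def)
  also have "\<dots> \<le> \<eta> * sum q S" using half \<eta>nn by (rule mult_left_mono)
  also have "\<dots> < sum L S"
    unfolding sum_distrib_left by (rule sum_strict_mono[OF finS Sne]) (rule neg)
  also have "\<dots> \<le> sum L (cherries V)"
    using fin Lnn by (intro sum_mono2) (auto simp: S_def)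
  also have "\<dots> \<le> 7 * (pair_bound n - R)"
    using sum_pair_loss_le[OF fin] sum_cherry_pairs[OF fin, of "\<lambda>(\<tau>, \<tau>'). pair_loss V \<tau> \<tau>'"]
    by (simp add: L_def n_def R_def)
  finally show False by simp
qed

text \<open>Take a typical \<open>\<tau>\<close> and split \<open>V\<close> into \<open>A = away V \<tau>\<close> and \<open>B = reach V \<tau>\<close>. Then \<open>A\<close> has almost the maximum number
  of cherries, and so has \<open>away V \<tau>'\<close> for a suitable cherry \<open>\<tau>'\<close> in \<open>A\<close>, which agrees with \<open>B\<close> up to the defect
  of \<open>\<tau>, \<tau>'\<close>. An edge from \<open>A\<close> to \<open>B\<close> adds a vertex of \<open>B\<close> to the neighbourhood of every cherry of \<open>A\<close> at its end,
  so the average defect bounds the number of these edges.\<close>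

lemma near_two_bicliques:
  assumes fin: "finite V"
  defines "n \<equiv> real (card V)" and "R \<equiv> real (card (cherry_pairs V))"
  defines "\<eta> \<equiv> 14 * (pair_bound n - R) / R"
  assumes n: "320 \<le> n" and R: "n^6 / 1024 \<le> R" and \<eta>: "\<eta> \<le> 1 / 2"
  shows "\<exists>k b. real (card (conflicts V (\<sim>) (two_bicliques k b))) \<le> 6000 * (1 + \<eta> * n\<^sup>2)"
proof -
  have Rpos: "0 < R" using n R by (intro less_le_trans[OF _ R]) auto
  have \<eta>nn: "0 \<le> \<eta>" using card_cherry_pairs_le[OF fin] Rpos by (simp add: \<eta>_def n_def R_def)
  obtain \<tau> where \<tau>: "\<tau> \<in> cherries V" and big: "n / 16 \<le> real (card (away V \<tau>))"
      and ne: "cherries (away V \<tau>) \<noteq> {}"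
      and loss: "(\<Sum>\<tau>'\<in>cherries (away V \<tau>). pair_loss V \<tau> \<tau>') \<le> \<eta> * real (card (cherries (away V \<tau>)))"
    using typical_cherry[OF fin] Rpos R by (auto simp: n_def R_def \<eta>_def)
  define A where "A = away V \<tau>"
  define B where "B = reach V \<tau>"
  define a where "a = real (card A)"
  have AB: "A \<union> B = V" "A \<inter> B = {}" "finite A" "finite B" "B \<subseteq> V" "A \<subseteq> V"
    using fin reach_subset[of V \<tau>] by (auto simp: A_def B_def away_def)
  have a: "n / 16 \<le> a" "a \<le> n" "20 \<le> a"
    using big n card_mono[OF fin AB(6)] by (auto simp: a_def A_def n_def)
  obtain \<tau>' where \<tau>': "\<tau>' \<in> cherries A" and le: "pair_loss V \<tau> \<tau>' * real (card (cherries A)) \<le> \<eta> * real (card (cherries A))"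
    using exists_le_average[of "cherries A" "pair_loss V \<tau>"] ne loss fin by (force simp: A_def)
  have "0 < real (card (cherries A))" using \<tau>' AB by (auto simp: card_gt_0_iff)
  then have le: "pair_loss V \<tau> \<tau>' \<le> \<eta>" using le by (simp add: mult_le_cancel_right)
  have pair: "(\<tau>, \<tau>'') \<in> cherry_pairs V" if "\<tau>'' \<in> cherries A" for \<tau>''
    using that \<tau> by (simp add: cherry_pairs_def A_def)
  note parts = pair_loss_parts[OF fin pair[OF \<tau>']]
  define B' where "B' = away V \<tau>'"
  have B': "finite B'" "real (card B') \<le> n" "3 \<le> card B'"
    using fin card_mono[OF fin, of B'] cherry_pair_sizes(6)[OF fin] pair[OF \<tau>']
    by (auto simp: B'_def away_def n_def cherry_pairs_sym)
  have ratios: "1 - cherry_ratio A \<le> \<eta>" "1 - cherry_ratio B' \<le> \<eta>"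
    using parts le by (auto simp: A_def B'_def)
  have near: "\<exists>I. real (card (conflicts X (\<sim>) (\<lambda>x y. (x \<in> I) \<noteq> (y \<in> I)))) \<le> 456 * (1 + \<eta> * n\<^sup>2)"
    if X: "finite X" "3 \<le> card X" "real (card X) \<le> n" "1 - cherry_ratio X \<le> \<eta>" for X
  proof -
    have "(1 - cherry_ratio X) * (real (card X))\<^sup>2 \<le> \<eta> * n\<^sup>2"
      using X \<eta>nn by (intro mult_mono power_mono) auto
    then have "456 * (1 + (1 - cherry_ratio X) * (real (card X))\<^sup>2) \<le> 456 * (1 + \<eta> * n\<^sup>2)" by simp
    moreover have "1 / 2 \<le> cherry_ratio X" using X \<eta> by linarith
    ultimately show ?thesis
      using near_bipartite_of_ratio[of X] X order.trans by blast
  qed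
  obtain I where I: "real (card (conflicts A (\<sim>) (\<lambda>x y. (x \<in> I) \<noteq> (y \<in> I)))) \<le> 456 * (1 + \<eta> * n\<^sup>2)"
    using near[of A] AB ratios a by (auto simp: a_def)
  obtain I' where I': "real (card (conflicts B' (\<sim>) (\<lambda>x y. (x \<in> I') \<noteq> (y \<in> I')))) \<le> 456 * (1 + \<eta> * n\<^sup>2)"
    using near[of B'] B' ratios by auto
  define g where "g w = real (card (nbh B w))" for w
  have cross: "sum g A \<le> 152 * \<eta> * n\<^sup>2 + 2368"
  proof -
    have "(\<Sum>(w, u, v)\<in>cherries A. g w) \<le> (\<Sum>\<tau>'\<in>cherries A. n * pair_loss V \<tau> \<tau>')"
    proof (rule sum_mono, clarify)
      fix w u v assume c: "(w, u, v) \<in> cherries A"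
      have "g w \<le> real (card (reach V \<tau> \<inter> reach V (w, u, v)))"
        unfolding g_def using fin
        by (auto simp: B_def reach_def nbh_def intro!: card_mono split: prod.splits)
      also have "\<dots> \<le> defect V \<tau> (w, u, v)" by (rule card_reach_Int_le_defect[OF fin])
      also have "\<dots> \<le> n * pair_loss V \<tau> (w, u, v)"
        using pair_loss_parts(2)[OF fin pair[OF c]] by (simp add: n_def)
      finally show "g w \<le> n * pair_loss V \<tau> (w, u, v)" .
    qed
    also have "\<dots> \<le> n * (\<eta> * real (card (cherries A)))"
      using loss n unfolding sum_distrib_left[symmetric] by (intro mult_left_mono) (auto simp: A_def)
    also have "\<dots> \<le> n * (\<eta> * (a^3 / 4))"
    proof (intro mult_left_mono)
      have "real (card (cherries A)) \<le> a\<^sup>2 * (a - 2) / 4"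
        using card_cherries_le[OF AB(3)] a by (simp add: a_def)
      also have "\<dots> \<le> a\<^sup>2 * a / 4" by (intro divide_right_mono mult_left_mono) auto
      finally show "real (card (cherries A)) \<le> a^3 / 4" by (simp add: power2_eq_square power3_eq_cube)
    qed (use \<eta>nn n in auto)
    finally have 1: "(\<Sum>(w, u, v)\<in>cherries A. g w) \<le> n * (\<eta> * (a^3 / 4))" .
    have gn: "g w \<le> n" for w
      unfolding g_def n_def using card_mono[OF fin, of "nbh B w"] AB by (auto simp: nbh_def)
    have "a\<^sup>2 / 16 * sum g A \<le> (\<Sum>(w, u, v)\<in>cherries A. g w) + 37 * n * shortfall A"
      using sum_weighted_by_centres[OF AB(3), of g n] a gn by (simp add: a_def g_def)
    also have "\<dots> \<le> n * (\<eta> * (a^3 / 4)) + 37 * n * (a / 4 * (1 + \<eta> * a\<^sup>2))"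
    proof (intro add_mono mult_left_mono 1)
      have "shortfall A \<le> a / 4 * (1 + (1 - cherry_ratio A) * a\<^sup>2)"
        using shortfall_le[of A] cherry_ratio_le_1[OF AB(3)] a by (simp add: a_def)
      also have "\<dots> \<le> a / 4 * (1 + \<eta> * a\<^sup>2)"
        using ratios a by (intro mult_left_mono add_left_mono mult_right_mono) auto
      finally show "shortfall A \<le> a / 4 * (1 + \<eta> * a\<^sup>2)" .
    qed (use n in auto)
    also have "\<dots> = a\<^sup>2 / 16 * (152 * \<eta> * (n * a) + 148 * (n / a))"
      using a by (simp add: field_simps power2_eq_square power3_eq_cube)
    finally have "sum g A \<le> 152 * \<eta> * (n * a) + 148 * (n / a)"
      using a by (simp add: mult_le_cancel_left)
    also have "\<dots> \<le> 152 * \<eta> * n\<^sup>2 + 148 * 16"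
    proof (intro add_mono mult_left_mono)
      show "n * a \<le> n\<^sup>2" using a n by (simp add: power2_eq_square mult_left_mono)
      show "n / a \<le> 16" using a by (simp add: field_simps)
    qed (use \<eta>nn in auto)
    finally show ?thesis by simp
  qed
  define k where "k x \<longleftrightarrow> x \<in> A" for x
  define b where "b x \<longleftrightarrow> (if x \<in> A then x \<in> I else x \<in> I')" for x
  define P where "P = (SIGMA w:A. nbh B w)"
  define D where "D = reach V \<tau> \<inter> reach V \<tau>'"
  have finP: "finite P" using AB by (auto simp: P_def intro!: finite_SigmaI)
  have finD: "finite D" using fin by (simp add: D_def)
  have "conflicts V (\<sim>) (two_bicliques k b)
      \<subseteq> conflicts A (\<sim>) (\<lambda>x y. (x \<in> I) \<noteq> (y \<in> I)) \<union> conflicts B' (\<sim>) (\<lambda>x y. (x \<in> I') \<noteq> (y \<in> I'))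
        \<union> P \<union> prod.swap ` P \<union> D \<times> V \<union> V \<times> D"
  proof
    fix p assume p: "p \<in> conflicts V (\<sim>) (two_bicliques k b)"
    obtain x y where xy: "p = (x, y)" by (cases p)
    have V: "x \<in> V" "y \<in> V" and c: "(x \<sim> y) \<noteq> two_bicliques k b x y" using p xy by (auto simp: conflicts_def)
    \<comment> \<open>Outside \<open>A\<close>, the set \<open>B\<close> is covered by \<open>B'\<close> and the common part \<open>D\<close>.\<close>
    have BD: "z \<in> A \<or> z \<in> D \<or> (z \<in> B' \<and> z \<in> B \<and> z \<notin> A)" if "z \<in> V" for z
      using that AB by (auto simp: D_def B'_def B_def A_def away_def)
    consider "x \<in> D \<or> y \<in> D" | "x \<in> A" "y \<in> A" | "x \<in> A" "y \<in> B" "y \<notin> A" | "y \<in> A" "x \<in> B" "x \<notin> A"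
      | "x \<in> B'" "y \<in> B'" "x \<notin> A" "y \<notin> A" using BD V by blast
    then show "p \<in> conflicts A (\<sim>) (\<lambda>x y. (x \<in> I) \<noteq> (y \<in> I)) \<union> conflicts B' (\<sim>) (\<lambda>x y. (x \<in> I') \<noteq> (y \<in> I'))
        \<union> P \<union> prod.swap ` P \<union> D \<times> V \<union> V \<times> D"
      by cases (use V c xy in \<open>auto simp: conflicts_def two_bicliques_def k_def b_def P_def nbh_def image_iff adj_commute\<close>)
  qed
  then have "card (conflicts V (\<sim>) (two_bicliques k b))
     \<le> card (conflicts A (\<sim>) (\<lambda>x y. (x \<in> I) \<noteq> (y \<in> I)) \<union> conflicts B' (\<sim>) (\<lambda>x y. (x \<in> I') \<noteq> (y \<in> I'))
        \<union> P \<union> prod.swap ` P \<union> D \<times> V \<union> V \<times> D)"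
    using fin AB B' finP finD by (intro card_mono) auto
  also have "\<dots> \<le> card (conflicts A (\<sim>) (\<lambda>x y. (x \<in> I) \<noteq> (y \<in> I)))
     + card (conflicts B' (\<sim>) (\<lambda>x y. (x \<in> I') \<noteq> (y \<in> I'))) + card P + card P + card (D \<times> V) + card (V \<times> D)"
    using card_image_le[OF finP, of prod.swap]
    by (intro order.trans[OF card_Un_le] add_mono) auto
  also have "\<dots> = card (conflicts A (\<sim>) (\<lambda>x y. (x \<in> I) \<noteq> (y \<in> I)))
     + card (conflicts B' (\<sim>) (\<lambda>x y. (x \<in> I') \<noteq> (y \<in> I'))) + 2 * card P + 2 * (card D * card V)"
    by (simp add: card_cartesian_product)
  finally have "real (card (conflicts V (\<sim>) (two_bicliques k b)))
     \<le> real (card (conflicts A (\<sim>) (\<lambda>x y. (x \<in> I) \<noteq> (y \<in> I)))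
     + card (conflicts B' (\<sim>) (\<lambda>x y. (x \<in> I') \<noteq> (y \<in> I'))) + 2 * card P + 2 * (card D * card V))"
    by (simp only: of_nat_le_iff)
  also have "\<dots> = real (card (conflicts A (\<sim>) (\<lambda>x y. (x \<in> I) \<noteq> (y \<in> I))))
     + real (card (conflicts B' (\<sim>) (\<lambda>x y. (x \<in> I') \<noteq> (y \<in> I')))) + 2 * sum g A + 2 * (real (card D) * n)"
    using AB by (simp add: P_def g_def n_def)
  also have "\<dots> \<le> 456 * (1 + \<eta> * n\<^sup>2) + 456 * (1 + \<eta> * n\<^sup>2) + 2 * (152 * \<eta> * n\<^sup>2 + 2368) + 2 * ((n * \<eta>) * n)"
  proof (intro add_mono I I' mult_left_mono cross mult_right_mono)
    have "real (card D) \<le> n * pair_loss V \<tau> \<tau>'"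
      using card_reach_Int_le_defect[OF fin, of \<tau> \<tau>'] parts(2) by (simp add: D_def n_def)
    also have "\<dots> \<le> n * \<eta>" using le n by (intro mult_left_mono) auto
    finally show "real (card D) \<le> n * \<eta>" .
  qed (use n in auto)
  also have "\<dots> \<le> 6000 * (1 + \<eta> * n\<^sup>2)"
    using \<eta>nn by (simp add: power2_eq_square algebra_simps)
  finally show ?thesis by blast
qed

end

section \<open>Induced copies of two disjoint cherries\<close>

definition support :: "('a \<times> 'a \<times> 'a) \<times> ('a \<times> 'a \<times> 'a) \<Rightarrow> 'a set" where
  "support = (\<lambda>((w, u, v), (w', u', v')). {w, u, v, w', u', v'})"

text \<open>Adding an edge to \<open>F15\<close> or deleting one never gives an induced subgraph of two disjoint bicliques: deletion leaves
  two disjoint edges and a fifth vertex adjacent to none of them, addition creates a triangle or an induced path on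
  four vertices. The pair \<open>e\<close> is the one that is changed.\<close>

lemma two_bicliques_no_single_conflict:
  fixes k b :: "'a \<Rightarrow> bool"
  assumes d: "distinct [w,u,v,w',u',v']"
    and e: "e \<in> {(w,u),(w,v),(w',u'),(w',v'),(u,v),(u',v'),(w,w'),(w,u'),(w,v'),(u,w'),(u,u'),(u,v'),(v,w'),(v,u'),(v,v')}"
    and c: "two_bicliques k b w u = (e \<noteq> (w,u))" "two_bicliques k b w v = (e \<noteq> (w,v))"
      "two_bicliques k b w' u' = (e \<noteq> (w',u'))" "two_bicliques k b w' v' = (e \<noteq> (w',v'))"
      "two_bicliques k b u v = (e = (u,v))" "two_bicliques k b u' v' = (e = (u',v'))"
      "two_bicliques k b w w' = (e = (w,w'))" "two_bicliques k b w u' = (e = (w,u'))"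
      "two_bicliques k b w v' = (e = (w,v'))" "two_bicliques k b u w' = (e = (u,w'))"
      "two_bicliques k b u u' = (e = (u,u'))" "two_bicliques k b u v' = (e = (u,v'))"
      "two_bicliques k b v w' = (e = (v,w'))" "two_bicliques k b v u' = (e = (v,u'))"
      "two_bicliques k b v v' = (e = (v,v'))"
  shows False
proof -
  have d': "w \<noteq> u" "w \<noteq> v" "w \<noteq> w'" "w \<noteq> u'" "w \<noteq> v'" "u \<noteq> v" "u \<noteq> w'" "u \<noteq> u'" "u \<noteq> v'"
    "v \<noteq> w'" "v \<noteq> u'" "v \<noteq> v'" "w' \<noteq> u'" "w' \<noteq> v'" "u' \<noteq> v'" using d by auto
  note d'' = d' d'[symmetric]
  show False
    using e c unfolding two_bicliques_def
    by (elim insertE emptyE; simp only: prod.inject d'' simp_thms; sat)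
qed

context graph begin

definition copies :: "'a set \<Rightarrow> 'a set set" where
  "copies V = support ` cherry_pairs V"

lemma mem_cherry_pairs:
  "((w, u, v), (w', u', v')) \<in> cherry_pairs V \<longleftrightarrow>
    {w, u, v, w', u', v'} \<subseteq> V \<and> distinct [w, u, v, w', u', v'] \<and>
    w \<sim> u \<and> w \<sim> v \<and> w' \<sim> u' \<and> w' \<sim> v' \<and> \<not> u \<sim> v \<and> \<not> u' \<sim> v' \<and>
    \<not> w \<sim> w' \<and> \<not> w \<sim> u' \<and> \<not> w \<sim> v' \<and> \<not> u \<sim> w' \<and> \<not> u \<sim> u' \<and> \<not> u \<sim> v' \<and>
    \<not> v \<sim> w' \<and> \<not> v \<sim> u' \<and> \<not> v \<sim> v'" (is "_ \<longleftrightarrow> ?R")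
proof -
  have away: "x \<in> away V (w, u, v) \<longleftrightarrow> x \<in> V \<and> x \<notin> {w, u, v} \<and> \<not> w \<sim> x \<and> \<not> u \<sim> x \<and> \<not> v \<sim> x"
    if "(w, u, v) \<in> cherries V" for x
    using that by (auto simp: away_def reach_def nbh_def mem_cherries dest: adj_sym)
  show ?thesis
  proof (cases "(w, u, v) \<in> cherries V")
    case True
    then show ?thesis
      unfolding cherry_pairs_def mem_Sigma_iff mem_cherries[of w' u' v'] away[OF True]
      by (auto simp: mem_cherries)
  next
    case False
    show ?thesis
    proof
      assume "((w, u, v), (w', u', v')) \<in> cherry_pairs V"
      then have "(w, u, v) \<in> cherries V" by (simp add: cherry_pairs_def)
      with False show ?R by simp
    next
      assume ?R
      then have "(w, u, v) \<in> cherries V" by (simp add: mem_cherries)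
      with False show "((w, u, v), (w', u', v')) \<in> cherry_pairs V" by simp
    qed
  qed
qed

lemma mem_copies:
  "U \<in> copies V \<longleftrightarrow> (\<exists>w u v w' u' v'. ((w, u, v), (w', u', v')) \<in> cherry_pairs V \<and> U = {w, u, v, w', u', v'})"
  by (simp only: copies_def image_iff Bex_def split_paired_Ex support_def prod.case)

lemma finite_copies [simp]: "finite V \<Longrightarrow> finite (copies V)"
  by (simp add: copies_def)

text \<open>The adjacencies within a copy in both orientations, as rewrite rules for case distinctions over its vertices.\<close>

lemma cherry_pair_facts:
  assumes p: "((w, u, v), (w', u', v')) \<in> cherry_pairs V"
  shows "w \<noteq> u" "w \<noteq> v" "w \<noteq> w'" "w \<noteq> u'" "w \<noteq> v'" "u \<noteq> v" "u \<noteq> w'" "u \<noteq> u'" "u \<noteq> v'"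
    "v \<noteq> w'" "v \<noteq> u'" "v \<noteq> v'" "w' \<noteq> u'" "w' \<noteq> v'" "u' \<noteq> v'"
    and "w \<sim> u" "w \<sim> v" "w' \<sim> u'" "w' \<sim> v'" "u \<sim> w" "v \<sim> w" "u' \<sim> w'" "v' \<sim> w'"
    and "\<not> u \<sim> v" "\<not> u' \<sim> v'" "\<not> w \<sim> w'" "\<not> w \<sim> u'" "\<not> w \<sim> v'" "\<not> u \<sim> w'" "\<not> u \<sim> u'" "\<not> u \<sim> v'"
    "\<not> v \<sim> w'" "\<not> v \<sim> u'" "\<not> v \<sim> v'"
    and "\<not> v \<sim> u" "\<not> v' \<sim> u'" "\<not> w' \<sim> w" "\<not> u' \<sim> w" "\<not> v' \<sim> w" "\<not> w' \<sim> u" "\<not> u' \<sim> u" "\<not> v' \<sim> u"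
    "\<not> w' \<sim> v" "\<not> u' \<sim> v" "\<not> v' \<sim> v"
proof -
  note mem = p[unfolded mem_cherry_pairs]
  show "w \<noteq> u" "w \<noteq> v" "w \<noteq> w'" "w \<noteq> u'" "w \<noteq> v'" "u \<noteq> v" "u \<noteq> w'" "u \<noteq> u'" "u \<noteq> v'"
    "v \<noteq> w'" "v \<noteq> u'" "v \<noteq> v'" "w' \<noteq> u'" "w' \<noteq> v'" "u' \<noteq> v'" using mem by auto
  show "w \<sim> u" "w \<sim> v" "w' \<sim> u'" "w' \<sim> v'" using mem by blast+
  then show "u \<sim> w" "v \<sim> w" "u' \<sim> w'" "v' \<sim> w'" by (auto intro: adj_sym)
  show "\<not> u \<sim> v" "\<not> u' \<sim> v'" "\<not> w \<sim> w'" "\<not> w \<sim> u'" "\<not> w \<sim> v'" "\<not> u \<sim> w'" "\<not> u \<sim> u'" "\<not> u \<sim> v'"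
    "\<not> v \<sim> w'" "\<not> v \<sim> u'" "\<not> v \<sim> v'" using mem by blast+
  then show "\<not> v \<sim> u" "\<not> v' \<sim> u'" "\<not> w' \<sim> w" "\<not> u' \<sim> w" "\<not> v' \<sim> w" "\<not> w' \<sim> u" "\<not> u' \<sim> u" "\<not> v' \<sim> u"
    "\<not> w' \<sim> v" "\<not> u' \<sim> v" "\<not> v' \<sim> v" using adj_sym by blast+
qed

lemma cherries_of_copy:
  assumes p: "((w, u, v), (w', u', v')) \<in> cherry_pairs V"
  shows "cherries {w, u, v, w', u', v'} = {(w, u, v), (w, v, u), (w', u', v'), (w', v', u')}"
proof -
  note facts = cherry_pair_facts[OF p] cherry_pair_facts(1-15)[OF p, symmetric]
  have "t \<in> cherries {w, u, v, w', u', v'} \<longleftrightarrow> t \<in> {(w, u, v), (w, v, u), (w', u', v'), (w', v', u')}" for t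
  proof -
    obtain x y z where t: "t = (x, y, z)" by (cases t)
    have "x \<sim> y \<longleftrightarrow> (x = w \<and> y \<in> {u, v}) \<or> (x = w' \<and> y \<in> {u', v'}) \<or> (x \<in> {u, v} \<and> y = w) \<or> (x \<in> {u', v'} \<and> y = w')"
      if "x \<in> {w, u, v, w', u', v'}" "y \<in> {w, u, v, w', u', v'}" for x y
      using that by (elim insertE emptyE; simp add: facts)
    note adj = this
    show ?thesis
    proof
      assume "t \<in> cherries {w, u, v, w', u', v'}"
      then have xyz: "x \<sim> y" "x \<sim> z" "y \<noteq> z" and
        mem: "x \<in> {w, u, v, w', u', v'}" "y \<in> {w, u, v, w', u', v'}" "z \<in> {w, u, v, w', u', v'}"
        unfolding t mem_cherries by blast+
      have "(x = w \<and> y \<in> {u, v}) \<or> (x = w' \<and> y \<in> {u', v'}) \<or> (x \<in> {u, v} \<and> y = w) \<or> (x \<in> {u', v'} \<and> y = w')"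
        "(x = w \<and> z \<in> {u, v}) \<or> (x = w' \<and> z \<in> {u', v'}) \<or> (x \<in> {u, v} \<and> z = w) \<or> (x \<in> {u', v'} \<and> z = w')"
        by (rule adj[THEN iffD1, OF mem(1,2) xyz(1)], rule adj[THEN iffD1, OF mem(1,3) xyz(2)])
      then show "t \<in> {(w, u, v), (w, v, u), (w', u', v'), (w', v', u')}"
        using xyz(3) unfolding t by (elim disjE conjE insertE emptyE; simp add: facts)
    next
      assume "t \<in> {(w, u, v), (w, v, u), (w', u', v'), (w', v', u')}"
      then show "t \<in> cherries {w, u, v, w', u', v'}"
        by (elim insertE emptyE; simp add: mem_cherries facts)
    qed
  qed
  then show ?thesis by blast
qed

lemma cherry_pairs_swap_leaves: "((w, u, v), \<tau>) \<in> cherry_pairs V \<Longrightarrow> ((w, v, u), \<tau>) \<in> cherry_pairs V"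
  by (cases \<tau>) (auto simp: mem_cherry_pairs adj_commute)

text \<open>Order the two cherries and the leaves of each: the eight automorphisms of \<open>F15\<close>.\<close>

lemma cherry_pairs_with_support:
  assumes p: "((w, u, v), (w', u', v')) \<in> cherry_pairs V"
  shows "{p \<in> cherry_pairs V. support p = {w, u, v, w', u', v'}} =
    {((w, u, v), (w', u', v')), ((w, v, u), (w', u', v')), ((w, u, v), (w', v', u')), ((w, v, u), (w', v', u')),
     ((w', u', v'), (w, u, v)), ((w', u', v'), (w, v, u)), ((w', v', u'), (w, u, v)), ((w', v', u'), (w, v, u))}"
    (is "?L = ?R")
proof
  show "?R \<subseteq> ?L"
    using p cherry_pairs_swap_leaves cherry_pairs_sym
    by (simp add: support_def insert_commute) meson
  show "?L \<subseteq> ?R"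
  proof
    fix p' assume p': "p' \<in> ?L"
    obtain \<tau> \<tau>' where \<tau>: "p' = (\<tau>, \<tau>')" by (cases p')
    have "\<tau> \<in> cherries {w, u, v, w', u', v'}" "\<tau>' \<in> cherries {w, u, v, w', u', v'}"
      using p' unfolding \<tau> by (cases \<tau>; cases \<tau>'; auto simp: support_def mem_cherry_pairs mem_cherries)+
    then show "p' \<in> ?R"
      unfolding cherries_of_copy[OF p] using p p' unfolding \<tau>
      by (elim insertE emptyE; simp add: mem_cherry_pairs)
  qed
qed

lemma card_cherry_pairs:
  assumes fin: "finite V"
  shows "card (cherry_pairs V) = 8 * card (copies V)"
proof -
  have "card (cherry_pairs V) = (\<Sum>U\<in>copies V. card {p \<in> cherry_pairs V. support p = U})"
    using sum.image_gen[of "cherry_pairs V" "\<lambda>_. 1::nat" support] fin by (simp add: copies_def)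
  also have "\<dots> = (\<Sum>U\<in>copies V. 8)"
  proof (rule sum.cong[OF refl])
    fix U assume "U \<in> copies V"
    then obtain w u v w' u' v' where U: "U = {w, u, v, w', u', v'}"
      and p: "((w, u, v), (w', u', v')) \<in> cherry_pairs V" unfolding mem_copies by blast
    show "card {p \<in> cherry_pairs V. support p = U} = 8"
      using p unfolding U cherry_pairs_with_support[OF p] mem_cherry_pairs by (simp add: card_insert_if)
  qed
  finally show ?thesis by simp
qed

lemma copies_card: "U \<in> copies V \<Longrightarrow> U \<subseteq> V \<and> card U = 6"
  by (auto simp: mem_copies mem_cherry_pairs card_insert_if)

end

section \<open>The effect of a bounded number of conflicts\<close>

lemma graph_two_bicliques: "graph (two_bicliques k b)"
  by unfold_locales (auto simp: two_bicliques_def)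

lemma card_supersets_le:
  assumes fin: "finite V" and X: "X \<subseteq> V" "card X \<le> 6"
  shows "card {U. X \<subseteq> U \<and> U \<subseteq> V \<and> card U = 6} \<le> card V ^ (6 - card X)"
proof -
  have finX: "finite X" using X fin finite_subset by blast
  have "inj_on (\<lambda>U. U - X) {U. X \<subseteq> U \<and> U \<subseteq> V \<and> card U = 6}"
    by (rule inj_onI) blast
  moreover have "(\<lambda>U. U - X) ` {U. X \<subseteq> U \<and> U \<subseteq> V \<and> card U = 6} \<subseteq> {Y. Y \<subseteq> V \<and> card Y = 6 - card X}"
    using finX by (auto simp: card_Diff_subset)
  ultimately have "card {U. X \<subseteq> U \<and> U \<subseteq> V \<and> card U = 6} \<le> card {Y. Y \<subseteq> V \<and> card Y = 6 - card X}"
    by (rule card_inj_on_le) (use fin in simp)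
  also have "\<dots> = card V choose (6 - card X)" using n_subsets[OF fin] .
  also have "\<dots> \<le> card V ^ (6 - card X)"
    by (cases "6 - card X \<le> card V") (auto simp: binomial_le_pow binomial_eq_0)
  finally show ?thesis .
qed

lemma card_UN_le_mult:
  assumes "finite I" "\<And>i. i \<in> I \<Longrightarrow> card (F i) \<le> m"
  shows "card (\<Union>i\<in>I. F i) \<le> card I * m"
proof -
  have "card (\<Union>i\<in>I. F i) \<le> (\<Sum>i\<in>I. card (F i))" using assms(1) by (rule card_UN_le)
  also have "\<dots> \<le> (\<Sum>i\<in>I. m)" using assms(2) by (rule sum_mono)
  finally show ?thesis by simp
qed

context graph begin

lemma copy_not_single_conflict:
  assumes U: "U \<in> copies V" and xy: "(x, y) \<in> conflicts U (\<sim>) (two_bicliques k b)"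
  shows "\<exists>x' y'. (x', y') \<in> conflicts U (\<sim>) (two_bicliques k b) \<and> {x', y'} \<noteq> {x, y}"
proof (rule ccontr)
  interpret H: graph "two_bicliques k b" by (rule graph_two_bicliques)
  obtain w u v w' u' v' where p: "((w, u, v), (w', u', v')) \<in> cherry_pairs V"
    and Ueq: "U = {w, u, v, w', u', v'}" using U unfolding mem_copies by blast
  define L where "L = {(w,u),(w,v),(w',u'),(w',v'),(u,v),(u',v'),(w,w'),(w,u'),(w,v'),(u,w'),(u,u'),(u,v'),(v,w'),(v,u'),(v,v')}"
  have dist: "distinct [w, u, v, w', u', v']" using p by (simp add: mem_cherry_pairs)
  assume "\<not> ?thesis"
  then have agree: "p \<sim> q \<longleftrightarrow> two_bicliques k b p q" if "p \<in> U" "q \<in> U" "{p, q} \<noteq> {x, y}" for p q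
    using that by (auto simp: conflicts_def)
  have dis: "x \<in> U" "y \<in> U" "(x \<sim> y) \<noteq> two_bicliques k b x y" using xy by (auto simp: conflicts_def)
  \<comment> \<open>Only one of \<open>(x, y)\<close>, \<open>(y, x)\<close> occurs in the list \<open>L\<close> of the fifteen pairs.\<close>
  have no: False if e: "(x', y') \<in> L" "{x', y'} = {x, y}" for x' y'
  proof -
    have dis': "(x' \<sim> y') \<noteq> two_bicliques k b x' y'"
      using dis(3) e(2) adj_commute H.adj_commute by (auto simp: doubleton_eq_iff)
    have gen: "two_bicliques k b p q \<longleftrightarrow> (p \<sim> q) \<noteq> ((x', y') = (p, q))" if "(p, q) \<in> L" for p q
    proof (cases "(x', y') = (p, q)")
      case False
      have "(q, p) \<notin> L" using \<open>(p, q) \<in> L\<close> dist unfolding L_def by auto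
      then have "{p, q} \<noteq> {x, y}" using False e by (auto simp: doubleton_eq_iff)
      moreover have "p \<in> U" "q \<in> U" using \<open>(p, q) \<in> L\<close> by (auto simp: L_def Ueq)
      ultimately show ?thesis using agree False by auto
    qed (use dis' in auto)
    show False
      by (rule two_bicliques_no_single_conflict[OF dist e(1)[unfolded L_def], of k b])
         (use p in \<open>simp_all only: gen L_def insert_iff simp_thms mem_cherry_pairs\<close>)
  qed
  have "x \<noteq> y" using dis(3) H.adj_irrefl by auto
  then have "(x, y) \<in> L \<or> (y, x) \<in> L"
    using dis(1,2) unfolding Ueq L_def by (elim insertE emptyE; simp)
  then show False using no[of x y] no[of y x] by (auto simp: insert_commute)
qed

lemma copies_cong:
  assumes U: "U \<in> copies V" and H: "graph r" and agree: "conflicts U (\<sim>) r = {}"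
  shows "U \<in> graph.copies r V"
proof -
  interpret H: graph r by (rule H)
  obtain w u v w' u' v' where p: "((w, u, v), (w', u', v')) \<in> cherry_pairs V"
    and Ueq: "U = {w, u, v, w', u', v'}" using U unfolding mem_copies by blast
  have "x \<sim> y \<longleftrightarrow> r x y" if "x \<in> U" "y \<in> U" for x y
    using agree that by (auto simp: conflicts_def)
  then have "((w, u, v), (w', u', v')) \<in> H.cherry_pairs V"
    using p unfolding mem_cherry_pairs H.mem_cherry_pairs Ueq by simp
  then show ?thesis unfolding H.mem_copies Ueq by blast
qed

lemma card_copies_le_conflicts:
  assumes fin: "finite V" and H: "graph r"
  shows "card (copies V) \<le> card (graph.copies r V) + card (conflicts V (\<sim>) r) * card V ^ 4"
proof -
  interpret H: graph r by (rule H)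
  define F where "F = (\<lambda>(x, y). {U. {x, y} \<subseteq> U \<and> U \<subseteq> V \<and> card U = 6})"
  have "copies V \<subseteq> H.copies V \<union> (\<Union>p\<in>conflicts V (\<sim>) r. F p)"
  proof
    fix U assume U: "U \<in> copies V"
    show "U \<in> H.copies V \<union> (\<Union>p\<in>conflicts V (\<sim>) r. F p)"
    proof (cases "conflicts U (\<sim>) r = {}")
      case True
      then show ?thesis using copies_cong[OF U H] by simp
    next
      case False
      then show ?thesis using copies_card[OF U] by (fastforce simp: conflicts_def F_def)
    qed
  qed
  moreover have "finite (\<Union>p\<in>conflicts V (\<sim>) r. F p)"
    by (rule finite_subset[of _ "Pow V"]) (use fin in \<open>auto simp: F_def\<close>)
  ultimately have "card (copies V) \<le> card (H.copies V \<union> (\<Union>p\<in>conflicts V (\<sim>) r. F p))"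
    using fin by (intro card_mono) auto
  also have "\<dots> \<le> card (H.copies V) + card (\<Union>p\<in>conflicts V (\<sim>) r. F p)" by (rule card_Un_le)
  also have "card (\<Union>p\<in>conflicts V (\<sim>) r. F p) \<le> card (conflicts V (\<sim>) r) * card V ^ 4"
  proof (rule card_UN_le_mult)
    fix p assume p: "p \<in> conflicts V (\<sim>) r"
    obtain x y where xy: "p = (x, y)" by (cases p)
    have "x \<noteq> y" "{x, y} \<subseteq> V" using p xy by (auto simp: conflicts_def)
    then show "card (F p) \<le> card V ^ 4"
      using card_supersets_le[OF fin, of "{x, y}"] xy by (simp add: F_def)
  qed (use fin in simp)
  finally show ?thesis by simp
qed

text \<open>A copy without conflicts is also a copy in the two bicliques and does not contain the pair \<open>x, y\<close>; a copy with a
  conflict has two of them, which together cover at least three vertices.\<close>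

lemma card_copies_le_two_bicliques:
  fixes k b :: "'a \<Rightarrow> bool"
  assumes fin: "finite V" and xy: "(x, y) \<in> conflicts V (\<sim>) (two_bicliques k b)"
  defines "C \<equiv> conflicts V (\<sim>) (two_bicliques k b)"
  shows "card (copies V) + card {U \<in> graph.copies (two_bicliques k b) V. x \<in> U \<and> y \<in> U}
     \<le> card (graph.copies (two_bicliques k b) V) + (card C)\<^sup>2 * card V ^ 3"
proof -
  interpret H: graph "two_bicliques k b" by (rule graph_two_bicliques)
  define F where "F = (\<lambda>((x, y), (x', y')). {U. {x, y, x', y'} \<subseteq> U \<and> U \<subseteq> V \<and> card U = 6})"
  define D where "D = {((x, y), (x', y')). (x, y) \<in> C \<and> (x', y') \<in> C \<and> {x', y'} \<noteq> {x, y}}"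
  define N where "N = {U \<in> H.copies V. x \<in> U \<and> y \<in> U}"
  have finC: "finite C" using fin by (simp add: C_def)
  have D: "D \<subseteq> C \<times> C" by (auto simp: D_def)
  then have finD: "finite D" using finC finite_subset by blast
  have "copies V \<subseteq> (H.copies V - N) \<union> (\<Union>p\<in>D. F p)"
  proof
    fix U assume U: "U \<in> copies V"
    note UV = copies_card[OF U]
    show "U \<in> (H.copies V - N) \<union> (\<Union>p\<in>D. F p)"
    proof (cases "conflicts U (\<sim>) (two_bicliques k b) = {}")
      case True
      moreover have "U \<notin> N" using True xy by (auto simp: N_def conflicts_def)
      ultimately show ?thesis using copies_cong[OF U graph_two_bicliques] by simp
    next
      case False
      then obtain p q where pq: "(p, q) \<in> conflicts U (\<sim>) (two_bicliques k b)" by auto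
      obtain p' q' where pq': "(p', q') \<in> conflicts U (\<sim>) (two_bicliques k b)" "{p', q'} \<noteq> {p, q}"
        using copy_not_single_conflict[OF U pq] by blast
      have "((p, q), (p', q')) \<in> D" "U \<in> F ((p, q), (p', q'))"
        using pq pq' UV by (auto simp: D_def C_def F_def conflicts_def)
      then show ?thesis by blast
    qed
  qed
  moreover have "finite (\<Union>p\<in>D. F p)"
    by (rule finite_subset[of _ "Pow V"]) (use fin in \<open>auto simp: F_def\<close>)
  ultimately have "card (copies V) \<le> card ((H.copies V - N) \<union> (\<Union>p\<in>D. F p))"
    using fin by (intro card_mono) auto
  also have "\<dots> \<le> card (H.copies V - N) + card (\<Union>p\<in>D. F p)" by (rule card_Un_le)
  also have "card (\<Union>p\<in>D. F p) \<le> card D * card V ^ 3"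
  proof (rule card_UN_le_mult[OF finD])
    fix p assume p: "p \<in> D"
    obtain x y x' y' where q: "p = ((x, y), (x', y'))" by (metis surj_pair)
    have ne: "x \<noteq> y" "x' \<noteq> y'" "{x', y'} \<noteq> {x, y}" "{x, y, x', y'} \<subseteq> V"
      using p q H.adj_irrefl by (auto simp: conflicts_def D_def C_def)
    then have V: "1 \<le> card V" using fin by (auto simp: Suc_le_eq card_gt_0_iff)
    have "3 \<le> card {x, y, x', y'} \<and> card {x, y, x', y'} \<le> 4"
      using ne(1-3) by (auto simp: card_insert_if)
    then have "card (F p) \<le> card V ^ (6 - card {x, y, x', y'})" "6 - card {x, y, x', y'} \<le> 3"
      using card_supersets_le[OF fin, of "{x, y, x', y'}"] ne(4) q by (auto simp: F_def)
    then show "card (F p) \<le> card V ^ 3"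
      using power_increasing[OF _ V, of "6 - card {x, y, x', y'}" 3] by linarith
  qed
  also have "card D * card V ^ 3 \<le> (card C)\<^sup>2 * card V ^ 3"
    using card_mono[OF _ D] finC by (simp add: card_cartesian_product power2_eq_square)
  finally have "card (copies V) \<le> card (H.copies V - N) + (card C)\<^sup>2 * card V ^ 3" by simp
  moreover have "card (H.copies V - N) + card N = card (H.copies V)"
    using fin by (subst card_Un_disjoint[symmetric]) (auto simp: N_def intro!: arg_cong[of _ _ card])
  ultimately show ?thesis by (simp add: N_def)
qed

end

definition part :: "'a set \<Rightarrow> ('a \<Rightarrow> bool) \<Rightarrow> ('a \<Rightarrow> bool) \<Rightarrow> bool \<Rightarrow> bool \<Rightarrow> 'a set" where
  "part V k b i j = {x \<in> V. k x = i \<and> b x = j}"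

lemma split_set_in_two:
  assumes "finite S" "2 * m \<le> card S"
  shows "\<exists>S1 S2. S1 \<subseteq> S \<and> S2 \<subseteq> S \<and> S1 \<inter> S2 = {} \<and> card S1 = m \<and> card S2 = m"
proof -
  obtain S1 where S1: "S1 \<subseteq> S" "card S1 = m" using assms obtain_subset_with_card_n[of m S] by auto
  then have "m \<le> card (S - S1)" using assms finite_subset[of S1 S] by (simp add: card_Diff_subset)
  then obtain S2 where "S2 \<subseteq> S - S1" "card S2 = m" using obtain_subset_with_card_n by blast
  then show ?thesis using S1 by blast
qed

text \<open>The four added vertices can be read off from the extension because they come from disjoint pools.\<close>

lemma card_extensions:
  assumes fin: "finite ZA" "finite ZB" "finite ZC" "finite ZD"
    and disj: "ZA \<inter> ZB = {}" "ZA \<inter> ZC = {}" "ZA \<inter> ZD = {}" "ZB \<inter> ZC = {}" "ZB \<inter> ZD = {}" "ZC \<inter> ZD = {}"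
      "X \<inter> (ZA \<union> ZB \<union> ZC \<union> ZD) = {}"
    and card: "card ZA = m" "card ZB = m" "card ZC = m" "card ZD = m"
    and F: "\<And>z1 z2 z3 z4. z1 \<in> ZA \<Longrightarrow> z2 \<in> ZB \<Longrightarrow> z3 \<in> ZC \<Longrightarrow> z4 \<in> ZD \<Longrightarrow> X \<union> {z1, z2, z3, z4} \<in> F"
    and finF: "finite F"
  shows "m ^ 4 \<le> card F"
proof -
  define f where "f = (\<lambda>(z1, z2, z3, z4). X \<union> {z1, z2, z3, z4})"
  have "inj_on f (ZA \<times> ZB \<times> ZC \<times> ZD)"
  proof (rule inj_onI)
    fix p q assume p: "p \<in> ZA \<times> ZB \<times> ZC \<times> ZD" and q: "q \<in> ZA \<times> ZB \<times> ZC \<times> ZD" and eq: "f p = f q"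
    obtain z1 z2 z3 z4 where z: "p = (z1, z2, z3, z4)" by (metis surj_pair)
    obtain y1 y2 y3 y4 where y: "q = (y1, y2, y3, y4)" by (metis surj_pair)
    have zs: "f p \<inter> ZA = {z1}" "f p \<inter> ZB = {z2}" "f p \<inter> ZC = {z3}" "f p \<inter> ZD = {z4}"
      using p disj unfolding z f_def by auto
    have ys: "f q \<inter> ZA = {y1}" "f q \<inter> ZB = {y2}" "f q \<inter> ZC = {y3}" "f q \<inter> ZD = {y4}"
      using q disj unfolding y f_def by auto
    show "p = q" using zs ys eq unfolding z y by auto
  qed
  then have "card (f ` (ZA \<times> ZB \<times> ZC \<times> ZD)) = m ^ 4"
    using card by (simp add: card_image card_cartesian_product power_numeral_reduce)
  moreover have "f ` (ZA \<times> ZB \<times> ZC \<times> ZD) \<subseteq> F" using F by (auto simp: f_def)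
  ultimately show ?thesis using card_mono[OF finF] by metis
qed

text \<open>Whatever the relative position of \<open>x\<close> and \<open>y\<close>, there is a copy of \<open>F15\<close> through both, and the other four
  vertices of it vary freely within their classes. Two disjoint pools per class serve a class that is used twice.\<close>

lemma two_bicliques_copies_through:
  fixes k b :: "'a \<Rightarrow> bool"
  assumes fin: "finite V" and xy: "x \<in> V" "y \<in> V" "x \<noteq> y"
    and large: "\<And>i j. 2 * m + 2 \<le> card (part V k b i j)"
  shows "m ^ 4 \<le> card {U \<in> graph.copies (two_bicliques k b) V. x \<in> U \<and> y \<in> U}"
proof -
  interpret H: graph "two_bicliques k b" by (rule graph_two_bicliques)
  have "\<exists>S1 S2. S1 \<subseteq> part V k b i j - {x, y} \<and> S2 \<subseteq> part V k b i j - {x, y} \<and> S1 \<inter> S2 = {} \<and> card S1 = m \<and> card S2 = m"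
    for i j
  proof (rule split_set_in_two)
    show fin': "finite (part V k b i j - {x, y})" using fin by (simp add: part_def)
    have "card (part V k b i j) - card {x, y} \<le> card (part V k b i j - {x, y})"
      by (rule diff_card_le_card_Diff) simp
    then show "2 * m \<le> card (part V k b i j - {x, y})" using large[of i j] xy by simp
  qed
  then obtain S1 S2 where S: "S1 i j \<subseteq> part V k b i j - {x, y}" "S2 i j \<subseteq> part V k b i j - {x, y}"
    "S1 i j \<inter> S2 i j = {}" "card (S1 i j) = m" "card (S2 i j) = m" for i j by metis
  have S1: "z \<in> V" "k z = i" "b z = j" "z \<noteq> x" "z \<noteq> y" if "z \<in> S1 i j" for z i j
    using that S(1)[of i j] by (auto simp: part_def)
  have S2: "z \<in> V" "k z = i" "b z = j" "z \<noteq> x" "z \<noteq> y" if "z \<in> S2 i j" for z i j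
    using that S(2)[of i j] by (auto simp: part_def)
  have fS: "finite (S1 i j)" "finite (S2 i j)" for i j
    by (rule finite_subset[OF _ fin]; use S1 S2 in blast)+
  have sub: "S1 i j \<subseteq> {z. k z = i \<and> b z = j}" "S2 i j \<subseteq> {z. k z = i \<and> b z = j}" for i j
    using S(1,2)[of i j] by (auto simp: part_def)
  have disj: "S1 i j \<inter> S1 i' j' = {}" "S2 i j \<inter> S2 i' j' = {}" if "(i, j) \<noteq> (i', j')" for i j i' j'
    using sub[of i j] sub[of i' j'] that by auto
  have disj12: "S1 i j \<inter> S2 i' j' = {}" "S2 i' j' \<inter> S1 i j = {}" for i j i' j'
    using sub(1)[of i j] sub(2)[of i' j'] S(3)[of i j] by (cases "(i, j) = (i', j')"; auto)+
  have notin: "x \<notin> S1 i j" "y \<notin> S1 i j" "x \<notin> S2 i j" "y \<notin> S2 i j" for i j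
    using S(1,2)[of i j] by auto
  define F where "F = {U \<in> H.copies V. x \<in> U \<and> y \<in> U}"
  have finF: "finite F" using fin by (simp add: F_def)
  have copy: "{w, u, v, w', u', v'} \<in> F" if "((w, u, v), (w', u', v')) \<in> H.cherry_pairs V"
    "x \<in> {w, u, v, w', u', v'}" "y \<in> {w, u, v, w', u', v'}" for w u v w' u' v'
    using that unfolding F_def H.mem_copies by blast
  consider (opposite) "k y = k x" "b y = (\<not> b x)" | (same) "k y = k x" "b y = b x" | (apart) "k y = (\<not> k x)" by blast
  then have "m ^ 4 \<le> card F"
  proof cases
    case opposite
    show ?thesis
    proof (rule card_extensions[where X = "{x, y}" and ZA = "S1 (k x) (b x)" and ZB = "S1 (\<not> k x) True"
          and ZC = "S1 (\<not> k x) False" and ZD = "S2 (\<not> k x) False"])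
      fix z1 z2 z3 z4
      assume z: "z1 \<in> S1 (k x) (b x)" "z2 \<in> S1 (\<not> k x) True" "z3 \<in> S1 (\<not> k x) False" "z4 \<in> S2 (\<not> k x) False"
      have "z3 \<noteq> z4" using z S(3) by blast
      then have "((y, x, z1), (z2, z3, z4)) \<in> H.cherry_pairs V"
        using opposite xy S1[OF z(1)] S1[OF z(2)] S1[OF z(3)] S2[OF z(4)]
        unfolding H.mem_cherry_pairs two_bicliques_def by auto
      from copy[OF this] show "{x, y} \<union> {z1, z2, z3, z4} \<in> F" by (simp add: insert_commute)
    qed (simp_all add: fS S(4,5) finF disj disj12 notin)
  next
    case same
    show ?thesis
    proof (rule card_extensions[where X = "{x, y}" and ZA = "S1 (k x) (\<not> b x)" and ZB = "S1 (\<not> k x) True"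
          and ZC = "S1 (\<not> k x) False" and ZD = "S2 (\<not> k x) False"])
      fix z1 z2 z3 z4
      assume z: "z1 \<in> S1 (k x) (\<not> b x)" "z2 \<in> S1 (\<not> k x) True" "z3 \<in> S1 (\<not> k x) False" "z4 \<in> S2 (\<not> k x) False"
      have "z3 \<noteq> z4" using z S(3) by blast
      then have "((z1, x, y), (z2, z3, z4)) \<in> H.cherry_pairs V"
        using same xy S1[OF z(1)] S1[OF z(2)] S1[OF z(3)] S2[OF z(4)]
        unfolding H.mem_cherry_pairs two_bicliques_def by auto
      from copy[OF this] show "{x, y} \<union> {z1, z2, z3, z4} \<in> F" by (simp add: insert_commute)
    qed (simp_all add: fS S(4,5) finF disj disj12 notin)
  next
    case apart
    show ?thesis
    proof (rule card_extensions[where X = "{x, y}" and ZA = "S1 (k x) (\<not> b x)" and ZB = "S2 (k x) (\<not> b x)"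
          and ZC = "S1 (k y) (\<not> b y)" and ZD = "S2 (k y) (\<not> b y)"])
      fix z1 z2 z3 z4
      assume z: "z1 \<in> S1 (k x) (\<not> b x)" "z2 \<in> S2 (k x) (\<not> b x)" "z3 \<in> S1 (k y) (\<not> b y)" "z4 \<in> S2 (k y) (\<not> b y)"
      have "z3 \<noteq> z4" "z1 \<noteq> z2" using z S(3) by blast+
      then have "((x, z1, z2), (y, z3, z4)) \<in> H.cherry_pairs V"
        using apart xy S1[OF z(1)] S2[OF z(2)] S1[OF z(3)] S2[OF z(4)]
        unfolding H.mem_cherry_pairs two_bicliques_def by auto
      from copy[OF this] show "{x, y} \<union> {z1, z2, z3, z4} \<in> F" by (simp add: insert_commute)
    qed (simp_all add: fS S(4,5) finF disj disj12 notin apart)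
  qed
  then show ?thesis by (simp add: F_def)
qed

section \<open>Separated pairs in two bicliques\<close>

definition psize :: "'a set \<Rightarrow> ('a \<Rightarrow> bool) \<Rightarrow> ('a \<Rightarrow> bool) \<Rightarrow> bool \<Rightarrow> bool \<Rightarrow> real" where
  "psize V k b i j = real (card (part V k b i j))"

text \<open>The number of ordered cherries of the complete bipartite graph with classes of size \<open>p\<close> and \<open>q\<close>.\<close>

definition biclique_cherries :: "real \<Rightarrow> real \<Rightarrow> real" where
  "biclique_cherries p q = p * q * (p + q - 2)"

lemma sum_by_part:
  fixes g :: "bool \<Rightarrow> bool \<Rightarrow> real"
  assumes "finite A"
  shows "(\<Sum>x\<in>A. g (k x) (b x)) = psize A k b True True * g True True + psize A k b True False * g True False
    + psize A k b False True * g False True + psize A k b False False * g False False"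
proof -
  have "(\<Sum>x\<in>A. g (k x) (b x)) = (\<Sum>c\<in>UNIV. \<Sum>x\<in>{x\<in>A. (k x, b x) = c}. g (k x) (b x))"
    by (rule sum.group[symmetric]) (use assms in auto)
  also have "\<dots> = (\<Sum>c\<in>UNIV. psize A k b (fst c) (snd c) * g (fst c) (snd c))"
    by (intro sum.cong refl) (auto simp: psize_def part_def)
  also have "UNIV = {(True, True), (True, False), (False, True), (False, False)}" by auto
  finally show ?thesis by simp
qed

lemma sum_psize:
  assumes "finite A"
  shows "psize A k b True True + psize A k b True False + psize A k b False True + psize A k b False False = real (card A)"
  using sum_by_part[OF assms, of "\<lambda>_ _. 1" k b] by simp

lemma psize_nonneg [simp]: "0 \<le> psize A k b i j"
  by (simp add: psize_def)

lemma psize_le: "finite A \<Longrightarrow> psize A k b i j \<le> real (card A)"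
  by (auto simp: psize_def part_def intro!: card_mono)

context
  fixes k b :: "'a \<Rightarrow> bool"
begin

interpretation H: graph "two_bicliques k b" by (rule graph_two_bicliques)

lemma nbh_two_bicliques: "graph.nbh (two_bicliques k b) A x = part A k b (k x) (\<not> b x)"
  by (auto simp: H.nbh_def part_def two_bicliques_def)

lemma sum_cherries_two_bicliques:
  assumes fin: "finite A"
  shows "(\<Sum>(w, u, v)\<in>graph.cherries (two_bicliques k b) A. g (k w))
    = g True * biclique_cherries (psize A k b True True) (psize A k b True False)
      + g False * biclique_cherries (psize A k b False True) (psize A k b False False)"
proof -
  define \<delta> where "\<delta> i j = psize A k b i (\<not> j)" for i j
  have "(\<Sum>(w, u, v)\<in>H.cherries A. g (k w))
      = (\<Sum>w\<in>A. \<Sum>u\<in>H.nbh A w. real (card (H.nbh A w - H.nbh A u - {u})) * g (k w))"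
    using fin by (simp add: H.sum_cherries)
  also have "\<dots> = (\<Sum>w\<in>A. \<Sum>u\<in>H.nbh A w. (\<delta> (k w) (b w) - 1) * g (k w))"
  proof (intro sum.cong refl)
    fix w u assume w: "w \<in> A" and u: "u \<in> H.nbh A w"
    have "H.nbh A w \<inter> H.nbh A u = {}" using u by (auto simp: H.nbh_def two_bicliques_def)
    then show "real (card (H.nbh A w - H.nbh A u - {u})) * g (k w) = (\<delta> (k w) (b w) - 1) * g (k w)"
      using H.card_leaves[OF fin u] by (simp add: H.common_def \<delta>_def nbh_two_bicliques psize_def)
  qed
  also have "\<dots> = (\<Sum>w\<in>A. \<delta> (k w) (b w) * ((\<delta> (k w) (b w) - 1) * g (k w)))"
    by (simp add: nbh_two_bicliques \<delta>_def psize_def)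
  also have "\<dots> = g True * biclique_cherries (psize A k b True True) (psize A k b True False)
      + g False * biclique_cherries (psize A k b False True) (psize A k b False False)"
    by (subst sum_by_part[OF fin, of "\<lambda>i j. \<delta> i j * ((\<delta> i j - 1) * g i)"])
       (simp add: \<delta>_def biclique_cherries_def algebra_simps)
  finally show ?thesis .
qed

lemma card_cherry_pairs_two_bicliques:
  assumes fin: "finite V"
  shows "real (card (graph.cherry_pairs (two_bicliques k b) V)) =
    2 * biclique_cherries (psize V k b True True) (psize V k b True False)
      * biclique_cherries (psize V k b False True) (psize V k b False False)"
proof -
  define q where "q i = biclique_cherries (psize V k b i True) (psize V k b i False)" for i
  have "real (card (H.cherry_pairs V)) = (\<Sum>\<tau>\<in>H.cherries V. real (card (H.cherries (H.away V \<tau>))))"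
    using H.sum_cherry_pairs[OF fin, of "\<lambda>_. 1::real"] by simp
  also have "\<dots> = (\<Sum>(w, u, v)\<in>H.cherries V. q (\<not> k w))"
  proof (rule sum.cong[OF refl], clarify)
    fix w u v assume \<tau>: "(w, u, v) \<in> H.cherries V"
    define A where "A = H.away V (w, u, v)"
    have A: "A = {y \<in> V. k y \<noteq> k w}"
      using \<tau> by (auto simp: A_def H.away_def H.reach_def H.nbh_def H.mem_cherries two_bicliques_def)
    have ps: "psize A k b i j = (if i = k w then 0 else psize V k b i j)" for i j
    proof -
      have "part A k b i j = (if i = k w then {} else part V k b i j)"
        by (auto simp: A part_def)
      then show ?thesis by (simp add: psize_def)
    qed
    have finA: "finite A" using fin by (simp add: A)
    have "real (card (H.cherries A)) = biclique_cherries (psize A k b True True) (psize A k b True False)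
        + biclique_cherries (psize A k b False True) (psize A k b False False)"
      using sum_cherries_two_bicliques[OF finA, of "\<lambda>_. 1"] by (simp add: split_def)
    also have "\<dots> = q (\<not> k w)"
      by (cases "k w") (simp_all add: ps q_def biclique_cherries_def)
    finally show "real (card (H.cherries (H.away V (w, u, v)))) = q (\<not> k w)" by (simp add: A_def)
  qed
  also have "\<dots> = 2 * q True * q False"
    using sum_cherries_two_bicliques[OF fin, of "\<lambda>i. q (\<not> i)"] by (simp add: q_def)
  finally show ?thesis by (simp add: q_def)
qed

end

text \<open>For four classes of total size \<open>n\<close> the terms of first order in the deviations from \<open>n / 4\<close> cancel, so rounding
  costs only \<open>O(n\<^sup>4)\<close>, the number of copies that a single wrong pair affects.\<close>

lemma balanced_bicliques:
  fixes x0 x1 x2 x3 n :: real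
  assumes n: "16 \<le> n" and sum: "x0 + x1 + x2 + x3 = n"
    and near: "\<bar>x0 - n / 4\<bar> \<le> 1" "\<bar>x1 - n / 4\<bar> \<le> 1" "\<bar>x2 - n / 4\<bar> \<le> 1" "\<bar>x3 - n / 4\<bar> \<le> 1"
  shows "pair_bound n - n^4 \<le> 2 * biclique_cherries x0 x1 * biclique_cherries x2 x3"
proof -
  define h where "h = n / 2"
  define t where "t = x0 + x1 - h"
  have h: "8 \<le> h" using n by (simp add: h_def)
  have s: "x0 + x1 = h + t" "x2 + x3 = h - t" using sum by (auto simp: t_def h_def)
  have "t\<^sup>2 \<le> 2\<^sup>2" by (rule abs_le_square_iff[THEN iffD1]) (use near sum in \<open>auto simp: t_def h_def\<close>)
  then have t: "t\<^sup>2 \<le> 4" by simp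
  have "(x0 - x1)\<^sup>2 \<le> 2\<^sup>2" by (rule abs_le_square_iff[THEN iffD1]) (use near in auto)
  then have a: "(h + t)\<^sup>2 / 4 - 1 \<le> x0 * x1"
    unfolding s(1)[symmetric] by (simp add: power2_eq_square algebra_simps)
  have "(x2 - x3)\<^sup>2 \<le> 2\<^sup>2" by (rule abs_le_square_iff[THEN iffD1]) (use near in auto)
  then have b: "(h - t)\<^sup>2 / 4 - 1 \<le> x2 * x3"
    unfolding s(2)[symmetric] by (simp add: power2_eq_square algebra_simps)
  have "h - 2 \<le> h + t" "h - 2 \<le> h - t" using near sum by (auto simp: t_def h_def)
  then have "(h - 2)\<^sup>2 \<le> (h + t)\<^sup>2" "(h - 2)\<^sup>2 \<le> (h - t)\<^sup>2"
    using h by (auto intro!: power_mono)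
  moreover have "6\<^sup>2 \<le> (h - 2)\<^sup>2" using h by (intro power_mono) auto
  ultimately have nn: "0 \<le> (h + t)\<^sup>2 / 4 - 1" "0 \<le> (h - t)\<^sup>2 / 4 - 1" by auto
  have hh: "16 \<le> h\<^sup>2" using power_mono[of 8 h 2] h by simp
  have X: "(h^4 - 16 * h\<^sup>2) / 16 \<le> (x0 * x1) * (x2 * x3)"
  proof -
    have "(h\<^sup>2 - 4)\<^sup>2 \<le> (h\<^sup>2 - t\<^sup>2)\<^sup>2" using t hh by (intro power_mono) auto
    moreover have "(h\<^sup>2 - 4)\<^sup>2 = h^4 - 8 * h\<^sup>2 + 16"
      by (simp add: power2_eq_square power4_eq_xxxx algebra_simps)
    ultimately have "(h^4 - 16 * h\<^sup>2) / 16 \<le> ((h\<^sup>2 - t\<^sup>2)\<^sup>2 - 8 * h\<^sup>2 - 8 * t\<^sup>2 + 16) / 16"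
      using t by (intro divide_right_mono) auto
    also have "\<dots> = ((h + t)\<^sup>2 / 4 - 1) * ((h - t)\<^sup>2 / 4 - 1)"
      by (simp add: power2_eq_square field_simps)
    also have "\<dots> \<le> (x0 * x1) * (x2 * x3)" using a b nn by (intro mult_mono) auto
    finally show ?thesis .
  qed
  have Y: "(h - 2)\<^sup>2 - 4 \<le> (x0 + x1 - 2) * (x2 + x3 - 2)"
    using t unfolding s by (simp add: power2_eq_square algebra_simps)
  have Xnn: "0 \<le> (h^4 - 16 * h\<^sup>2) / 16"
    using mult_right_mono[OF hh, of "h\<^sup>2"] by (simp add: power2_eq_square power4_eq_xxxx)
  have Ynn: "0 \<le> (h - 2)\<^sup>2 - 4" using power_mono[of 6 "h - 2" 2] h by simp
  have "pair_bound n - n^4 \<le> 2 * ((h^4 - 16 * h\<^sup>2) / 16 * ((h - 2)\<^sup>2 - 4))"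
  proof -
    have "h\<^sup>2 * ((h - 2)\<^sup>2 - 4) \<le> h\<^sup>2 * h\<^sup>2"
      using h by (intro mult_left_mono) (auto simp: power2_eq_square algebra_simps)
    moreover have "2 * ((h^4 - 16 * h\<^sup>2) / 16 * ((h - 2)\<^sup>2 - 4))
        = h^4 * (h - 2)\<^sup>2 / 8 - h^4 / 2 - 2 * (h\<^sup>2 * ((h - 2)\<^sup>2 - 4))"
      by (simp add: field_simps)
    moreover have "h\<^sup>2 * h\<^sup>2 = h^4" by (simp add: power4_eq_xxxx power2_eq_square)
    moreover have "n^4 = 16 * h^4" by (simp add: h_def power_divide)
    moreover have "0 \<le> h^4" by simp
    moreover have "pair_bound n = h^4 * (h - 2)\<^sup>2 / 8" by (simp add: pair_bound_def h_def)
    ultimately show ?thesis by linarith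
  qed
  also have "\<dots> \<le> 2 * (((x0 * x1) * (x2 * x3)) * ((x0 + x1 - 2) * (x2 + x3 - 2)))"
  proof -
    have "0 \<le> (x0 * x1) * (x2 * x3)" using X Xnn by linarith
    then show ?thesis using X Y Ynn by (intro mult_left_mono mult_mono) auto
  qed
  finally show ?thesis unfolding biclique_cherries_def by (simp only: mult_ac)
qed

text \<open>Every copy uses all four classes, so a graph with many copies has no small class.\<close>

lemma card_cherry_pairs_le_psize:
  fixes k b :: "'a \<Rightarrow> bool"
  assumes fin: "finite V" and n2: "2 \<le> card V"
  shows "real (card (graph.cherry_pairs (two_bicliques k b) V)) \<le> 2 * psize V k b i j * real (card V) ^ 5"
proof -
  define n where "n = real (card V)"
  define p where "p = psize V k b"
  define q where "q i = biclique_cherries (p i True) (p i False)" for i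
  have n: "2 \<le> n" using n2 by (simp add: n_def)
  have p: "0 \<le> p i j" "p i j \<le> n" for i j using psize_le[OF fin] by (auto simp: p_def n_def)
  have s: "p True True + p True False + p False True + p False False = n"
    using sum_psize[OF fin] by (simp add: p_def n_def)
  have q: "\<bar>q i\<bar> \<le> p i j * n\<^sup>2" for i j
  proof -
    have "\<bar>p i True + p i False - 2\<bar> \<le> n"
      using s p[of True] p[of False] n by (cases i) (smt (verit))+
    then have "\<bar>p i j * (p i (\<not> j) * (p i True + p i False - 2))\<bar> \<le> p i j * (n * n)"
      using p unfolding abs_mult by (intro mult_mono) auto
    then show ?thesis by (cases j) (simp_all add: q_def biclique_cherries_def power2_eq_square mult_ac)
  qed
  have "\<bar>q i * q (\<not> i)\<bar> \<le> (p i j * n\<^sup>2) * (n * n\<^sup>2)"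
  proof -
    have "\<bar>q (\<not> i)\<bar> \<le> n * n\<^sup>2"
      using q[of "\<not> i" True] mult_right_mono[OF p(2)[of "\<not> i" True], of "n\<^sup>2"] by simp
    then show ?thesis using q[of i j] p unfolding abs_mult by (intro mult_mono) auto
  qed
  then have "q True * q False \<le> p i j * n^5"
    by (cases i) (simp_all add: power_numeral_reduce mult_ac)
  then show ?thesis
    using card_cherry_pairs_two_bicliques[OF fin, of k b] by (simp add: q_def p_def n_def)
qed

section \<open>Densities, blowups and edit distance\<close>

definition pgraph_adj :: "'a pgraph \<Rightarrow> 'a \<Rightarrow> 'a \<Rightarrow> bool" where
  "pgraph_adj G x y \<longleftrightarrow> {x, y} \<in> edges G"

lemma graph_pgraph_adj: "simple_graph G \<Longrightarrow> graph (pgraph_adj G)"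
  by unfold_locales (auto simp: pgraph_adj_def simple_graph_def insert_commute)

lemma isomorphic_F15_iff:
  assumes G: "simple_graph G" and S: "S \<subseteq> verts G" "card S = 6"
  shows "isomorphic (induced G S) F15 \<longleftrightarrow> S \<in> graph.copies (pgraph_adj G) (verts G)"
proof -
  interpret graph "pgraph_adj G" by (rule graph_pgraph_adj[OF G])
  have ind: "{x, y} \<in> edges (induced G S) \<longleftrightarrow> pgraph_adj G x y" if "x \<in> S" "y \<in> S" for x y
    using that by (simp add: induced_def pgraph_adj_def)
  show ?thesis
  proof
    assume "isomorphic (induced G S) F15"
    then obtain f where f: "bij_betw f S {0..<6}"
      and e: "\<forall>x\<in>S. \<forall>y\<in>S. pgraph_adj G x y \<longleftrightarrow> {f x, f y} \<in> edges F15"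
      by (auto simp: isomorphic_def isomorphism_def F15_def induced_def pgraph_adj_def)
    define g where "g = inv_into S f"
    have g: "bij_betw g {0..<6} S" unfolding g_def by (rule bij_betw_inv_into[OF f])
    have fg: "f (g i) = i" "g i \<in> S" if "i < 6" for i
      using that f g by (auto simp: g_def bij_betw_inv_into_right bij_betw_apply)
    have adj: "pgraph_adj G (g i) (g j) \<longleftrightarrow> {i, j} \<in> edges F15" if "i < 6" "j < 6" for i j
      using e fg that by simp
    have ne: "g i \<noteq> g j" if "i < 6" "j < 6" "i \<noteq> j" for i j
      using fg that by metis
    have img: "S = {g 0, g 3, g 4, g 1, g 2, g 5}"
      using bij_betw_imp_surj_on[OF g] by (simp add: atLeast0_lessThan_Suc numeral_eq_Suc lessThan_Suc atLeast0LessThan insert_commute)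
    have "((g 0, g 3, g 4), (g 1, g 2, g 5)) \<in> cherry_pairs (verts G)"
      unfolding mem_cherry_pairs using S fg by (auto simp: adj ne F15_def doubleton_eq_iff)
    then show "S \<in> copies (verts G)" unfolding mem_copies img by blast
  next
    assume "S \<in> copies (verts G)"
    then obtain w u v w' u' v' where p: "((w, u, v), (w', u', v')) \<in> cherry_pairs (verts G)"
      and Seq: "S = {w, u, v, w', u', v'}" unfolding mem_copies by blast
    note facts = cherry_pair_facts[OF p] cherry_pair_facts(1-15)[OF p, symmetric]
    define f :: "'a \<Rightarrow> nat" where
      "f x = (if x = w then 0 else if x = u then 3 else if x = v then 4 else if x = w' then 1 else if x = u' then 2 else 5)" for x
    have fs: "f w = 0" "f u = 3" "f v = 4" "f w' = 1" "f u' = 2" "f v' = 5"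
      by (simp_all add: f_def facts)
    have inj: "inj_on f S" unfolding Seq by (simp add: fs facts)
    have img: "f ` S = {0..<6}" unfolding Seq by (simp add: fs) auto
    have "pgraph_adj G x y \<longleftrightarrow> {f x, f y} \<in> edges F15" if "x \<in> S" "y \<in> S" for x y
      using that unfolding Seq by (elim insertE emptyE; simp add: fs facts F15_def doubleton_eq_iff)
    then have "isomorphism f (induced G S) F15"
      unfolding isomorphism_def using inj img by (auto simp: bij_betw_def ind F15_def induced_def pgraph_adj_def)
    then show "isomorphic (induced G S) F15" unfolding isomorphic_def by blast
  qed
qed

lemma ind_density_F15:
  assumes G: "simple_graph G"
  shows "ind_density F15 G = real (card (graph.copies (pgraph_adj G) (verts G))) / real (card (verts G) choose 6)"
proof -
  interpret graph "pgraph_adj G" by (rule graph_pgraph_adj[OF G])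
  have "{S. S \<subseteq> verts G \<and> card S = card (verts F15) \<and> isomorphic (induced G S) F15} = copies (verts G)"
    using isomorphic_F15_iff[OF G] copies_card by (auto simp: F15_def)
  then show ?thesis by (simp add: ind_density_def F15_def)
qed

definition biclique_pgraph :: "'a set \<Rightarrow> ('a \<Rightarrow> bool) \<Rightarrow> ('a \<Rightarrow> bool) \<Rightarrow> 'a pgraph" where
  "biclique_pgraph V k b = (V, {{x, y} | x y. x \<in> V \<and> y \<in> V \<and> two_bicliques k b x y})"

lemma simple_biclique_pgraph: "finite V \<Longrightarrow> simple_graph (biclique_pgraph V k b)"
  by (auto simp: simple_graph_def pattern_def biclique_pgraph_def two_bicliques_def doubleton_eq_iff)

lemma pgraph_adj_biclique_pgraph:
  "x \<in> V \<Longrightarrow> y \<in> V \<Longrightarrow> pgraph_adj (biclique_pgraph V k b) x y \<longleftrightarrow> two_bicliques k b x y"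
  by (auto simp: pgraph_adj_def biclique_pgraph_def doubleton_eq_iff two_bicliques_def)

lemma copies_biclique_pgraph:
  assumes "finite V"
  shows "graph.copies (pgraph_adj (biclique_pgraph V k b)) V = graph.copies (two_bicliques k b) V"
proof -
  let ?r = "pgraph_adj (biclique_pgraph V k b)" and ?s = "two_bicliques k b"
  have r: "graph ?r" by (rule graph_pgraph_adj[OF simple_biclique_pgraph[OF assms]])
  have s: "graph ?s" by (rule graph_two_bicliques)
  have none: "conflicts U ?r ?s = {}" "conflicts U ?s ?r = {}" if "U \<subseteq> V" for U
    using that by (auto simp: conflicts_def pgraph_adj_biclique_pgraph[OF subsetD[OF that] subsetD[OF that]])
  show ?thesis
  proof (intro set_eqI iffI)
    fix U assume U: "U \<in> graph.copies ?r V"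
    then have "U \<subseteq> V" using graph.copies_card[OF r] by blast
    then show "U \<in> graph.copies ?s V" by (intro graph.copies_cong[OF r U s] none)
  next
    fix U assume U: "U \<in> graph.copies ?s V"
    then have "U \<subseteq> V" using graph.copies_card[OF s] by blast
    then show "U \<in> graph.copies ?r V" by (intro graph.copies_cong[OF s U r] none)
  qed
qed

text \<open>Part \<open>i\<close> of the blowup has component \<open>odd i\<close> and side \<open>2 \<le> i\<close>: the edges \<open>02\<close> and \<open>13\<close> of the pattern join parts that
  agree in the first and differ in the second.\<close>

lemma blowup_B15_eq:
  assumes W: "W = (\<Union>i\<in>{0..<4}. P i)"
    and P: "\<And>x i. i < 4 \<Longrightarrow> x \<in> P i \<longleftrightarrow> x \<in> W \<and> k x = odd i \<and> b x = (2 \<le> i)"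
  shows "blowup B15 P = biclique_pgraph W k b"
proof -
  have lt4: "{0..<4} = {0, 1, 2, 3::nat}" by auto
  have E: "{i, j} \<in> {{0, 2}, {1, 3::nat}} \<longleftrightarrow> odd i = odd j \<and> (2 \<le> i) \<noteq> (2 \<le> j)"
    if "i \<in> {0..<4}" "j \<in> {0..<4}" for i j :: nat
    using that unfolding lt4 by (elim insertE emptyE; simp add: doubleton_eq_iff)
  have "{{x, y} | x y i j. i \<in> {0..<4} \<and> j \<in> {0..<4} \<and> x \<in> P i \<and> y \<in> P j \<and> x \<noteq> y
        \<and> {i, j} \<in> {{0, 2}, {1, 3}}} = {{x, y} | x y. x \<in> W \<and> y \<in> W \<and> two_bicliques k b x y}" (is "?L = ?R")
  proof (intro set_eqI iffI)
    fix e assume "e \<in> ?L"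
    then obtain x y i j where e: "e = {x, y}" "i \<in> {0..<4}" "j \<in> {0..<4}" "x \<in> P i" "y \<in> P j"
      "{i, j} \<in> {{0, 2}, {1, 3}}" by blast
    then have "x \<in> W \<and> y \<in> W \<and> two_bicliques k b x y"
      using P[of i x] P[of j y] E[of i j] by (simp add: two_bicliques_def)
    then show "e \<in> ?R" using e(1) by blast
  next
    fix e assume "e \<in> ?R"
    then obtain x y where e: "e = {x, y}" "x \<in> W" "y \<in> W" "two_bicliques k b x y" by blast
    obtain i j where ij: "i \<in> {0..<4}" "j \<in> {0..<4}" "x \<in> P i" "y \<in> P j" using e W by blast
    have "{i, j} \<in> {{0, 2}, {1, 3}}"
      using P[of i x] P[of j y] E[OF ij(1,2)] e ij by (simp add: two_bicliques_def)
    moreover have "x \<noteq> y" using e by (auto simp: two_bicliques_def)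
    ultimately show "e \<in> ?L" using e ij by blast
  qed
  then show ?thesis unfolding blowup_def biclique_pgraph_def B15_def W by simp
qed

lemma biclique_pgraph_is_blowup:
  assumes fin: "finite V"
  shows "biclique_pgraph V k b \<in> blowups B15"
proof -
  define P where "P i = part V k b (odd i) (2 \<le> i)" for i :: nat
  have lt4: "{0..<4} = {0, 1, 2, 3::nat}" by auto
  have "x \<in> (\<Union>i\<in>{0..<4}. P i)" if "x \<in> V" for x
    using that by (cases "k x"; cases "b x") (auto simp: lt4 P_def part_def)
  then have "V = (\<Union>i\<in>{0..<4}. P i)" by (auto simp: P_def part_def)
  then have "blowup B15 P = biclique_pgraph V k b"
    by (rule blowup_B15_eq) (auto simp: P_def part_def)
  moreover have "blowup_parts B15 P"
    unfolding blowup_parts_def disjoint_family_on_def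
    using fin by (auto simp: B15_def lt4 P_def part_def)
  ultimately show ?thesis unfolding blowups_def by (metis (mono_tags, lifting) mem_Collect_eq)
qed

lemma blowup_B15_parts:
  assumes V: "blowup_parts B15 V"
  obtains W k b where "blowup B15 V = biclique_pgraph W k b" "finite W"
    "psize W k b False False = real (card (V 0))" "psize W k b True False = real (card (V 1))"
    "psize W k b False True = real (card (V 2))" "psize W k b True True = real (card (V 3))"
proof -
  define W where "W = (\<Union>i\<in>{0..<4}. V i)"
  define k where "k x \<longleftrightarrow> x \<in> V 1 \<or> x \<in> V 3" for x
  define b where "b x \<longleftrightarrow> x \<in> V 2 \<or> x \<in> V 3" for x
  have lt4: "{0..<4} = {0, 1, 2, 3::nat}" by auto
  have disj: "V 0 \<inter> V 1 = {}" "V 0 \<inter> V 2 = {}" "V 0 \<inter> V 3 = {}" "V 1 \<inter> V 2 = {}" "V 1 \<inter> V 3 = {}" "V 2 \<inter> V 3 = {}"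
    using V by (auto simp: blowup_parts_def disjoint_family_on_def B15_def)
  have fin: "finite W" using V by (auto simp: W_def blowup_parts_def B15_def)
  have P: "x \<in> V i \<longleftrightarrow> x \<in> W \<and> k x = odd i \<and> b x = (2 \<le> i)" if "i < 4" for x i
  proof -
    have "i \<in> {0, 1, 2, 3}" using that by auto
    then show ?thesis unfolding W_def k_def b_def lt4 using disj
      by (elim insertE emptyE; simp; blast)
  qed
  have "part W k b (odd i) (2 \<le> i) = V i" if "i < 4" for i
    using P[OF that] by (auto simp: part_def)
  from this[of 0] this[of 1] this[of 2] this[of 3]
  have "psize W k b False False = real (card (V 0))" "psize W k b True False = real (card (V 1))"
    "psize W k b False True = real (card (V 2))" "psize W k b True True = real (card (V 3))"
    by (simp_all add: psize_def)
  moreover have "blowup B15 V = biclique_pgraph W k b"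
    by (rule blowup_B15_eq[OF W_def]) (rule P)
  ultimately show ?thesis using fin by (intro that)
qed

lemma edit_distance_le_conflicts:
  assumes G: "simple_graph G"
  shows "edit_distance G B15 \<le> card (conflicts (verts G) (pgraph_adj G) (two_bicliques k b))"
proof -
  define V where "V = verts G"
  define H where "H = biclique_pgraph V k b"
  define C where "C = conflicts V (pgraph_adj G) (two_bicliques k b)"
  have fin: "finite V" using G by (simp add: V_def simple_graph_def pattern_def)
  have edge: "\<exists>x y. e = {x, y} \<and> x \<in> V \<and> y \<in> V" if "e \<in> edges G \<union> edges H" for e
    using that G by (auto simp: simple_graph_def pattern_def V_def H_def biclique_pgraph_def)
  have "(edges G - edges H) \<union> (edges H - edges G) \<subseteq> (\<lambda>(x, y). {x, y}) ` C"
  proof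
    fix e assume e: "e \<in> (edges G - edges H) \<union> (edges H - edges G)"
    then obtain x y where xy: "e = {x, y}" "x \<in> V" "y \<in> V" using edge[of e] by blast
    have "{x, y} \<in> edges H \<longleftrightarrow> two_bicliques k b x y"
      using pgraph_adj_biclique_pgraph[of x V y k b] xy by (simp add: pgraph_adj_def H_def)
    then have "(x, y) \<in> C" using e xy by (auto simp: C_def conflicts_def pgraph_adj_def)
    then show "e \<in> (\<lambda>(x, y). {x, y}) ` C" using xy by force
  qed
  then have "card ((edges G - edges H) \<union> (edges H - edges G)) \<le> card C"
    using fin by (intro surj_card_le) (auto simp: C_def)
  moreover have "edit_distance G B15 \<le> card ((edges G - edges H) \<union> (edges H - edges G))"
    unfolding edit_distance_def
  proof (rule cInf_lower)
    have "isomorphic H H"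
      unfolding isomorphic_def isomorphism_def by (rule exI[of _ id]) simp
    moreover have "H \<in> blowups B15" unfolding H_def by (rule biclique_pgraph_is_blowup[OF fin])
    moreover have "simple_graph H" unfolding H_def by (rule simple_biclique_pgraph[OF fin])
    moreover have "verts H = verts G" by (simp add: H_def biclique_pgraph_def V_def)
    ultimately show "card ((edges G - edges H) \<union> (edges H - edges G))
      \<in> {card ((edges G - edges H) \<union> (edges H - edges G)) | H :: 'a pgraph.
          simple_graph H \<and> verts H = verts G \<and> (\<exists>K\<in>(blowups B15 :: 'a pgraph set). isomorphic H K)}"
      by blast
  qed simp
  ultimately show ?thesis by (simp add: C_def V_def)
qed

definition pair_count :: "'a pgraph \<Rightarrow> real" where
  "pair_count G = real (card (graph.cherry_pairs (pgraph_adj G) (verts G)))"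

lemma pair_count_eq:
  assumes G: "simple_graph G" and n: "6 \<le> card (verts G)"
  shows "pair_count G = 8 * ind_density F15 G * real (card (verts G) choose 6)"
proof -
  interpret graph "pgraph_adj G" by (rule graph_pgraph_adj[OF G])
  have "finite (verts G)" using G by (simp add: simple_graph_def pattern_def)
  then show ?thesis using n ind_density_F15[OF G] by (simp add: pair_count_def card_cherry_pairs)
qed

lemma pair_count_biclique_pgraph:
  assumes "finite V"
  shows "pair_count (biclique_pgraph V k b) = real (card (graph.cherry_pairs (two_bicliques k b) V))"
proof -
  have v: "verts (biclique_pgraph V k b) = V" by (simp add: biclique_pgraph_def)
  show ?thesis unfolding pair_count_def v
    using graph.card_cherry_pairs[OF graph_pgraph_adj[OF simple_biclique_pgraph[OF assms]] assms, of k b]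
      graph.card_cherry_pairs[OF graph_two_bicliques assms, of k b] copies_biclique_pgraph[OF assms, of k b]
    by simp
qed

text \<open>The maximum of \<open>pair_count\<close> over graphs with \<open>n \<ge> 6\<close> vertices.\<close>

definition max_pairs :: "nat \<Rightarrow> real" where
  "max_pairs n = 8 * max_density F15 n * real (n choose 6)"

lemma ind_density_le_max: "simple_graph G \<Longrightarrow> ind_density F15 (G :: nat pgraph) \<le> max_density F15 (card (verts G))"
  unfolding max_density_def by (rule Max_ge[OF finite_ind_density_values]) blast

lemma pair_count_le_max_pairs:
  assumes "simple_graph (G :: nat pgraph)" "6 \<le> card (verts G)"
  shows "pair_count G \<le> max_pairs (card (verts G))"
  using ind_density_le_max[OF assms(1)] pair_count_eq[OF assms] by (simp add: max_pairs_def mult_right_mono)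

lemma max_density_attained:
  obtains G :: "nat pgraph" where "simple_graph G" "card (verts G) = n" "max_density F15 n = ind_density F15 G"
proof -
  have "simple_graph ({0..<n}, {})" by (simp add: simple_graph_def pattern_def)
  then have "{ind_density F15 G | G :: nat pgraph. simple_graph G \<and> card (verts G) = n} \<noteq> {}"
    by (metis (mono_tags, lifting) card_atLeastLessThan diff_zero empty_iff fst_conv mem_Collect_eq)
  from Max_in[OF finite_ind_density_values this] show ?thesis
    using that unfolding max_density_def by blast
qed

lemma max_pairs_le:
  assumes "6 \<le> n"
  shows "max_pairs n \<le> pair_bound (real n)"
proof -
  obtain G :: "nat pgraph" where G: "simple_graph G" "card (verts G) = n" "max_density F15 n = ind_density F15 G"
    by (rule max_density_attained)
  have "finite (verts G)" using G by (simp add: simple_graph_def pattern_def)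
  then have "pair_count G \<le> pair_bound (real n)"
    using graph.card_cherry_pairs_le[OF graph_pgraph_adj[OF G(1)], of "verts G"] G(2) by (simp add: pair_count_def)
  then show ?thesis using pair_count_eq[OF G(1)] G assms by (simp add: max_pairs_def)
qed

lemma card_residue_class:
  assumes "r < 4"
  shows "card {x\<in>{0..<n}. x mod 4 = r} = (n + 3 - r) div 4"
proof -
  have "bij_betw (\<lambda>t. 4 * t + r) {..<(n + 3 - r) div 4} {x\<in>{0..<n}. x mod 4 = r}"
  proof (rule bij_betw_byWitness[of _ "\<lambda>x. x div 4"])
    show "\<forall>t\<in>{..<(n + 3 - r) div 4}. (4 * t + r) div 4 = t" using assms by auto
    show "\<forall>x\<in>{x\<in>{0..<n}. x mod 4 = r}. 4 * (x div 4) + r = x" by auto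
    show "(\<lambda>t. 4 * t + r) ` {..<(n + 3 - r) div 4} \<subseteq> {x\<in>{0..<n}. x mod 4 = r}" using assms by auto
    show "(\<lambda>x. x div 4) ` {x\<in>{0..<n}. x mod 4 = r} \<subseteq> {..<(n + 3 - r) div 4}"
    proof clarsimp
      fix x assume "x < n" "r = x mod 4"
      define a where "a = x div 4"
      have "x = 4 * a + r" using \<open>r = x mod 4\<close> by (simp add: a_def)
      then have "4 * Suc a + r \<le> n + 3" using \<open>x < n\<close> by simp
      then have "4 * Suc a \<le> n + 3 - r" by (rule add_le_imp_le_diff)
      then have "Suc a \<le> (n + 3 - r) div 4" by (simp add: less_eq_div_iff_mult_less_eq)
      then show "x div 4 < (n + 3 - x mod 4) div 4" using \<open>r = x mod 4\<close> by (simp add: a_def)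
    qed
  qed
  from bij_betw_same_card[OF this] show ?thesis by simp
qed

lemma max_pairs_ge:
  assumes n: "16 \<le> n"
  shows "pair_bound (real n) - real n ^ 4 \<le> max_pairs n"
proof -
  define V where "V = {0..<n}"
  define k where "k x \<longleftrightarrow> odd x" for x :: nat
  define b where "b x \<longleftrightarrow> 2 \<le> x mod 4" for x :: nat
  have fin: "finite V" by (simp add: V_def)
  have k: "k x \<longleftrightarrow> x mod 4 = 1 \<or> x mod 4 = 3" for x unfolding k_def by presburger
  have b: "b x \<longleftrightarrow> x mod 4 = 2 \<or> x mod 4 = 3" for x unfolding b_def by presburger
  have c: "x mod 4 = 0 \<or> x mod 4 = 1 \<or> x mod 4 = 2 \<or> x mod 4 = 3" for x :: nat by presburger
  have parts: "part V k b True True = {x\<in>{0..<n}. x mod 4 = 3}" "part V k b True False = {x\<in>{0..<n}. x mod 4 = 1}"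
    "part V k b False True = {x\<in>{0..<n}. x mod 4 = 2}" "part V k b False False = {x\<in>{0..<n}. x mod 4 = 0}"
    unfolding part_def V_def k b using c by auto
  have near: "\<bar>real ((n + 3 - r) div 4) - real n / 4\<bar> \<le> 1" if "r < 4" for r
  proof -
    have "4 * ((n + 3 - r) div 4) \<le> n + 4" "n \<le> 4 * ((n + 3 - r) div 4) + 4" using that by linarith+
    then have "4 * real ((n + 3 - r) div 4) \<le> real n + 4" "real n \<le> 4 * real ((n + 3 - r) div 4) + 4" by linarith+
    then show ?thesis by linarith
  qed
  have "\<bar>psize V k b i j - real n / 4\<bar> \<le> 1" for i j
    using near[of 0] near[of 1] near[of 2] near[of 3] unfolding psize_def
    by (cases i; cases j) (simp_all only: parts card_residue_class)
  then have "pair_bound (real n) - real n ^ 4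
     \<le> 2 * biclique_cherries (psize V k b True True) (psize V k b True False)
        * biclique_cherries (psize V k b False True) (psize V k b False False)"
    using n sum_psize[OF fin, of k b] by (intro balanced_bicliques) (auto simp: V_def)
  also have "\<dots> = pair_count (biclique_pgraph V k b)"
    by (simp add: pair_count_biclique_pgraph[OF fin] card_cherry_pairs_two_bicliques[OF fin])
  also have "\<dots> \<le> max_pairs (card (verts (biclique_pgraph V k b)))"
    by (rule pair_count_le_max_pairs[OF simple_biclique_pgraph[OF fin]]) (use n in \<open>simp add: biclique_pgraph_def V_def\<close>)
  finally show ?thesis by (simp add: biclique_pgraph_def V_def)
qed

section \<open>Perfect stability\<close>

text \<open>If the count is far below the bound, the trivial estimate \<open>n\<^sup>2\<close> for the edit distance suffices. Otherwise
  \<open>near_two_bicliques\<close> bounds the number \<open>W\<close> of conflicts by a multiple of \<open>1 + D / n\<^sup>4\<close>, where \<open>D\<close> is the distance to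
  \<open>pair_bound\<close> and exceeds the gap to the true maximum by at most \<open>n\<^sup>4\<close>. This is enough when the gap is at least a
  small multiple of \<open>n\<^sup>4\<close>. For a smaller gap \<open>W\<close> is bounded; if there were any conflict, removing all of them would
  gain a constant multiple of \<open>n\<^sup>4\<close> copies and lose only \<open>O(n\<^sup>3)\<close>, contradicting the small gap. The numerical
  constants are generous powers of ten.\<close>

lemma edit_distance_le_gap:
  assumes G: "simple_graph (G :: nat pgraph)"
  defines "n \<equiv> real (card (verts G))"
  assumes n: "10^40 \<le> n"
  shows "real (edit_distance G B15) * n^4 \<le> 10^26 * (max_pairs (card (verts G)) - pair_count G)"
proof -
  interpret graph "pgraph_adj G" by (rule graph_pgraph_adj[OF G])
  define V where "V = verts G"
  define R where "R = pair_count G"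
  define g where "g = max_pairs (card V) - R"
  define D where "D = pair_bound n - R"
  have fin: "finite V" using G by (simp add: V_def simple_graph_def pattern_def)
  have nV: "n = real (card V)" by (simp add: n_def V_def)
  have Rpairs: "R = real (card (cherry_pairs V))" by (simp add: R_def pair_count_def V_def)
  have card16: "16 \<le> card V" using n unfolding nV by simp
  have g0: "0 \<le> g" using pair_count_le_max_pairs[OF G] card16 by (simp add: g_def R_def V_def)
  have Dg: "D \<le> g + n^4" using max_pairs_ge[OF card16] by (simp add: D_def g_def nV)
  have D0: "0 \<le> D" using card_cherry_pairs_le[OF fin] by (simp add: D_def Rpairs nV)
  have npos: "0 < n" using n by (rule less_le_trans[rotated]) simp
  have n2: "10^12 \<le> n\<^sup>2"
  proof -
    have "(10^6)\<^sup>2 \<le> n\<^sup>2" using n by (intro power_mono) auto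
    then show ?thesis by simp
  qed
  have n46: "n^6 = n^4 * n\<^sup>2" "n^4 = n^3 * n" "n^6 = n^5 * n" by (simp_all add: power_numeral_reduce)
  have edit: "real (edit_distance G B15) \<le> real (card (conflicts V (pgraph_adj G) (two_bicliques k b)))" for k b
    using edit_distance_le_conflicts[OF G, of k b] by (simp add: V_def)
  show ?thesis
  proof (cases "n^6 / 1024 \<le> R \<and> 14 * D / R \<le> 1 / 2")
    case False
    have "n^6 / 600 \<le> pair_bound n"
    proof -
      \<comment> \<open>Asymptotically the bound is \<open>n\<^sup>6 / 512\<close>, so \<open>R < n\<^sup>6 / 1024\<close> is far below it.\<close>
      have "512 / 600 * n\<^sup>2 \<le> (n - 4)\<^sup>2"
      proof -
        have "1000 * n \<le> n * n" using n by (intro mult_right_mono) auto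
        then have "8 * n + 64 / 75 * (n * n) \<le> n * n + 16" using npos by linarith
        then show ?thesis by (simp add: power2_eq_square algebra_simps)
      qed
      then have "n^4 / 512 * (512 / 600 * n\<^sup>2) \<le> n^4 / 512 * (n - 4)\<^sup>2" by (intro mult_left_mono) auto
      also have "\<dots> = pair_bound n" by (simp add: pair_bound_def power2_eq_square power4_eq_xxxx field_simps)
      finally show ?thesis unfolding n46(1) by simp
    qed
    have "n^6 / 30000 \<le> D"
    proof (cases "n^6 / 1024 \<le> R")
      case True
      then have Rpos: "0 < R" using npos by (intro less_le_trans[OF _ True]) simp
      have "1 / 2 < 14 * D / R" using False True by simp
      then have "R / 28 \<le> D" using Rpos by (simp add: field_simps)
      then show ?thesis using True D0 by simp
    next
      case False
      moreover have "0 \<le> n^6" by simp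
      ultimately show ?thesis using \<open>n^6 / 600 \<le> pair_bound n\<close> unfolding D_def by linarith
    qed
    moreover have "n^4 * 60000 \<le> n^6" unfolding n46(1) using n2 by (intro mult_left_mono) auto
    ultimately have gn: "n^6 / 60000 \<le> g" using Dg by linarith
    have "conflicts V (pgraph_adj G) (two_bicliques k b) \<subseteq> V \<times> V" for k b by (auto simp: conflicts_def)
    then have "card (conflicts V (pgraph_adj G) (two_bicliques k b)) \<le> card V * card V" for k b
      using fin card_mono[of "V \<times> V"] by (simp add: card_cartesian_product)
    then have "real (card (conflicts V (pgraph_adj G) (two_bicliques k b))) \<le> n\<^sup>2" for k b
      unfolding nV power2_eq_square of_nat_mult[symmetric] by (simp only: of_nat_le_iff)
    then have "real (edit_distance G B15) \<le> n\<^sup>2" using edit order.trans by blast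
    then have "real (edit_distance G B15) * n^4 \<le> n\<^sup>2 * n^4" using npos by (intro mult_right_mono) auto
    also have "\<dots> = n^6" unfolding n46(1) by (rule mult.commute)
    also have "\<dots> \<le> 60000 * g" using gn by simp
    also have "\<dots> \<le> 10^26 * g" using g0 by simp
    finally show ?thesis by (simp add: g_def R_def V_def)
  next
    case True
    then have R: "n^6 / 1024 \<le> R" and \<eta>: "14 * D / R \<le> 1 / 2" by auto
    have Rpos: "0 < R" using npos by (intro less_le_trans[OF _ R]) simp
    obtain k b where kb: "real (card (conflicts V (pgraph_adj G) (two_bicliques k b))) \<le> 6000 * (1 + 14 * D / R * n\<^sup>2)"
      using near_two_bicliques[OF fin] R \<eta> n unfolding nV[symmetric] Rpairs[symmetric] D_def by fastforce
    define C where "C = conflicts V (pgraph_adj G) (two_bicliques k b)"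
    define W where "W = real (card C)"
    have W: "W * n^4 \<le> 10^8 * (g + n^4)"
    proof -
      have "14 * D / R \<le> 14 * D / (n^6 / 1024)"
        using R D0 npos Rpos by (intro divide_left_mono mult_pos_pos) auto
      then have "14 * D / R * n\<^sup>2 * n^4 \<le> 14 * D / (n^6 / 1024) * n\<^sup>2 * n^4"
        using npos by (intro mult_right_mono) auto
      also have "\<dots> = 14 * D / (n^6 / 1024) * n^6" unfolding n46(1) by (simp only: mult_ac)
      also have "\<dots> = 14336 * D" using npos by simp
      finally have 1: "14 * D / R * n\<^sup>2 * n^4 \<le> 14336 * (g + n^4)" using Dg by simp
      have "W * n^4 \<le> 6000 * (1 + 14 * D / R * n\<^sup>2) * n^4"
        using kb npos by (intro mult_right_mono) (auto simp: W_def C_def)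
      also have "\<dots> = 6000 * (n^4 + 14 * D / R * n\<^sup>2 * n^4)" by (simp add: algebra_simps)
      also have "\<dots> \<le> 6000 * (n^4 + 14336 * (g + n^4))"
        by (intro mult_left_mono add_left_mono 1) simp
      also have "\<dots> \<le> 10^8 * (g + n^4)" using g0 npos by simp
      finally show ?thesis .
    qed
    have editW: "real (edit_distance G B15) * n^4 \<le> W * n^4"
      using edit[of k b] npos by (intro mult_right_mono) (auto simp: W_def C_def)
    show ?thesis
    proof (cases "n^4 \<le> 10^17 * g")
      case True
      then have "10^8 * (g + n^4) \<le> 10^26 * g" using g0 by simp
      then show ?thesis using editW W by (simp add: g_def R_def V_def)
    next
      case False
      then have small: "10^17 * g < n^4" by simp
      have "C = {}"
      proof (rule ccontr)
        assume "C \<noteq> {}"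
        then obtain x y where xy: "(x, y) \<in> C" by auto
        have "x \<in> V" "y \<in> V" "x \<noteq> y"
          using xy adj_irrefl by (auto simp: C_def conflicts_def two_bicliques_def)
        interpret H: graph "two_bicliques k b" by (rule graph_two_bicliques)
        define Q where "Q = real (card (H.cherry_pairs V))"
        have Q: "Q = 8 * real (card (H.copies V))" by (simp add: Q_def H.card_cherry_pairs[OF fin])
        have RC: "R = 8 * real (card (copies V))" by (simp add: Rpairs card_cherry_pairs[OF fin])
        have "10^8 * (g + n^4) \<le> (2 * 10^8) * n^4" using small g0 by simp
        then have "W * n^4 \<le> (2 * 10^8) * n^4" by (rule order.trans[OF W])
        then have W8: "W \<le> 2 * 10^8" using npos by simp
        have "R \<le> Q + 8 * (W * n^4)"
        proof -
          have "real (card (copies V)) \<le> real (card (H.copies V) + card C * card V ^ 4)"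
            using card_copies_le_conflicts[OF fin graph_two_bicliques, of k b]
            unfolding C_def by (simp only: of_nat_le_iff)
          then show ?thesis by (simp add: RC Q W_def nV)
        qed
        also have "\<dots> \<le> Q + 16 * 10^8 * n^4" using \<open>W * n^4 \<le> (2 * 10^8) * n^4\<close> by simp
        also have "16 * 10^8 * n^4 \<le> n^6 / 2048"
        proof -
          have "(10^20)\<^sup>2 \<le> n\<^sup>2" using n by (intro power_mono) auto
          then have "16 * 10^8 * 2048 \<le> n\<^sup>2" by simp
          then have "16 * 10^8 * 2048 * n^4 \<le> n^6"
            unfolding n46(1) mult.commute[of "n^4"] by (rule mult_right_mono) simp
          then show ?thesis by simp
        qed
        finally have "n^6 / 2048 \<le> Q" using R by simp
        have ps: "n / 4096 \<le> psize V k b i j" for i j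
        proof -
          have "n^6 / 2048 \<le> 2 * psize V k b i j * n^5"
            using card_cherry_pairs_le_psize[OF fin, of k b i j] card16 \<open>n^6 / 2048 \<le> Q\<close>
            unfolding Q_def nV by linarith
          then have "n^5 * (n / 2048) \<le> n^5 * (2 * psize V k b i j)"
            unfolding n46(3) by (simp only: mult_ac times_divide_eq_right times_divide_eq_left)
          then have "n / 2048 \<le> 2 * psize V k b i j" using npos by simp
          then show ?thesis by simp
        qed
        \<comment> \<open>The pools in \<open>two_bicliques_copies_through\<close> need \<open>2 m + 2\<close> vertices in each class.\<close>
        define m where "m = nat \<lfloor>n / 10000\<rfloor>"
        have m: "real m \<le> n / 10000" "n / 10000 - 1 \<le> real m" using npos by (auto simp: m_def) linarith
        have m': "n / 20000 \<le> real m" using m(2) n by simp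
        have "2 * m + 2 \<le> card (part V k b i j)" for i j
        proof -
          have "real (2 * m + 2) \<le> real (card (part V k b i j))"
            using m(1) ps[of i j] n by (simp add: psize_def)
          then show ?thesis by (simp only: of_nat_le_iff)
        qed
        then have "m ^ 4 \<le> card {U \<in> H.copies V. x \<in> U \<and> y \<in> U}"
          using two_bicliques_copies_through[OF fin \<open>x \<in> V\<close> \<open>y \<in> V\<close> \<open>x \<noteq> y\<close>] by blast
        then have "card (copies V) + m ^ 4 \<le> card (H.copies V) + (card C)\<^sup>2 * card V ^ 3"
          using card_copies_le_two_bicliques[OF fin xy[unfolded C_def]] unfolding C_def by linarith
        then have "real (card (copies V) + m ^ 4) \<le> real (card (H.copies V) + (card C)\<^sup>2 * card V ^ 3)"
          by (simp only: of_nat_le_iff)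
        then have "R + 8 * real m ^ 4 \<le> Q + 8 * (W\<^sup>2 * n^3)" by (simp add: RC Q W_def nV)
        moreover have "Q \<le> max_pairs (card V)"
        proof -
          have "pair_count (biclique_pgraph V k b) \<le> max_pairs (card (verts (biclique_pgraph V k b)))"
            by (rule pair_count_le_max_pairs[OF simple_biclique_pgraph[OF fin]])
               (use card16 in \<open>simp add: biclique_pgraph_def\<close>)
          then show ?thesis unfolding pair_count_biclique_pgraph[OF fin] Q_def by (simp add: biclique_pgraph_def)
        qed
        ultimately have "8 * real m ^ 4 \<le> g + 8 * (W\<^sup>2 * n^3)" by (simp add: g_def)
        also have "8 * (W\<^sup>2 * n^3) \<le> 8 * ((2 * 10^8)\<^sup>2 * n^3)"
          using W8 npos by (intro mult_left_mono mult_right_mono power_mono) (auto simp: W_def)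
        also have "8 * ((2 * 10^8)\<^sup>2 * n^3) \<le> n^4 / 10^20"
        proof -
          have "8 * (2 * 10^8)\<^sup>2 * 10^20 \<le> n" using n by simp
          then have "8 * (2 * 10^8)\<^sup>2 * 10^20 * n^3 \<le> n^4"
            unfolding n46(2) mult.commute[of "n^3"] using npos by (intro mult_right_mono) auto
          then show ?thesis by simp
        qed
        finally have "8 * real m ^ 4 \<le> g + n^4 / 10^20" by simp
        moreover have "n^4 / 20000^4 \<le> real m ^ 4"
          using power_mono[OF m', of 4] npos by (simp add: power_divide)
        moreover have "0 < n^4" using npos by simp
        moreover have False if "8 * t \<le> g + s / 10^20" "s / 20000^4 \<le> t" "0 < s" "10^17 * g < s" for s t :: real
          using that by simp
        ultimately show False using small by blast
      qed
      then have "W = 0" by (simp add: W_def)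
      then show ?thesis using editW g0 by (simp add: g_def R_def V_def)
    qed
  qed
qed

theorem perfectly_stable_F15: "perfectly_stable F15 B15"
  unfolding perfectly_stable_def
proof (intro exI[of _ "10^40"] conjI allI impI)
  fix G :: "nat pgraph" assume G: "simple_graph G" and n: "10^40 \<le> real (card (verts G))"
  let ?n = "real (card (verts G))"
  define c where "c = real (card (verts G) choose 6)"
  define d where "d = max_density F15 (card (verts G)) - ind_density F15 G"
  have npos: "0 < ?n" using n by (rule less_le_trans[rotated]) simp
  have six: "6 \<le> card (verts G)" using n by simp
  have "max_pairs (card (verts G)) - pair_count G = 8 * (d * c)"
    unfolding max_pairs_def pair_count_eq[OF G six] d_def c_def by (simp add: algebra_simps)
  then have 1: "real (edit_distance G B15) * ?n^4 \<le> 10^26 * (8 * (d * c))"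
    using edit_distance_le_gap[OF G n] by simp
  have d0: "0 \<le> d" using ind_density_le_max[OF G] by (simp add: d_def)
  have "c \<le> ?n^6"
    using binomial_le_pow[OF six] unfolding c_def of_nat_power[symmetric] by (simp only: of_nat_le_iff)
  then have "d * c \<le> d * ?n^6" using d0 by (rule mult_left_mono)
  moreover have "0 \<le> d * ?n^6" using d0 by simp
  moreover have "10^26 * (8 * s) \<le> 10^40 * t" if "s \<le> t" "0 \<le> t" for s t :: real using that by simp
  ultimately have "10^26 * (8 * (d * c)) \<le> 10^40 * (d * ?n^6)" by blast
  also have "\<dots> = 10^40 * d * ?n\<^sup>2 * ?n^4" by (simp add: power_numeral_reduce)
  finally have "real (edit_distance G B15) * ?n^4 \<le> 10^40 * d * ?n\<^sup>2 * ?n^4" using 1 by linarith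
  then show "real (edit_distance G B15) \<le> 10^40 * (max_density F15 (card (verts G)) - ind_density F15 G) * ?n\<^sup>2"
    using npos by (simp add: d_def)
qed simp

section \<open>Limit density and optimal weights\<close>

lemma real_choose_6: "real (n choose 6) = real n * (real n - 1) * (real n - 2) * (real n - 3) * (real n - 4) * (real n - 5) / 720"
proof -
  have "{0..<6} = {0, 1, 2, 3, 4, 5::nat}" by auto
  then show ?thesis
    by (simp add: binomial_gbinomial gbinomial_prod_rev fact_numeral mult_ac)
qed

lemma shifted_ratio_tendsto:
  assumes "(\<lambda>n. f n / real n) \<longlonglongrightarrow> x"
  shows "(\<lambda>n. (f n - c) / real n) \<longlonglongrightarrow> x"
proof -
  have "(\<lambda>n. f n / real n - c / real n) \<longlonglongrightarrow> x - 0"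
    by (intro tendsto_diff assms lim_const_over_n)
  then show ?thesis by (simp add: diff_divide_distrib)
qed

lemma choose_6_tendsto:
  assumes "(\<lambda>n. real (N n) / real n) \<longlonglongrightarrow> 1"
  shows "(\<lambda>n. real (N n choose 6) / real n ^ 6) \<longlonglongrightarrow> 1 / 720"
proof -
  have "(\<lambda>n. real (N n) / real n * ((real (N n) - 1) / real n) * ((real (N n) - 2) / real n)
      * ((real (N n) - 3) / real n) * ((real (N n) - 4) / real n) * ((real (N n) - 5) / real n) / 720)
      \<longlonglongrightarrow> 1 * 1 * 1 * 1 * 1 * 1 / 720"
    by (intro tendsto_divide tendsto_mult shifted_ratio_tendsto assms tendsto_const) simp
  moreover have "real (N n) / real n * ((real (N n) - 1) / real n) * ((real (N n) - 2) / real n)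
      * ((real (N n) - 3) / real n) * ((real (N n) - 4) / real n) * ((real (N n) - 5) / real n) / 720
      = real (N n choose 6) / real n ^ 6" for n
    by (simp add: real_choose_6 power_numeral_reduce)
  ultimately show ?thesis by simp
qed

text \<open>The factor \<open>90 = 720 / 8\<close> converts ordered pairs of ordered cherries, per \<open>n\<^sup>6\<close>, to copies per six-element set.\<close>

lemma density_tendsto:
  assumes "(\<lambda>n. P n / real n ^ 6) \<longlonglongrightarrow> L" "(\<lambda>n. real (N n) / real n) \<longlonglongrightarrow> 1"
  shows "(\<lambda>n. P n / (8 * real (N n choose 6))) \<longlonglongrightarrow> 90 * L"
proof -
  have lim: "(\<lambda>n. (P n / real n ^ 6) / (8 * (real (N n choose 6) / real n ^ 6))) \<longlonglongrightarrow> L / (8 * (1 / 720))"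
    by (intro tendsto_intros assms choose_6_tendsto) simp
  have "\<forall>\<^sub>F n in sequentially. (P n / real n ^ 6) / (8 * (real (N n choose 6) / real n ^ 6))
      = P n / (8 * real (N n choose 6))"
    using eventually_gt_at_top[of 0] by eventually_elim simp
  from Lim_transform_eventually[OF lim this] show ?thesis by (simp add: mult.commute)
qed

lemma self_ratio_tendsto: "(\<lambda>n. real n / real n) \<longlonglongrightarrow> 1"
proof -
  have "\<forall>\<^sub>F n in sequentially. real n / real n = 1"
    using eventually_gt_at_top[of 0] by eventually_elim simp
  then show ?thesis by (rule tendsto_eventually)
qed

theorem max_density_F15_tendsto: "(\<lambda>n. max_density F15 n) \<longlonglongrightarrow> 45 / 256"
proof -
  have lim: "(\<lambda>n. (1 / 2)^4 * (1 / 2 - 2 / real n)\<^sup>2 / 8) \<longlonglongrightarrow> (1 / 2)^4 * (1 / 2 - 0)\<^sup>2 / 8"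
    by (intro tendsto_intros lim_const_over_n) simp
  have "\<forall>\<^sub>F n in sequentially. (1 / 2)^4 * (1 / 2 - 2 / real n)\<^sup>2 / 8 = pair_bound (real n) / real n ^ 6"
    using eventually_gt_at_top[of 0]
    by eventually_elim (simp add: pair_bound_def field_simps power_numeral_reduce)
  from Lim_transform_eventually[OF lim this]
  have upper: "(\<lambda>n. pair_bound (real n) / real n ^ 6) \<longlonglongrightarrow> 1 / 512"
    by (simp add: power2_eq_square power4_eq_xxxx)
  have "(\<lambda>n. 1 / real n * (1 / real n)) \<longlonglongrightarrow> 0 * 0" by (intro tendsto_mult lim_const_over_n)
  then have lim: "(\<lambda>n. pair_bound (real n) / real n ^ 6 - 1 / real n * (1 / real n)) \<longlonglongrightarrow> 1 / 512 - 0"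
    by (intro tendsto_diff upper) simp
  have "\<forall>\<^sub>F n in sequentially. pair_bound (real n) / real n ^ 6 - 1 / real n * (1 / real n)
      = (pair_bound (real n) - real n ^ 4) / real n ^ 6"
    using eventually_gt_at_top[of 0]
    by eventually_elim (simp add: diff_divide_distrib power_numeral_reduce)
  from Lim_transform_eventually[OF lim this]
  have lower: "(\<lambda>n. (pair_bound (real n) - real n ^ 4) / real n ^ 6) \<longlonglongrightarrow> 1 / 512" by simp
  have "(\<lambda>n. max_pairs n / real n ^ 6) \<longlonglongrightarrow> 1 / 512"
  proof (rule tendsto_sandwich[OF _ _ lower upper])
    show "\<forall>\<^sub>F n in sequentially. (pair_bound (real n) - real n ^ 4) / real n ^ 6 \<le> max_pairs n / real n ^ 6"
      using eventually_ge_at_top[of 16] by eventually_elim (intro divide_right_mono max_pairs_ge, auto)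
    show "\<forall>\<^sub>F n in sequentially. max_pairs n / real n ^ 6 \<le> pair_bound (real n) / real n ^ 6"
      using eventually_ge_at_top[of 6] by eventually_elim (intro divide_right_mono max_pairs_le, auto)
  qed
  from density_tendsto[OF this self_ratio_tendsto]
  have lim: "(\<lambda>n. max_pairs n / (8 * real (n choose 6))) \<longlonglongrightarrow> 45 / 256" by simp
  have "\<forall>\<^sub>F n in sequentially. max_pairs n / (8 * real (n choose 6)) = max_density F15 n"
    using eventually_ge_at_top[of 6] by eventually_elim (simp add: max_pairs_def)
  from Lim_transform_eventually[OF lim this] show ?thesis .
qed

text \<open>The limit of \<open>pair_count / n\<^sup>6\<close> for blowups with part sizes \<open>x\<^sub>i n\<close>.\<close>

definition limit_pairs :: "(nat \<Rightarrow> real) \<Rightarrow> real" where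
  "limit_pairs x = 2 * (x 0 * x 2 * (x 0 + x 2)) * (x 1 * x 3 * (x 1 + x 3))"

lemma blowup_ind_density_tendsto:
  fixes V :: "nat \<Rightarrow> nat \<Rightarrow> nat set"
  assumes V: "\<And>n. blowup_parts B15 (V n)"
    and x: "\<And>i. i < 4 \<Longrightarrow> (\<lambda>n. real (card (V n i)) / real n) \<longlonglongrightarrow> x i"
    and sum: "x 0 + x 1 + x 2 + x 3 = 1"
  shows "(\<lambda>n. ind_density F15 (blowup B15 (V n))) \<longlonglongrightarrow> 90 * limit_pairs x"
proof -
  define v where "v i n = real (card (V n i))" for i n
  define G where "G n = blowup B15 (V n)" for n
  define N where "N n = card (verts (G n))" for n
  have G: "simple_graph (G n) \<and> real (N n) = v 0 n + v 1 n + v 2 n + v 3 n \<and>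
      pair_count (G n) = 2 * biclique_cherries (v 0 n) (v 2 n) * biclique_cherries (v 1 n) (v 3 n)" for n
  proof -
    obtain W k b where W: "G n = biclique_pgraph W k b" "finite W"
      "psize W k b False False = v 0 n" "psize W k b True False = v 1 n"
      "psize W k b False True = v 2 n" "psize W k b True True = v 3 n"
      using blowup_B15_parts[OF V[of n]] unfolding G_def v_def by metis
    have "real (N n) = v 0 n + v 1 n + v 2 n + v 3 n"
      using sum_psize[OF W(2), of k b] W by (simp add: N_def biclique_pgraph_def)
    then show ?thesis
      using simple_biclique_pgraph[OF W(2), of k b] pair_count_biclique_pgraph[OF W(2), of k b]
        card_cherry_pairs_two_bicliques[OF W(2), of k b] W
      by (simp add: biclique_cherries_def mult_ac add_ac)
  qed
  have lim: "(\<lambda>n. v i n / real n) \<longlonglongrightarrow> x i" if "i < 4" for i using x[OF that] by (simp add: v_def)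
  have "(\<lambda>n. v 0 n / real n + v 1 n / real n + v 2 n / real n + v 3 n / real n) \<longlonglongrightarrow> x 0 + x 1 + x 2 + x 3"
    by (intro tendsto_add lim) auto
  then have N: "(\<lambda>n. real (N n) / real n) \<longlonglongrightarrow> 1" using G sum by (simp add: add_divide_distrib)
  have bic: "(\<lambda>n. biclique_cherries (v i n) (v j n) / real n ^ 3) \<longlonglongrightarrow> x i * x j * (x i + x j)" if "i < 4" "j < 4" for i j
  proof -
    have "(\<lambda>n. v i n / real n + v j n / real n) \<longlonglongrightarrow> x i + x j"
      by (intro tendsto_add lim that)
    then have "(\<lambda>n. v i n / real n * (v j n / real n) * (((v i n + v j n) - 2) / real n)) \<longlonglongrightarrow> x i * x j * (x i + x j)"
      by (intro tendsto_mult lim that shifted_ratio_tendsto) (simp add: add_divide_distrib)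
    then show ?thesis by (simp add: biclique_cherries_def power3_eq_cube)
  qed
  have "(\<lambda>n. 2 * (biclique_cherries (v 0 n) (v 2 n) / real n ^ 3) * (biclique_cherries (v 1 n) (v 3 n) / real n ^ 3))
     \<longlonglongrightarrow> limit_pairs x"
    unfolding limit_pairs_def by (intro tendsto_intros bic) auto
  moreover have "2 * (biclique_cherries (v 0 n) (v 2 n) / real n ^ 3) * (biclique_cherries (v 1 n) (v 3 n) / real n ^ 3)
     = pair_count (G n) / real n ^ 6" for n
    using G[of n] by (simp add: power_numeral_reduce)
  ultimately have P: "(\<lambda>n. pair_count (G n) / real n ^ 6) \<longlonglongrightarrow> limit_pairs x" by (simp only:)
  have "\<forall>\<^sub>F n in sequentially. 6 \<le> N n"
  proof -
    have "\<forall>\<^sub>F n in sequentially. 1 / 2 < real (N n) / real n"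
      by (rule order_tendstoD(1)[OF N]) simp
    then show ?thesis using eventually_ge_at_top[of 12]
      by eventually_elim (simp add: field_simps)
  qed
  then have "\<forall>\<^sub>F n in sequentially. pair_count (G n) / (8 * real (N n choose 6)) = ind_density F15 (G n)"
  proof eventually_elim
    case (elim n)
    have "simple_graph (G n)" using G by blast
    from pair_count_eq[OF this] elim show ?case by (simp add: N_def)
  qed
  from Lim_transform_eventually[OF density_tendsto[OF P N] this] show ?thesis by (simp add: G_def)
qed

text \<open>Blowups with parts of size \<open>\<lfloor>x\<^sub>i n\<rfloor>\<close> satisfy the convergence condition, so the limit over all such sequences
  is unique; all of them have the same limit by the previous lemma.\<close>

lemma blowup_density_F15:
  assumes x: "x \<in> weights (verts B15)"
  shows "blowup_density F15 B15 x = 90 * limit_pairs x"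
proof -
  have lt4: "{0..<4} = {0, 1, 2, 3::nat}" by auto
  have vB: "verts B15 = {0..<4}" by (simp add: B15_def)
  have nn: "0 \<le> x i" if "i < 4" for i using x that by (auto simp: weights_def B15_def)
  have sum: "x 0 + x 1 + x 2 + x 3 = 1" using x by (simp add: weights_def B15_def lt4)
  define V where "V n i = (\<lambda>t. 4 * t + i) ` {..<nat \<lfloor>x i * real n\<rfloor>}" for n i :: nat
  have card: "card (V n i) = nat \<lfloor>x i * real n\<rfloor>" for n i
    unfolding V_def by (subst card_image) (auto simp: inj_on_def)
  have parts: "blowup_parts B15 (V n)" for n
  proof -
    have "V n i \<inter> V n j = {}" if "i < 4" "j < 4" "i \<noteq> j" for i j
    proof -
      have "z mod 4 = i" if "z \<in> V n i" "i < 4" for z i using that by (auto simp: V_def)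
      then show ?thesis using that by blast
    qed
    then show ?thesis by (auto simp: blowup_parts_def disjoint_family_on_def B15_def V_def)
  qed
  have lim: "(\<lambda>n. real (card (V n i)) / real n) \<longlonglongrightarrow> x i" if i: "i < 4" for i
  proof (rule tendsto_sandwich)
    show "(\<lambda>n. x i - 1 / real n) \<longlonglongrightarrow> x i"
      using tendsto_diff[OF tendsto_const lim_const_over_n, of "x i" 1] by simp
    show "(\<lambda>n. x i) \<longlonglongrightarrow> x i" by simp
    show "\<forall>\<^sub>F n in sequentially. x i - 1 / real n \<le> real (card (V n i)) / real n"
      using eventually_gt_at_top[of 0]
    proof eventually_elim
      case (elim n)
      have "x i * real n - 1 \<le> real (card (V n i))" using nn[OF i] unfolding card by linarith
      then have "(x i * real n - 1) / real n \<le> real (card (V n i)) / real n" by (intro divide_right_mono) auto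
      then show ?case using elim by (simp add: diff_divide_distrib)
    qed
    show "\<forall>\<^sub>F n in sequentially. real (card (V n i)) / real n \<le> x i"
      using eventually_gt_at_top[of 0]
    proof eventually_elim
      case (elim n)
      have "0 \<le> x i * real n" using nn[OF i] by simp
      then have "real (card (V n i)) \<le> x i * real n" unfolding card by linarith
      then show ?case using elim by (simp add: field_simps)
    qed
  qed
  show ?thesis unfolding blowup_density_def
  proof (rule the_equality)
    show "\<forall>V :: nat \<Rightarrow> nat \<Rightarrow> nat set. (\<forall>n. blowup_parts B15 (V n)) \<and>
        (\<forall>i\<in>verts B15. (\<lambda>n. real (card (V n i)) / real n) \<longlonglongrightarrow> x i)
        \<longrightarrow> (\<lambda>n. ind_density F15 (blowup B15 (V n))) \<longlonglongrightarrow> 90 * limit_pairs x"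
    proof (intro allI impI, elim conjE)
      fix V :: "nat \<Rightarrow> nat \<Rightarrow> nat set"
      assume "\<forall>n. blowup_parts B15 (V n)" "\<forall>i\<in>verts B15. (\<lambda>n. real (card (V n i)) / real n) \<longlonglongrightarrow> x i"
      then show "(\<lambda>n. ind_density F15 (blowup B15 (V n))) \<longlonglongrightarrow> 90 * limit_pairs x"
        by (intro blowup_ind_density_tendsto sum) (simp_all add: vB)
    qed
  next
    fix L
    assume "\<forall>V :: nat \<Rightarrow> nat \<Rightarrow> nat set. (\<forall>n. blowup_parts B15 (V n)) \<and>
        (\<forall>i\<in>verts B15. (\<lambda>n. real (card (V n i)) / real n) \<longlonglongrightarrow> x i)
        \<longrightarrow> (\<lambda>n. ind_density F15 (blowup B15 (V n))) \<longlonglongrightarrow> L"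
    then have "(\<lambda>n. ind_density F15 (blowup B15 (V n))) \<longlonglongrightarrow> L"
      using parts lim by (simp add: vB)
    moreover have "(\<lambda>n. ind_density F15 (blowup B15 (V n))) \<longlonglongrightarrow> 90 * limit_pairs x"
      by (rule blowup_ind_density_tendsto[OF parts lim sum])
    ultimately show "L = 90 * limit_pairs x" by (rule LIMSEQ_unique)
  qed
qed

text \<open>With \<open>s = x\<^sub>0 + x\<^sub>2\<close>, the value is \<open>2 p q s (1 - s)\<close> for \<open>p \<le> s\<^sup>2 / 4\<close> and \<open>q \<le> (1 - s)\<^sup>2 / 4\<close>, hence at most
  \<open>(s (1 - s))\<^sup>3 / 8\<close>; equality forces \<open>s = 1 / 2\<close> and equal weights within each component.\<close>

lemma limit_pairs_le:
  assumes nn: "0 \<le> x 0" "0 \<le> x 1" "0 \<le> x 2" "0 \<le> x 3" and sum: "x 0 + x 1 + x 2 + x 3 = 1"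
  shows "limit_pairs x \<le> 1 / 512"
    and "limit_pairs x = 1 / 512 \<Longrightarrow> x 0 = 1 / 4 \<and> x 1 = 1 / 4 \<and> x 2 = 1 / 4 \<and> x 3 = 1 / 4"
proof -
  define p where "p = x 0 * x 2"
  define q where "q = x 1 * x 3"
  define s where "s = x 0 + x 2"
  have s: "x 1 + x 3 = 1 - s" "0 \<le> s" "s \<le> 1" using nn sum by (auto simp: s_def)
  have p: "p = (s\<^sup>2 - (x 0 - x 2)\<^sup>2) / 4" by (simp add: p_def s_def power2_eq_square algebra_simps)
  have q: "q = ((1 - s)\<^sup>2 - (x 1 - x 3)\<^sup>2) / 4"
    unfolding s(1)[symmetric] by (simp add: q_def power2_eq_square algebra_simps)
  have pq: "0 \<le> p" "p \<le> s\<^sup>2 / 4" "0 \<le> q" "q \<le> (1 - s)\<^sup>2 / 4"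
    using nn by (simp add: p_def, simp add: p, simp add: q_def nn, simp add: q)
  have lp: "limit_pairs x = 2 * (p * q * (s * (1 - s)))"
    unfolding limit_pairs_def p_def q_def s_def[symmetric] s(1) by (simp add: mult_ac)
  define y where "y = s * (1 - s)"
  have y: "0 \<le> y" "y = 1 / 4 - (s - 1 / 2)\<^sup>2"
    using s by (simp add: y_def, simp add: y_def power2_eq_square algebra_simps)
  then have y4: "y \<le> 1 / 4" by simp
  have pqy: "p * q \<le> y\<^sup>2 / 16"
  proof -
    have "p * q \<le> (s\<^sup>2 / 4) * ((1 - s)\<^sup>2 / 4)" using pq by (intro mult_mono) auto
    then show ?thesis by (simp add: y_def power_mult_distrib)
  qed
  have "y^3 \<le> (1 / 4)^3" using y y4 by (intro power_mono) auto
  moreover have "p * q * y \<le> y^3 / 16"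
    using mult_right_mono[OF pqy y(1)] by (simp add: power2_eq_square power3_eq_cube)
  ultimately show "limit_pairs x \<le> 1 / 512" unfolding lp y_def[symmetric] by (simp add: power3_eq_cube)
  assume eq: "limit_pairs x = 1 / 512"
  then have "(1 / 4)^3 \<le> y^3"
    using \<open>p * q * y \<le> y^3 / 16\<close> unfolding lp y_def[symmetric] by (simp add: power3_eq_cube)
  have "1 / 4 \<le> y"
  proof (rule ccontr)
    assume "\<not> 1 / 4 \<le> y"
    then have "y^3 < (1 / 4)^3" using y(1) by (intro power_strict_mono) auto
    with \<open>(1 / 4)^3 \<le> y^3\<close> show False by simp
  qed
  then have "(s - 1 / 2)\<^sup>2 \<le> 0" using y(2) by linarith
  then have half: "s = 1 / 2" by simp
  then have "p * q = 1 / 256" using eq unfolding lp half by simp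
  moreover have "p \<le> 1 / 16" "q \<le> 1 / 16" using pq half by (auto simp: power2_eq_square)
  moreover have "p * q \<le> p * (1 / 16)" "p * q \<le> (1 / 16) * q"
    by (rule mult_left_mono[OF \<open>q \<le> 1 / 16\<close> pq(1)], rule mult_right_mono[OF \<open>p \<le> 1 / 16\<close> pq(3)])
  ultimately have "p = 1 / 16" "q = 1 / 16" by linarith+
  then have "(x 0 - x 2)\<^sup>2 = 0" "(x 1 - x 3)\<^sup>2 = 0" using p q half by (auto simp: power2_eq_square)
  then show "x 0 = 1 / 4 \<and> x 1 = 1 / 4 \<and> x 2 = 1 / 4 \<and> x 3 = 1 / 4"
    using half s by (simp add: s_def)
qed

theorem unique_maximiser_F15: "unique_maximiser F15 B15 (\<lambda>i. 1 / 4)"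
proof -
  have lt4: "{0..<4} = {0, 1, 2, 3::nat}" by auto
  have W: "x \<in> weights (verts B15) \<longleftrightarrow>
      0 \<le> x 0 \<and> 0 \<le> x 1 \<and> 0 \<le> x 2 \<and> 0 \<le> x 3 \<and> x 0 + x 1 + x 2 + x 3 = 1" for x
    by (auto simp: weights_def B15_def lt4)
  have quarter: "(\<lambda>i. 1 / 4) \<in> weights (verts B15)" unfolding W by simp
  have val: "blowup_density F15 B15 (\<lambda>i. 1 / 4) = 90 * (1 / 512)"
    unfolding blowup_density_F15[OF quarter] by (simp add: limit_pairs_def)
  have le: "blowup_density F15 B15 y \<le> 90 * (1 / 512)" if "y \<in> weights (verts B15)" for y
    using limit_pairs_le(1)[of y] that unfolding blowup_density_F15[OF that] W by simp
  have "maximiser F15 B15 (\<lambda>i. 1 / 4)" unfolding maximiser_def val using quarter le by blast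
  moreover have "\<exists>\<sigma>. automorphism \<sigma> B15 \<and> (\<forall>i\<in>verts B15. y i = 1 / 4)" if y: "maximiser F15 B15 y" for y
  proof -
    have yW: "y \<in> weights (verts B15)" and "90 * (1 / 512) \<le> blowup_density F15 B15 y"
      using y quarter unfolding maximiser_def val[symmetric] by auto
    then have "limit_pairs y = 1 / 512"
      using limit_pairs_le(1)[of y] unfolding blowup_density_F15[OF yW] W[of y] by simp
    then have "\<forall>i\<in>verts B15. y i = 1 / 4"
      using limit_pairs_le(2)[of y] yW unfolding W by (auto simp: B15_def lt4)
    moreover have "automorphism id B15" by (simp add: isomorphism_def)
    ultimately show ?thesis by blast
  qed
  ultimately show ?thesis unfolding unique_maximiser_def by blast
qed

theorem theorem3p8:
  shows "(\<lambda>n. max_density F15 n) \<longlonglongrightarrow> 45 / 256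
    \<and> perfectly_stable F15 B15
    \<and> unique_maximiser F15 B15 (\<lambda>i. 1 / 4)"
  using max_density_F15_tendsto perfectly_stable_F15 unique_maximiser_F15 by blast

end
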